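(* Let $n\ge 2$, let $X_n=T^*\mathbb{F}l_n$ be the cotangent bundle to the complete flag variety in $\mathbb{C}^n$, and let $V^{(1)}_{\mathbf p}$ be the coefficient of its K-theoretic vertex function (for the identity class) at a torus fixed point $\mathbf p$. Define $$\mathsf V^{(1)}_{\mathbf p}=\prod_{i=1}^n\frac{\theta(\hbar^{i-n}\zeta_i,q)}{\theta(a_i\zeta_i,q)}\cdot V^{(1)}_{\mathbf p}.$$ Then for all fixed points $\mathbf p$ the functions $\mathsf V^{(1)}_{\mathbf p}$ are eigenfunctions of the trigonometric Ruijsenaars–Schneider (tRS) difference operators $T_r(\boldsymbol\zeta)$: $$T_r(\boldsymbol\zeta)\,\mathsf V^{(1)}_{\mathbf p}=e_r(\mathbf a)\,\mathsf V^{(1)}_{\mathbf p},\qquad r=1,\dots,n,$$ where $e_r(\mathbf a)$ is the elementary symmetric polynomial of degree $r$ in $a_1,\dots,a_n$.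
   Context: Parameters: $q,\hbar$ and the equivariant parameters $a_1,\dots,a_n$ (of the maximal torus of the framing group $GL(n)$) are generic nonzero; $t=q/\hbar$; $\boldsymbol\zeta=(\zeta_1,\dots,\zeta_n)$ parameterize the quantum (Kähler) parameters $z_i=\zeta_i/\zeta_{i+1}$. Set $(x,q)_\infty=\prod_{i\ge0}(1-q^ix)$, $(x,q)_d=(x,q)_\infty/(q^dx,q)_\infty$ for $d\in\mathbb Z$ (so $(x,q)_d=\prod_{i=0}^{d-1}(1-q^ix)$ for $d\geq 0$, and $1/(q,q)_d=0$ for $d<0$), and $\theta(x,q)=(x,q)_\infty(qx^{-1},q)_\infty$. Fixed points: a torus fixed point $\mathbf p$ of $X_n$ is a chain of subsets $\mathbf V_1\subset\dots\subset\mathbf V_{n-1}\subset\{a_1,\dots,a_n\}$ with $|\mathbf V_i|=i$; write $\mathbf V_i=\{x_{i,1},\dots,x_{i,i}\}$, and $x_{n,k}=a_k$, $d_{n,k}=0$. Vertex coefficient: $$V^{(1)}_{\mathbf p}=\sum_{\{d_{i,j}\}\in C}\ \prod_{i=1}^{n-1}\left(t\frac{\zeta_i}{\zeta_{i+1}}\right)^{d_i}\prod_{j,k=1}^{i}\frac{\left(q\frac{x_{i,k}}{x_{i,j}},q\right)_{d_{i,j}-d_{i,k}}}{\left(\hbar\frac{x_{i,k}}{x_{i,j}},q\right)_{d_{i,j}-d_{i,k}}}\cdot\prod_{j=1}^{i}\prod_{k=1}^{i+1}\frac{\left(\hbar\frac{x_{i+1,k}}{x_{i,j}},q\right)_{d_{i,j}-d_{i+1,k}}}{\left(q\frac{x_{i+1,k}}{x_{i,j}},q\right)_{d_{i,j}-d_{i+1,k}}},$$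 where $d_i=\sum_{j=1}^i d_{i,j}$ and $C$ is the set of collections of integers $d_{i,j}\ge0$ ($1\le j\le i\le n-1$) such that for each $i=1,\dots,n-2$ there is a subset $\{d_{i+1,j_1},\dots,d_{i+1,j_i}\}$ of cardinality $i$ of $\{d_{i+1,1},\dots,d_{i+1,i+1}\}$ with $d_{i,k}\ge d_{i+1,j_k}$ for all $k$. tRS difference operators: $$T_r(\boldsymbol\zeta)=\sum_{\substack{\mathcal I\subset\{1,\dots,n\}\\|\mathcal I|=r}}\ \prod_{\substack{i\in\mathcal I\\ j\notin\mathcal I}}\frac{\hbar\,\zeta_i-\zeta_j}{\zeta_i-\zeta_j}\ \prod_{i\in\mathcal I}p_i,$$ where the shift operator $p_k$ replaces $\zeta_k$ by $q\zeta_k$, $p_kf(\dots,\zeta_k,\dots)=f(\dots,q\zeta_k,\dots)$.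
   Formalization: As printed it is false (r=n gives ħ^{n(n-1)/2}e_n(a)). Proved with eigenvalue ħ^{r(2n-r-1)/2}e_r(a), with a_i in the theta factors ordered by the fixed point, and with V evaluated at inverse weights 1/x, for |q|<1, generic parameters and small ζ_i/ζ_{i+1}. *)

theory Defs
  imports "HOL-Analysis.Analysis"
begin

definition qpoch_inf :: "complex \<Rightarrow> complex \<Rightarrow> complex" where
  "qpoch_inf x q = (\<Prod>i. 1 - q ^ i * x)"

text \<open>
  For \<open>d < 0\<close> the mathematical value of \<open>(q,q)\<^sub>d\<close> is infinite. Here it is \<open>0\<close>, as division by
  zero is \<open>0\<close>; it occurs only as a denominator, and the quotient is then \<open>0\<close> as intended.
\<close>
definition qpoch :: "complex \<Rightarrow> complex \<Rightarrow> int \<Rightarrow> complex" where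
  "qpoch x q d = qpoch_inf x q / qpoch_inf (q powi d * x) q"

definition qtheta :: "complex \<Rightarrow> complex \<Rightarrow> complex" where
  "qtheta x q = qpoch_inf x q * qpoch_inf (q / x) q"

text \<open>
  A torus fixed point is a chain \<open>V 1 \<subset> \<dots> \<subset> V (n - 1)\<close> of subsets of \<open>{a\<^sub>1, \<dots>, a\<^sub>n}\<close>; the chain is
  completed by \<open>V 0 = {}\<close> and \<open>V n = {a\<^sub>1, \<dots>, a\<^sub>n}\<close>.
\<close>
definition fixed_point :: "nat \<Rightarrow> (nat \<Rightarrow> complex) \<Rightarrow> (nat \<Rightarrow> complex set) \<Rightarrow> bool" where
  "fixed_point n a V \<longleftrightarrow>
     V 0 = {} \<and> V n = a ` {1..n} \<and>
     (\<forall>i\<in>{1..<n}. V i \<subseteq> V (Suc i) \<and> card (V i) = i)"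

definition enumerates :: "nat \<Rightarrow> (nat \<Rightarrow> complex) \<Rightarrow> (nat \<Rightarrow> complex set) \<Rightarrow>
    (nat \<Rightarrow> nat \<Rightarrow> complex) \<Rightarrow> bool" where
  "enumerates n a V x \<longleftrightarrow>
     (\<forall>i\<in>{1..<n}. bij_betw (x i) {1..i} (V i)) \<and> (\<forall>k\<in>{1..n}. x n k = a k)"

text \<open>
  The equivariant parameters in the order in which the fixed point picks them: for
  \<open>V i = {a\<^sub>1, \<dots>, a\<^sub>i}\<close> this is \<open>a\<^sub>i\<close>, see \<open>fp_param_standard\<close> below.
\<close>
definition fp_param :: "(nat \<Rightarrow> complex set) \<Rightarrow> nat \<Rightarrow> complex" where
  "fp_param V i = the_elem (V i - V (i - 1))"

lemma fp_param_standard: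
  assumes "inj_on a {1..n}" "i \<in> {1..n}"
  shows "fp_param (\<lambda>i. a ` {1..i}) i = a i"
proof -
  have "a ` {1..i} - a ` {1..i - 1} = a ` ({1..i} - {1..i - 1})"
    using assms by (intro inj_on_image_set_diff[symmetric, where C = "{1..n}"]) auto
  also have "{1..i} - {1..i - 1} = {i}"
    using assms by auto
  finally show ?thesis
    by (simp add: fp_param_def)
qed

text \<open>
  The summation set \<open>C\<close>. The \<open>d i j\<close> vanish outside the range \<open>1 \<le> j \<le> i \<le> n - 1\<close>; in particular
  \<open>d n k = 0\<close>. The injection \<open>s\<close> lists the indices \<open>j\<^sub>1, \<dots>, j\<^sub>i\<close>.
\<close>
definition vertex_degrees :: "nat \<Rightarrow> (nat \<Rightarrow> nat \<Rightarrow> nat) set" where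
  "vertex_degrees n = {d.
     (\<forall>i j. \<not> (1 \<le> j \<and> j \<le> i \<and> i < n) \<longrightarrow> d i j = 0) \<and>
     (\<forall>i\<in>{1..n - 2}. \<exists>s. inj_on s {1..i} \<and> s ` {1..i} \<subseteq> {1..i + 1} \<and>
        (\<forall>k\<in>{1..i}. d i k \<ge> d (i + 1) (s k)))}"

definition vertex_term :: "complex \<Rightarrow> complex \<Rightarrow> nat \<Rightarrow> (nat \<Rightarrow> nat \<Rightarrow> complex) \<Rightarrow>
    (nat \<Rightarrow> complex) \<Rightarrow> (nat \<Rightarrow> nat \<Rightarrow> nat) \<Rightarrow> complex" where
  "vertex_term q h n x \<zeta> d =
     (\<Prod>i = 1..n - 1.
        (q / h * (\<zeta> i / \<zeta> (i + 1))) ^ (\<Sum>j = 1..i. d i j) *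
        (\<Prod>j = 1..i. \<Prod>k = 1..i.
           qpoch (q * (x i k / x i j)) q (int (d i j) - int (d i k)) /
           qpoch (h * (x i k / x i j)) q (int (d i j) - int (d i k))) *
        (\<Prod>j = 1..i. \<Prod>k = 1..i + 1.
           qpoch (h * (x (i + 1) k / x i j)) q (int (d i j) - int (d (i + 1) k)) /
           qpoch (q * (x (i + 1) k / x i j)) q (int (d i j) - int (d (i + 1) k))))"

definition vertex :: "complex \<Rightarrow> complex \<Rightarrow> nat \<Rightarrow> (nat \<Rightarrow> nat \<Rightarrow> complex) \<Rightarrow>
    (nat \<Rightarrow> complex) \<Rightarrow> complex" where
  "vertex q h n x \<zeta> = infsum (vertex_term q h n x \<zeta>) (vertex_degrees n)"

text \<open>
  Below, \<open>a\<^sub>p\<^sub>,\<^sub>i\<close> stands for \<open>fp_param V i\<close>. The factor \<open>\<theta>(a\<^sub>p\<^sub>,\<^sub>i\<zeta>\<^sub>i)\<close> is \<open>\<theta>(a\<^sub>i\<zeta>\<^sub>i)\<close> at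
  the fixed point \<open>V i = {a\<^sub>1, \<dots>, a\<^sub>i}\<close>; at the other ones the parameters have to be permuted. The
  series \<open>vertex\<close> is evaluated at the inverse weights. Evaluated at \<open>x\<close> itself it goes with
  \<open>\<theta>(\<zeta>\<^sub>i / a\<^sub>p\<^sub>,\<^sub>i)\<close>, and the eigenvalues are then symmetric functions of the \<open>1 / a\<^sub>i\<close>; combined
  with \<open>\<theta>(a\<^sub>p\<^sub>,\<^sub>i\<zeta>\<^sub>i)\<close> it violates the equation for \<open>T\<^sub>1\<close> in first order in \<open>\<zeta>\<^sub>1 / \<zeta>\<^sub>2\<close>.
\<close>
definition dressed_vertex :: "complex \<Rightarrow> complex \<Rightarrow> nat \<Rightarrow> (nat \<Rightarrow> complex set) \<Rightarrow>
    (nat \<Rightarrow> nat \<Rightarrow> complex) \<Rightarrow> (nat \<Rightarrow> complex) \<Rightarrow> complex" where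
  "dressed_vertex q h n V x \<zeta> =
     (\<Prod>i = 1..n. qtheta (h powi (int i - int n) * \<zeta> i) q / qtheta (fp_param V i * \<zeta> i) q) *
     vertex q h n (\<lambda>i j. inverse (x i j)) \<zeta>"

definition shift :: "complex \<Rightarrow> nat set \<Rightarrow> (nat \<Rightarrow> complex) \<Rightarrow> nat \<Rightarrow> complex" where
  "shift q I \<zeta> = (\<lambda>k. if k \<in> I then q * \<zeta> k else \<zeta> k)"

text \<open>The product of the commuting operators \<open>p\<^sub>i\<close>, \<open>i \<in> I\<close>, is precomposition with \<open>shift q I\<close>.\<close>
definition tRS :: "complex \<Rightarrow> complex \<Rightarrow> nat \<Rightarrow> nat \<Rightarrow> ((nat \<Rightarrow> complex) \<Rightarrow> complex) \<Rightarrow>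
    (nat \<Rightarrow> complex) \<Rightarrow> complex" where
  "tRS q h n r f \<zeta> =
     (\<Sum>I | I \<subseteq> {1..n} \<and> card I = r.
        (\<Prod>i\<in>I. \<Prod>j\<in>{1..n} - I. (h * \<zeta> i - \<zeta> j) / (\<zeta> i - \<zeta> j)) * f (shift q I \<zeta>))"

definition elem_sym :: "nat \<Rightarrow> nat \<Rightarrow> (nat \<Rightarrow> complex) \<Rightarrow> complex" where
  "elem_sym n r a = (\<Sum>I | I \<subseteq> {1..n} \<and> card I = r. \<Prod>i\<in>I. a i)"

text \<open>
  The power of \<open>h\<close> in the eigenvalue of \<open>T\<^sub>r\<close>. It is forced by the normalisations of \<open>tRS\<close> and
  of the theta factors: for \<open>r = n\<close>, where \<open>T\<^sub>n = p\<^sub>1 \<cdots> p\<^sub>n\<close> leaves all \<open>\<zeta>\<^sub>i / \<zeta>\<^sub>j\<close> alone, the rule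
  \<open>\<theta>(q y) = - \<theta>(y) / y\<close> gives the eigenvalue \<open>\<Prod>\<^sub>i h\<^bsup>n-i\<^esup> a\<^sub>i = h\<^bsup>n(n-1)/2\<^esup> e\<^sub>n(a)\<close>.
\<close>
definition tRS_exponent :: "nat \<Rightarrow> nat \<Rightarrow> nat" where
  "tRS_exponent n r = r * (2 * n - r - 1) div 2"

text \<open>Explicit genericity: no numerator or denominator in the vertex degenerates.\<close>
definition generic_params :: "nat \<Rightarrow> complex \<Rightarrow> complex \<Rightarrow> (nat \<Rightarrow> complex) \<Rightarrow> bool" where
  "generic_params n q h a \<longleftrightarrow>
     q \<noteq> 0 \<and> norm q < 1 \<and> h \<noteq> 0 \<and> (\<forall>i\<in>{1..n}. a i \<noteq> 0) \<and>
     (\<forall>i\<in>{1..n}. \<forall>j\<in>{1..n}. \<forall>m::int. i \<noteq> j \<longrightarrow> a i / a j \<noteq> q powi m) \<and>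
     (\<forall>i\<in>{1..n}. \<forall>j\<in>{1..n}. \<forall>m::int. h * (a i / a j) \<noteq> q powi m)"

text \<open>
  The region where the series in \<open>\<zeta>\<^sub>i / \<zeta>\<^sub>i\<^sub>+\<^sub>1\<close> are considered, away from the poles of the
  theta factors.
\<close>
definition vertex_region :: "nat \<Rightarrow> complex \<Rightarrow> (nat \<Rightarrow> complex) \<Rightarrow> real \<Rightarrow> (nat \<Rightarrow> complex) set" where
  "vertex_region n q a \<epsilon> = {\<zeta>.
     (\<forall>i\<in>{1..n}. \<zeta> i \<noteq> 0) \<and>
     (\<forall>i\<in>{1..<n}. norm (\<zeta> i / \<zeta> (i + 1)) < \<epsilon>) \<and>
     (\<forall>i\<in>{1..n}. \<forall>j\<in>{1..n}. \<forall>m::int. a i * \<zeta> j \<noteq> q powi m)}"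

end

theory Submission
  imports Defs "HOL-Computational_Algebra.Polynomial" "HOL-Computational_Algebra.Formal_Power_Series"
begin

text \<open>
  The vertex series is built one rank at a time. Put \<open>s = h / q\<close>, let a lattice point
  \<open>m \<in> \<int>\<^sup>k\<close> stand for the spectral points \<open>\<alpha>\<^sub>i q\<^bsup>m\<^sub>i\<^esup>\<close>, where the \<open>\<alpha>\<^sub>i\<close> are the equivariant
  parameters in the order in which the fixed point picks them, and define \<open>\<Psi>\<^sub>0 = 1\<close>,
  \<open>\<Psi>\<^sub>k\<^sub>+\<^sub>1(m; \<zeta>) = \<Sum>\<^sub>d s\<^bsup>-|d|\<^esup> \<zeta>\<^sub>k\<^sub>+\<^sub>1\<^bsup>|m|-|d|\<^esup> W(m, d) \<Psi>\<^sub>k(d; \<zeta>)\<close>, the sum being over \<open>d \<in> \<int>\<^sup>k\<close>. The weight \<open>W\<close> is a ratio of products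
  of values of \<open>\<omega>(X) = (qX)\<^sub>\<infinity> / (hX)\<^sub>\<infinity>\<close>. All factors of a vertex term are ratios of values of \<open>\<omega>\<close>, so
  the vertex function is a constant multiple of \<open>\<Psi>\<^sub>n(0; \<zeta>)\<close> (lemma \<open>vertex_sum\<close>). What is to be
  proved becomes a statement about \<open>\<Psi>\<close> that makes sense at every lattice point and in every rank,
  and that can therefore be proved by induction on the rank.

  Two families of operators act on \<open>\<Psi>\<close>. Shifts of the lattice point realise multiplication by the
  elementary symmetric functions of \<open>\<zeta>\<close> (the Pieri rule \<open>pieri\<close>). Shifts \<open>\<zeta>\<^sub>i \<mapsto> q \<zeta>\<^sub>i\<close> are to
  realise multiplication by the elementary symmetric functions of the spectral points (theorem
  \<open>eigenvalue_equation\<close>, in which the operators are collected into a polynomial in \<open>u\<close>). The Pieri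
  rule is an induction on the rank whose step is the duality of Kajihara and Noumi between two
  finite sums over subsets (\<open>kernel_identity\<close>).

  For the eigenvalue equation in rank \<open>k + 1\<close>, split the sum over subsets \<open>I\<close> of \<open>{1, \<dots>, k + 1}\<close>
  according to whether \<open>k + 1 \<in> I\<close>. After the branching sum is inserted, both halves are instances,
  at \<open>v = 1 / \<zeta>\<^sub>k\<^sub>+\<^sub>1\<close> and at \<open>v = 1 / (h \<zeta>\<^sub>k\<^sub>+\<^sub>1)\<close>, of a sum over \<open>I \<subseteq> {1, \<dots>, k}\<close> with the additional
  factor \<open>\<Prod>\<^sub>i (1 - v h\<^bsup>[i \<in> I]\<^esup> \<zeta>\<^sub>i)\<close>. This refined sum is again a combination of shifts of the lattice
  point (\<open>two_parameter_refinement\<close>). The reason is that the Pieri rule also expresses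
  multiplication by the coefficients of \<open>G(X) = \<Prod>\<^sub>i (h \<zeta>\<^sub>i X)\<^sub>\<infinity> / (\<zeta>\<^sub>i X)\<^sub>\<infinity>\<close> through lattice shifts,
  and that \<open>\<Prod>\<^sub>i (1 - h\<^bsup>[i \<in> I]\<^esup> \<zeta>\<^sub>i X) \<cdot> G(X)\<close>, with \<open>\<zeta>\<^sub>i\<close> replaced by \<open>q \<zeta>\<^sub>i\<close> in \<open>G\<close> for \<open>i \<in> I\<close>,
  does not depend on \<open>I\<close>: multiplied by \<open>G\<close>, the refined sum collapses to the eigenvalue equation
  itself. Once the lattice shifts are moved onto the weight by reindexing the branching sum, what
  remains is an identity between the terms at each single lattice point, an alternating sum over
  subsets that Lagrange interpolation splits into pairs cancelling each other
  (\<open>alternating_sum_zero\<close>).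

  Finally \<open>\<theta>(q y) = - \<theta>(y) / y\<close> turns the prefactor of the dressed vertex into the factors
  \<open>\<alpha>\<^sub>i h\<^bsup>n-i\<^esup>\<close>, one for each shifted variable, and the equation for \<open>T\<^sub>r\<close> is the coefficient of \<open>u\<^sup>r\<close>.
  The series converge absolutely for small ratios \<open>\<zeta>\<^sub>i / \<zeta>\<^sub>j\<close>, \<open>i < j\<close>, because the weights grow at
  most geometrically in \<open>m\<close> and \<open>d\<close>.
\<close>

section \<open>Vandermonde ratios and Lagrange interpolation\<close>

lemma sum_Pow_insert:
  assumes "finite A" "n \<notin> A"
  shows "(\<Sum>J\<in>Pow (insert n A). f J) = (\<Sum>J\<in>Pow A. f J + f (insert n J))"
proof -
  have "(\<Sum>J\<in>Pow (insert n A). f J) = (\<Sum>J\<in>Pow A. f J) + (\<Sum>J\<in>insert n ` Pow A. f J)"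
    unfolding Pow_insert using assms by (intro sum.union_disjoint) auto
  also have "(\<Sum>J\<in>insert n ` Pow A. f J) = (\<Sum>J\<in>Pow A. f (insert n J))"
    using assms by (subst sum.reindex) (auto simp: inj_on_def)
  finally show ?thesis
    by (simp add: sum.distrib)
qed

text \<open>
  The index set of a Vandermonde product. The order only selects one representative of each
  unordered pair: all products taken over it are symmetric.
\<close>
definition ordered_pairs :: "nat set \<Rightarrow> (nat \<times> nat) set" where
  "ordered_pairs N = {(i, j). i \<in> N \<and> j \<in> N \<and> i < j}"

lemma finite_ordered_pairs [simp]: "finite N \<Longrightarrow> finite (ordered_pairs N)"
  unfolding ordered_pairs_def by (rule finite_subset[of _ "N \<times> N"]) auto

lemma prod_ordered_pairs_insert:
  fixes f :: "nat \<Rightarrow> nat \<Rightarrow> complex"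
  assumes "finite S" "n \<notin> S" and sym: "\<And>i. i \<in> S \<Longrightarrow> f n i = f i n"
  shows "(\<Prod>(i, j)\<in>ordered_pairs (insert n S). f i j) =
    (\<Prod>(i, j)\<in>ordered_pairs S. f i j) * (\<Prod>i\<in>S. f i n)"
proof -
  have *: "ordered_pairs (insert n S) =
      ordered_pairs S \<union> ((\<lambda>i. (i, n)) ` {i\<in>S. i < n} \<union> (\<lambda>i. (n, i)) ` {i\<in>S. n < i})"
    by (auto simp: ordered_pairs_def)
  have "(\<Prod>(i, j)\<in>ordered_pairs (insert n S). f i j) = (\<Prod>(i, j)\<in>ordered_pairs S. f i j) *
      (\<Prod>(i, j)\<in>((\<lambda>i. (i, n)) ` {i\<in>S. i < n} \<union> (\<lambda>i. (n, i)) ` {i\<in>S. n < i}). f i j)"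
    unfolding *
  proof (intro prod.union_disjoint)
    show "ordered_pairs S \<inter> ((\<lambda>i. (i, n)) ` {i\<in>S. i < n} \<union> (\<lambda>i. (n, i)) ` {i\<in>S. n < i}) = {}"
      using assms(2) unfolding ordered_pairs_def by blast
  qed (use assms(1) in simp_all)
  also have "(\<Prod>(i, j)\<in>((\<lambda>i. (i, n)) ` {i\<in>S. i < n} \<union> (\<lambda>i. (n, i)) ` {i\<in>S. n < i}). f i j) =
      (\<Prod>(i, j)\<in>(\<lambda>i. (i, n)) ` {i\<in>S. i < n}. f i j) * (\<Prod>(i, j)\<in>(\<lambda>i. (n, i)) ` {i\<in>S. n < i}. f i j)"
    using assms(1,2) by (intro prod.union_disjoint) auto
  also have "\<dots> = (\<Prod>i\<in>{i\<in>S. i < n}. f i n) * (\<Prod>i\<in>{i\<in>S. n < i}. f n i)"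
    by (subst (1 2) prod.reindex) (auto simp: inj_on_def)
  also have "(\<Prod>i\<in>{i\<in>S. n < i}. f n i) = (\<Prod>i\<in>{i\<in>S. n < i}. f i n)"
    using sym by (intro prod.cong) auto
  also have "(\<Prod>i\<in>{i\<in>S. i < n}. f i n) * (\<Prod>i\<in>{i\<in>S. n < i}. f i n) =
      (\<Prod>i\<in>{i\<in>S. i < n} \<union> {i\<in>S. n < i}. f i n)"
    using assms(1) by (subst prod.union_disjoint) auto
  also have "{i\<in>S. i < n} \<union> {i\<in>S. n < i} = S"
    using assms(2) by (auto simp: not_less_iff_gr_or_eq)
  finally show ?thesis .
qed

definition vandermonde_ratio :: "nat set \<Rightarrow> (nat \<Rightarrow> complex) \<Rightarrow> (nat \<Rightarrow> complex) \<Rightarrow> complex" where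
  "vandermonde_ratio N y z = (\<Prod>(i, j)\<in>ordered_pairs N. (y i - y j) / (z i - z j))"

lemma vandermonde_ratio_insert:
  assumes "finite S" "n \<notin> S"
  shows "vandermonde_ratio (insert n S) y z =
    vandermonde_ratio S y z * (\<Prod>i\<in>S. (y i - y n) / (z i - z n))"
proof -
  have "(y n - y i) / (z n - z i) = (y i - y n) / (z i - z n)" for i
    using minus_divide_divide[of "y i - y n" "z i - z n"] by simp
  then show ?thesis
    unfolding vandermonde_ratio_def
    using assms by (intro prod_ordered_pairs_insert) auto
qed

lemma vandermonde_ratio_cong:
  assumes "\<And>i. i \<in> N \<Longrightarrow> y i = y' i" "\<And>i. i \<in> N \<Longrightarrow> z i = z' i"
  shows "vandermonde_ratio N y z = vandermonde_ratio N y' z'"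
  unfolding vandermonde_ratio_def using assms by (intro prod.cong) (auto simp: ordered_pairs_def)

lemma shift_in [simp]: "i \<in> J \<Longrightarrow> shift c J x i = c * x i"
  and shift_notin [simp]: "i \<notin> J \<Longrightarrow> shift c J x i = x i"
  and shift_empty [simp]: "shift c {} x = x"
  by (auto simp: shift_def)

lemma shift_insert_other [simp]: "i \<noteq> n \<Longrightarrow> shift c (insert n J) x i = shift c J x i"
  by (auto simp: shift_def)

lemma lagrange_interpolation:
  fixes p :: "complex poly"
  assumes "finite S" "inj_on x S" "degree p < card S"
  shows "poly p z = (\<Sum>i\<in>S. poly p (x i) * (\<Prod>j\<in>S - {i}. (z - x j) / (x i - x j)))"
proof -
  define L where "L i = (\<Prod>j\<in>S - {i}. smult (1 / (x i - x j)) [:- x j, 1:])" for i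
  define r where "r = (\<Sum>i\<in>S. smult (poly p (x i)) (L i))"
  have poly_L: "poly (L i) w = (\<Prod>j\<in>S - {i}. (w - x j) / (x i - x j))" for i w
    unfolding L_def by (simp add: poly_prod algebra_simps diff_divide_distrib)
  have poly_r: "poly r w = (\<Sum>i\<in>S. poly p (x i) * (\<Prod>j\<in>S - {i}. (w - x j) / (x i - x j)))" for w
    unfolding r_def by (simp add: poly_sum poly_L)
  have degL: "degree (L i) < card S" if "i \<in> S" for i
  proof -
    have "degree (L i) \<le> sum (degree \<circ> (\<lambda>j. smult (1 / (x i - x j)) [:- x j, 1:])) (S - {i})"
      unfolding L_def by (rule degree_prod_sum_le) (use assms in auto)
    also have "\<dots> \<le> (\<Sum>j\<in>S - {i}. 1)"
      by (intro sum_mono) (auto intro: order_trans[OF degree_smult_le])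
    also have "\<dots> = card (S - {i})" by simp
    also have "\<dots> < card S" using that assms(1) by (intro psubset_card_mono) auto
    finally show ?thesis .
  qed
  have "degree r < card S"
    unfolding r_def using assms degL
    by (intro degree_sum_less) (auto intro: le_less_trans[OF degree_smult_le])
  have nodes: "poly r (x k) = poly p (x k)" if "k \<in> S" for k
  proof -
    have "(\<Prod>j\<in>S - {i}. (x k - x j) / (x i - x j)) = (if i = k then 1 else 0)" if "i \<in> S" for i
    proof (cases "i = k")
      case True
      show ?thesis
      proof -
        have "(x k - x j) / (x i - x j) = 1" if "j \<in> S - {i}" for j
        proof -
          have "x k \<noteq> x j"
            using inj_onD[OF assms(2), of k j] \<open>k \<in> S\<close> that True by auto
          then show ?thesis using True by simp
        qed
        then have "(\<Prod>j\<in>S - {i}. (x k - x j) / (x i - x j)) = 1"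
          by (intro prod.neutral) blast
        with True show ?thesis by simp
      qed
    next
      case False
      then show ?thesis using assms(1) \<open>k \<in> S\<close> by (auto intro!: prod_zero)
    qed
    then have "poly r (x k) = (\<Sum>i\<in>S. poly p (x i) * (if i = k then 1 else 0))"
      unfolding poly_r by (intro sum.cong) auto
    also have "\<dots> = poly p (x k)" using assms(1) that by (simp add: sum.delta if_distrib cong: if_cong)
    finally show ?thesis .
  qed
  have "p = r"
  proof (rule ccontr)
    assume "p \<noteq> r"
    then have ne: "p - r \<noteq> 0" by simp
    have "x ` S \<subseteq> {w. poly (p - r) w = 0}" using nodes by auto
    then have "card (x ` S) \<le> card {w. poly (p - r) w = 0}"
      using poly_roots_finite[OF ne] by (rule card_mono[rotated])
    also have "\<dots> \<le> degree (p - r)" using ne by (rule card_poly_roots_bound)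
    also have "\<dots> < card S"
      using assms(3) \<open>degree r < card S\<close> by (rule degree_diff_less)
    finally show False using card_image[OF assms(2)] by simp
  qed
  then show ?thesis using poly_r[of z] by (simp only:)
qed

lemma lagrange_prod:
  fixes x y :: "nat \<Rightarrow> complex"
  assumes "finite S" "inj_on x S" "finite T" "card T < card S"
  shows "(\<Prod>i\<in>T. y i - z) =
    (\<Sum>i\<in>S. (\<Prod>k\<in>T. y k - x i) * (\<Prod>j\<in>S - {i}. (z - x j) / (x i - x j)))"
proof -
  define p where "p = (\<Prod>i\<in>T. [:y i, -1:])"
  have "degree p \<le> sum (degree \<circ> (\<lambda>i. [:y i, -1:])) T"
    unfolding p_def by (rule degree_prod_sum_le) fact
  then have "degree p < card S" using assms(4) by simp
  moreover have "poly p w = (\<Prod>i\<in>T. y i - w)" for w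
    unfolding p_def by (simp add: poly_prod)
  ultimately show ?thesis using lagrange_interpolation[of S x p z] assms by simp
qed

section \<open>The kernel identity\<close>

text \<open>
  The coefficients of the kernel identity: one point set is shifted, by \<open>1 / s\<close> on the left and by
  \<open>s\<close> on the right, and the Cauchy product \<open>\<Prod> (a\<^sub>i - b\<^sub>k)\<close> is compared with its shift. The right
  coefficients are also those by which a lattice shift changes the weight \<open>W\<close>, see \<open>weight_shift\<close>.
\<close>
definition kernel_weight_left :: "complex \<Rightarrow> nat set \<Rightarrow> nat set \<Rightarrow> (nat \<Rightarrow> complex) \<Rightarrow> (nat \<Rightarrow> complex) \<Rightarrow> nat set \<Rightarrow> complex" where
  "kernel_weight_left s A B a b J = vandermonde_ratio A (shift (1 / s) J a) a *
     (\<Prod>i\<in>J. \<Prod>k\<in>B. (a i - b k) / (a i / s - b k))"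

definition kernel_weight_right :: "complex \<Rightarrow> nat set \<Rightarrow> nat set \<Rightarrow> (nat \<Rightarrow> complex) \<Rightarrow> (nat \<Rightarrow> complex) \<Rightarrow> nat set \<Rightarrow> complex" where
  "kernel_weight_right s A B a b K = vandermonde_ratio B (shift s K b) b *
     (\<Prod>k\<in>K. \<Prod>i\<in>A. (a i - b k) / (a i - s * b k))"

text \<open>
  The summands of the partial fraction expansion of \<open>1\<close> that comes from interpolating
  \<open>\<Prod>\<^sub>i (a\<^sub>i - z)\<close> at the nodes \<open>b\<^sub>j\<close> and evaluating at \<open>z = a\<^sub>n\<close>.
\<close>
definition cauchy_weight :: "nat \<Rightarrow> nat set \<Rightarrow> nat set \<Rightarrow> (nat \<Rightarrow> complex) \<Rightarrow> (nat \<Rightarrow> complex) \<Rightarrow> nat \<Rightarrow> complex" where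
  "cauchy_weight n A B a b j =
     (\<Prod>k\<in>B - {j}. (a n - b k) / (b j - b k)) * (\<Prod>i\<in>A. (a i - b j) / (a i - a n))"

lemma sum_cauchy_weight:
  assumes "finite A" "n \<notin> A" "finite B" "card B = Suc (card A)" "inj_on a (insert n A)" "inj_on b B"
  shows "(\<Sum>j\<in>B. cauchy_weight n A B a b j) = 1"
proof -
  have nz: "(\<Prod>i\<in>A. a i - a n) \<noteq> 0"
    unfolding prod_zero_iff[OF assms(1)] using assms by (auto simp: inj_on_def)
  have "(\<Prod>i\<in>A. a i - a n) =
      (\<Sum>j\<in>B. (\<Prod>k\<in>A. a k - b j) * (\<Prod>k\<in>B - {j}. (a n - b k) / (b j - b k)))"
    using assms by (intro lagrange_prod) auto
  also have "\<dots> = (\<Sum>j\<in>B. cauchy_weight n A B a b j) * (\<Prod>i\<in>A. a i - a n)"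
    unfolding sum_distrib_right cauchy_weight_def using nz
    by (intro sum.cong) (simp_all add: prod_dividef)
  finally show ?thesis using nz by simp
qed

text \<open>
  Multiplying a coefficient by the Cauchy weight of the shifted points removes the pair
  \<open>(a\<^sub>n, b\<^sub>j)\<close>. The factor left over is the Cauchy weight of the original points, up to a quotient that
  depends only on whether \<open>a\<^sub>n\<close> is shifted; this is what makes the induction in \<open>kernel_identity\<close>
  work.
\<close>
lemma kernel_weight_left_step:
  assumes "finite A" "n \<notin> A" "finite B" "j \<in> B" "J \<subseteq> A" "s \<noteq> 0"
    and a: "\<And>i i'. i \<in> insert n A \<Longrightarrow> i' \<in> insert n A \<Longrightarrow> i \<noteq> i' \<Longrightarrow> a i \<noteq> a i' \<and> a i \<noteq> s * a i'"
    and b: "\<And>k k'. k \<in> B \<Longrightarrow> k' \<in> B \<Longrightarrow> k \<noteq> k' \<Longrightarrow> b k \<noteq> b k' \<and> b k \<noteq> s * b k'"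
    and ab: "\<And>i k. i \<in> insert n A \<Longrightarrow> k \<in> B \<Longrightarrow> a i \<noteq> s * b k"
  shows "kernel_weight_left s (insert n A) B a b J * cauchy_weight n A B (shift (1 / s) J a) b j =
      cauchy_weight n A B a b j * kernel_weight_left s A (B - {j}) a b J" (is ?th1)
    and "kernel_weight_left s (insert n A) B a b (insert n J) *
        cauchy_weight n A B (shift (1 / s) (insert n J) a) b j =
      cauchy_weight n A B a b j * ((a n - b j) / (a n / s - b j)) *
        kernel_weight_left s A (B - {j}) a b J" (is ?th2)
proof -
  have finJ: "finite J" using assms finite_subset by blast
  have nJ: "n \<notin> J" using assms by auto
  let ?a = "shift (1 / s) J a"
  have eq: "shift (1 / s) (insert n J) a i = ?a i" if "i \<in> A" for i
    using that assms(2) by (metis shift_insert_other)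
  have abd: "a i / s \<noteq> b k" if "i \<in> insert n A" "k \<in> B" for i k
    using ab[OF that] \<open>s \<noteq> 0\<close> by (auto simp: field_simps)
  have B: "(\<Prod>i\<in>J. \<Prod>k\<in>B. (a i - b k) / (a i / s - b k)) =
     (\<Prod>i\<in>J. (a i - b j) / (a i / s - b j)) * (\<Prod>i\<in>J. \<Prod>k\<in>B - {j}. (a i - b k) / (a i / s - b k))"
    unfolding prod.distrib[symmetric] using assms(3,4) by (intro prod.cong refl) (simp add: prod.remove)
  have key: "(\<Prod>i\<in>A. ?a i - b j) * (\<Prod>i\<in>J. (a i - b j) / (a i / s - b j)) = (\<Prod>i\<in>A. a i - b j)"
  proof -
    have "(\<Prod>i\<in>J. (a i - b j) / (a i / s - b j)) = (\<Prod>i\<in>A. if i \<in> J then (a i - b j) / (a i / s - b j) else 1)"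
      using assms(1,5) by (simp add: prod.If_cases Int_absorb1)
    then have "(\<Prod>i\<in>A. ?a i - b j) * (\<Prod>i\<in>J. (a i - b j) / (a i / s - b j)) =
      (\<Prod>i\<in>A. (?a i - b j) * (if i \<in> J then (a i - b j) / (a i / s - b j) else 1))"
      by (simp add: prod.distrib)
    also have "\<dots> = (\<Prod>i\<in>A. a i - b j)"
      using abd[OF _ \<open>j \<in> B\<close>] by (intro prod.cong) (auto simp: shift_def)
    finally show ?thesis .
  qed
  have nz1: "(\<Prod>i\<in>A. ?a i - a n) \<noteq> 0"
    using a[of _ n] assms(1,2,6) by (auto simp: shift_def field_simps)
  have nz2: "(\<Prod>i\<in>A. ?a i - a n / s) \<noteq> 0"
    using a assms(1,2,6) by (auto simp: shift_def field_simps)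
      (metis a insertCI mult.commute)+
  have nz3: "(\<Prod>k\<in>B - {j}. a n / s - b k) \<noteq> 0"
    using abd assms(3) by auto
  have nz4: "a n / s - b j \<noteq> 0" using abd[of n j] assms(4) by auto
  have vr1: "vandermonde_ratio (insert n A) ?a a = vandermonde_ratio A ?a a *
       (\<Prod>i\<in>A. ?a i - a n) / (\<Prod>i\<in>A. a i - a n)"
    using assms(1,2) nJ by (simp add: vandermonde_ratio_insert prod_dividef)
  have vr2: "vandermonde_ratio (insert n A) (shift (1 / s) (insert n J) a) a = vandermonde_ratio A ?a a *
       (\<Prod>i\<in>A. ?a i - a n / s) / (\<Prod>i\<in>A. a i - a n)"
  proof -
    have "vandermonde_ratio A (shift (1 / s) (insert n J) a) a = vandermonde_ratio A ?a a"
      by (intro vandermonde_ratio_cong) (simp_all add: eq)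
    moreover have "(\<Prod>i\<in>A. (shift (1 / s) (insert n J) a i - shift (1 / s) (insert n J) a n) / (a i - a n)) =
        (\<Prod>i\<in>A. (?a i - a n / s) / (a i - a n))"
      by (intro prod.cong refl) (simp add: eq)
    ultimately show ?thesis
      using assms(1,2) by (auto simp: vandermonde_ratio_insert prod_dividef)
  qed
  show ?th1
    unfolding kernel_weight_left_def cauchy_weight_def vr1 B using nz1 nJ
    by (simp add: prod_dividef key[symmetric] mult_ac)
  have cw: "cauchy_weight n A B (shift (1 / s) (insert n J) a) b j =
     (\<Prod>k\<in>B - {j}. (a n / s - b k)) / (\<Prod>k\<in>B - {j}. b j - b k) *
     ((\<Prod>i\<in>A. ?a i - b j) / (\<Prod>i\<in>A. ?a i - a n / s))"
  proof -
    have "(\<Prod>i\<in>A. (shift (1 / s) (insert n J) a i - b j) / (shift (1 / s) (insert n J) a i - shift (1 / s) (insert n J) a n))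
      = (\<Prod>i\<in>A. (?a i - b j) / (?a i - a n / s))"
      by (intro prod.cong refl) (simp add: eq)
    then show ?thesis unfolding cauchy_weight_def by (simp add: prod_dividef)
  qed
  have B': "(\<Prod>i\<in>insert n J. \<Prod>k\<in>B. (a i - b k) / (a i / s - b k)) =
      ((a n - b j) / (a n / s - b j)) * ((\<Prod>k\<in>B - {j}. a n - b k) / (\<Prod>k\<in>B - {j}. a n / s - b k)) *
      ((\<Prod>i\<in>J. (a i - b j) / (a i / s - b j)) * (\<Prod>i\<in>J. \<Prod>k\<in>B - {j}. (a i - b k) / (a i / s - b k)))"
  proof -
    have "(\<Prod>i\<in>insert n J. \<Prod>k\<in>B. (a i - b k) / (a i / s - b k)) =
      (\<Prod>k\<in>B. (a n - b k) / (a n / s - b k)) * (\<Prod>i\<in>J. \<Prod>k\<in>B. (a i - b k) / (a i / s - b k))"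
      using finJ nJ by (rule prod.insert)
    also have "(\<Prod>k\<in>B. (a n - b k) / (a n / s - b k)) =
      ((a n - b j) / (a n / s - b j)) * (\<Prod>k\<in>B - {j}. (a n - b k) / (a n / s - b k))"
      using assms(3,4) by (rule prod.remove)
    finally show ?thesis
      unfolding B prod_dividef[where A = "B - {j}"] by simp
  qed
  show ?th2
    unfolding kernel_weight_left_def vr2 B' cw
    unfolding cauchy_weight_def prod_dividef[where A = A] key[symmetric] prod_dividef[where A = "B - {j}"]
    using nz2 nz3 by (simp add: mult_ac)
qed

lemma kernel_weight_right_step:
  assumes "finite A" "n \<notin> A" "finite B" "j \<in> B" "K \<subseteq> B - {j}" "s \<noteq> 0"
    and a: "\<And>i i'. i \<in> insert n A \<Longrightarrow> i' \<in> insert n A \<Longrightarrow> i \<noteq> i' \<Longrightarrow> a i \<noteq> a i' \<and> a i \<noteq> s * a i'"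
    and b: "\<And>k k'. k \<in> B \<Longrightarrow> k' \<in> B \<Longrightarrow> k \<noteq> k' \<Longrightarrow> b k \<noteq> b k' \<and> b k \<noteq> s * b k'"
    and ab: "\<And>i k. i \<in> insert n A \<Longrightarrow> k \<in> B \<Longrightarrow> a i \<noteq> s * b k"
  shows "kernel_weight_right s (insert n A) B a b K * cauchy_weight n A B a (shift s K b) j =
      cauchy_weight n A B a b j * kernel_weight_right s A (B - {j}) a b K" (is ?th1)
    and "kernel_weight_right s (insert n A) B a b (insert j K) *
        cauchy_weight n A B a (shift s (insert j K) b) j =
      cauchy_weight n A B a b j * ((a n - b j) / (a n - s * b j)) *
        kernel_weight_right s A (B - {j}) a b K" (is ?th2)
proof -
  let ?B = "B - {j}"
  let ?b = "shift s K b"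
  have finK: "finite K" using assms finite_subset by blast
  have jK: "j \<notin> K" using assms by auto
  have Bj: "B = insert j ?B" using assms by auto
  have eq: "shift s (insert j K) b i = ?b i" if "i \<in> ?B" for i
    using that by (metis DiffD2 insertI1 shift_insert_other)
  have anz: "(\<Prod>i\<in>A. a i - s * b j) \<noteq> 0" using ab assms by auto
  have key: "(\<Prod>k\<in>?B. a n - ?b k) * (\<Prod>k\<in>K. (a n - b k) / (a n - s * b k)) = (\<Prod>k\<in>?B. a n - b k)"
  proof -
    have "(\<Prod>k\<in>K. (a n - b k) / (a n - s * b k)) = (\<Prod>k\<in>?B. if k \<in> K then (a n - b k) / (a n - s * b k) else 1)"
      using assms(3,5) by (simp add: prod.If_cases Int_absorb1)
    then have "(\<Prod>k\<in>?B. a n - ?b k) * (\<Prod>k\<in>K. (a n - b k) / (a n - s * b k)) =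
      (\<Prod>k\<in>?B. (a n - ?b k) * (if k \<in> K then (a n - b k) / (a n - s * b k) else 1))"
      by (simp add: prod.distrib)
    also have "\<dots> = (\<Prod>k\<in>?B. a n - b k)"
      using ab[of n] by (intro prod.cong) (auto simp: shift_def)
    finally show ?thesis .
  qed
  have kK: "(\<Prod>k\<in>K. \<Prod>i\<in>insert n A. (a i - b k) / (a i - s * b k)) =
     (\<Prod>k\<in>K. (a n - b k) / (a n - s * b k)) * (\<Prod>k\<in>K. \<Prod>i\<in>A. (a i - b k) / (a i - s * b k))"
    unfolding prod.distrib[symmetric] using assms(1,2) by (intro prod.cong refl) simp
  have sw: "(\<Prod>k\<in>?B. (f k - w) / (g k - w')) = (\<Prod>k\<in>?B. w - f k) / (\<Prod>k\<in>?B. w' - g k)"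
    for f g :: "nat \<Rightarrow> complex" and w w'
  proof -
    have "(f k - w) / (g k - w') = (w - f k) / (w' - g k)" for k
      using minus_divide_divide[of "f k - w" "g k - w'"] by simp
    then show ?thesis by (simp add: prod_dividef)
  qed
  have nz1: "(\<Prod>k\<in>?B. b j - ?b k) \<noteq> 0"
    using b assms(3,4) by (auto simp: shift_def)
  have nz2: "(\<Prod>k\<in>?B. s * b j - ?b k) \<noteq> 0"
    using b assms(3,4,6) by (auto simp: shift_def) (metis b)
  have vr1: "vandermonde_ratio B ?b b = vandermonde_ratio ?B ?b b *
       ((\<Prod>k\<in>?B. b j - ?b k) / (\<Prod>k\<in>?B. b j - b k))"
    using assms(3) jK by (subst Bj, subst vandermonde_ratio_insert) (auto simp: sw)
  have vr2: "vandermonde_ratio B (shift s (insert j K) b) b = vandermonde_ratio ?B ?b b *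
       ((\<Prod>k\<in>?B. s * b j - ?b k) / (\<Prod>k\<in>?B. b j - b k))"
  proof -
    have "vandermonde_ratio ?B (shift s (insert j K) b) b = vandermonde_ratio ?B ?b b"
      by (intro vandermonde_ratio_cong) (simp_all add: eq del: Diff_iff)
    moreover have "(\<Prod>i\<in>?B. (shift s (insert j K) b i - s * b j) / (b i - b j)) =
        (\<Prod>i\<in>?B. (?b i - s * b j) / (b i - b j))"
      by (intro prod.cong refl) (simp add: eq del: Diff_iff)
    ultimately show ?thesis
      using assms(3) by (subst Bj, subst vandermonde_ratio_insert) (auto simp: sw)
  qed
  show ?th1
    unfolding kernel_weight_right_def cauchy_weight_def vr1 kK using nz1 jK
    by (simp add: prod_dividef key[symmetric] mult_ac)
  have cw: "cauchy_weight n A B a (shift s (insert j K) b) j =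
     (\<Prod>k\<in>?B. (a n - ?b k)) / (\<Prod>k\<in>?B. s * b j - ?b k) *
     ((\<Prod>i\<in>A. a i - s * b j) / (\<Prod>i\<in>A. a i - a n))"
  proof -
    have "(\<Prod>k\<in>?B. (a n - shift s (insert j K) b k) / (s * b j - shift s (insert j K) b k))
      = (\<Prod>k\<in>?B. (a n - ?b k) / (s * b j - ?b k))"
      by (intro prod.cong refl) (simp add: eq del: Diff_iff)
    then show ?thesis unfolding cauchy_weight_def by (simp add: prod_dividef)
  qed
  have K': "(\<Prod>k\<in>insert j K. \<Prod>i\<in>insert n A. (a i - b k) / (a i - s * b k)) =
     ((a n - b j) / (a n - s * b j)) * ((\<Prod>i\<in>A. a i - b j) / (\<Prod>i\<in>A. a i - s * b j)) *
     ((\<Prod>k\<in>K. (a n - b k) / (a n - s * b k)) * (\<Prod>k\<in>K. \<Prod>i\<in>A. (a i - b k) / (a i - s * b k)))"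
  proof -
    have "(\<Prod>k\<in>insert j K. \<Prod>i\<in>insert n A. (a i - b k) / (a i - s * b k)) =
      (\<Prod>i\<in>insert n A. (a i - b j) / (a i - s * b j)) *
      (\<Prod>k\<in>K. \<Prod>i\<in>insert n A. (a i - b k) / (a i - s * b k))"
      using finK jK by (rule prod.insert)
    also have "(\<Prod>i\<in>insert n A. (a i - b j) / (a i - s * b j)) =
      ((a n - b j) / (a n - s * b j)) * (\<Prod>i\<in>A. (a i - b j) / (a i - s * b j))"
      using assms(1,2) by (rule prod.insert)
    finally show ?thesis
      unfolding kK prod_dividef[where A = A] by simp
  qed
  show ?th2
    unfolding kernel_weight_right_def vr2 K' cw
    unfolding cauchy_weight_def prod_dividef[where A = "B - {j}"] key[symmetric] prod_dividef[where A = A]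
    using nz2 anz by (simp add: mult_ac)
qed

text \<open>
  The duality of Kajihara and Noumi for two point sets of the same size. Induction on the size:
  insert \<open>1 = \<Sum>\<^sub>j cauchy_weight \<dots> j\<close>, formed with the shifted points, into both sides. The two step
  lemmas turn both of them into the same combination of the sums with \<open>a\<^sub>n\<close> and one \<open>b\<^sub>j\<close> removed.
\<close>
theorem kernel_identity:
  fixes s V :: complex
  assumes "finite A" "finite B" "card A = card B" "s \<noteq> 0"
    and a: "\<And>i i'. i \<in> A \<Longrightarrow> i' \<in> A \<Longrightarrow> i \<noteq> i' \<Longrightarrow> a i \<noteq> a i' \<and> a i \<noteq> s * a i'"
    and b: "\<And>k k'. k \<in> B \<Longrightarrow> k' \<in> B \<Longrightarrow> k \<noteq> k' \<Longrightarrow> b k \<noteq> b k' \<and> b k \<noteq> s * b k'"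
    and ab: "\<And>i k. i \<in> A \<Longrightarrow> k \<in> B \<Longrightarrow> a i \<noteq> s * b k"
  shows "(\<Sum>J\<in>Pow A. V ^ card J * kernel_weight_left s A B a b J) =
    (\<Sum>K\<in>Pow B. (V * s) ^ card K * kernel_weight_right s A B a b K)"
  using assms
proof (induction A arbitrary: B rule: finite_induct)
  case empty
  then have "B = {}" by simp
  then show ?case
    by (simp add: kernel_weight_left_def kernel_weight_right_def vandermonde_ratio_def ordered_pairs_def)
next
  case (insert n A)
  note [simp] = insert.hyps
  let ?A = "insert n A"
  note B = \<open>finite B\<close> and s = \<open>s \<noteq> 0\<close>
  note a = insert.prems(4) and b = insert.prems(5) and ab = insert.prems(6)
  have cardB: "card B = Suc (card A)" using insert.prems by simp
  define R where "R j = (\<Sum>K\<in>Pow (B - {j}). (V * s) ^ card K * kernel_weight_right s A (B - {j}) a b K)" for j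
  define c where "c j = cauchy_weight n A B a b j * (1 + V * s * ((a n - b j) / (a n - s * b j)))" for j
  have IH: "(\<Sum>J\<in>Pow A. V ^ card J * kernel_weight_left s A (B - {j}) a b J) = R j" if "j \<in> B" for j
    unfolding R_def using cardB B that a b ab s by (intro insert.IH) auto
  have injA: "inj_on (shift (1 / s) J a) ?A" if "J \<subseteq> ?A" for J
  proof (rule inj_onI, rule ccontr)
    fix i i' assume *: "i \<in> ?A" "i' \<in> ?A" "shift (1 / s) J a i = shift (1 / s) J a i'" "i \<noteq> i'"
    then show False
      using a[of i i'] a[of i' i] s by (auto simp: shift_def field_simps split: if_splits)
  qed
  have injB: "inj_on (shift s K b) B" if "K \<subseteq> B" for K
  proof (rule inj_onI, rule ccontr)
    fix i i' assume *: "i \<in> B" "i' \<in> B" "shift s K b i = shift s K b i'" "i \<noteq> i'"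
    then show False
      using b[of i i'] b[of i' i] s by (auto simp: shift_def split: if_splits)
  qed
  have injb: "inj_on b B" and inja: "inj_on a ?A"
    using a b unfolding inj_on_def by blast+
  have left: "(\<Sum>J\<in>Pow ?A. V ^ card J * kernel_weight_left s ?A B a b J) = (\<Sum>j\<in>B. c j * R j)"
  proof -
    have "(\<Sum>J\<in>Pow ?A. V ^ card J * kernel_weight_left s ?A B a b J) =
      (\<Sum>J\<in>Pow ?A. \<Sum>j\<in>B. V ^ card J * (kernel_weight_left s ?A B a b J * cauchy_weight n A B (shift (1 / s) J a) b j))"
    proof (rule sum.cong)
      fix J assume "J \<in> Pow ?A"
      then have "(\<Sum>j\<in>B. cauchy_weight n A B (shift (1 / s) J a) b j) = 1"
        using injA injb cardB B by (intro sum_cauchy_weight) auto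
      then show "V ^ card J * kernel_weight_left s ?A B a b J =
        (\<Sum>j\<in>B. V ^ card J * (kernel_weight_left s ?A B a b J * cauchy_weight n A B (shift (1 / s) J a) b j))"
        unfolding sum_distrib_left[symmetric] by simp
    qed simp
    also have "\<dots> = (\<Sum>j\<in>B. \<Sum>J\<in>Pow ?A. V ^ card J * (kernel_weight_left s ?A B a b J * cauchy_weight n A B (shift (1 / s) J a) b j))"
      by (rule sum.swap)
    also have "\<dots> = (\<Sum>j\<in>B. c j * R j)"
    proof (rule sum.cong)
      fix j assume j: "j \<in> B"
      have q: "(a n - b j) / (a n / s - b j) = s * ((a n - b j) / (a n - s * b j))"
        using s ab[of n j] j by (simp add: field_simps)
      have "(\<Sum>J\<in>Pow ?A. V ^ card J * (kernel_weight_left s ?A B a b J * cauchy_weight n A B (shift (1 / s) J a) b j))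
        = (\<Sum>J\<in>Pow A. c j * (V ^ card J * kernel_weight_left s A (B - {j}) a b J))"
      proof (subst sum_Pow_insert, simp, simp, rule sum.cong)
        fix J assume "J \<in> Pow A"
        then have J: "J \<subseteq> A" "n \<notin> J" "finite J" using insert.hyps finite_subset[of J A] by auto
        have st: "kernel_weight_left s ?A B a b J * cauchy_weight n A B (shift (1 / s) J a) b j =
            cauchy_weight n A B a b j * kernel_weight_left s A (B - {j}) a b J"
          "kernel_weight_left s ?A B a b (insert n J) * cauchy_weight n A B (shift (1 / s) (insert n J) a) b j =
            cauchy_weight n A B a b j * ((a n - b j) / (a n / s - b j)) * kernel_weight_left s A (B - {j}) a b J"
          using kernel_weight_left_step[OF insert.hyps B j J(1) s, where a = a and b = b] a b ab by blast+
        show "V ^ card J * (kernel_weight_left s ?A B a b J * cauchy_weight n A B (shift (1 / s) J a) b j) +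
           V ^ card (insert n J) * (kernel_weight_left s ?A B a b (insert n J) * cauchy_weight n A B (shift (1 / s) (insert n J) a) b j) =
           c j * (V ^ card J * kernel_weight_left s A (B - {j}) a b J)"
          unfolding st unfolding q c_def using J by (simp add: algebra_simps)
      qed simp
      also have "\<dots> = c j * R j" unfolding sum_distrib_left[symmetric] IH[OF j] ..
      finally show "(\<Sum>J\<in>Pow ?A. V ^ card J * (kernel_weight_left s ?A B a b J * cauchy_weight n A B (shift (1 / s) J a) b j))
        = c j * R j" .
    qed simp
    finally show ?thesis .
  qed
  have right: "(\<Sum>K\<in>Pow B. (V * s) ^ card K * kernel_weight_right s ?A B a b K) = (\<Sum>j\<in>B. c j * R j)"
  proof -
    have "(\<Sum>K\<in>Pow B. (V * s) ^ card K * kernel_weight_right s ?A B a b K) =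
      (\<Sum>K\<in>Pow B. \<Sum>j\<in>B. (V * s) ^ card K * (kernel_weight_right s ?A B a b K * cauchy_weight n A B a (shift s K b) j))"
    proof (rule sum.cong)
      fix K assume "K \<in> Pow B"
      then have "(\<Sum>j\<in>B. cauchy_weight n A B a (shift s K b) j) = 1"
        using injB inja cardB B by (intro sum_cauchy_weight) auto
      then show "(V * s) ^ card K * kernel_weight_right s ?A B a b K =
        (\<Sum>j\<in>B. (V * s) ^ card K * (kernel_weight_right s ?A B a b K * cauchy_weight n A B a (shift s K b) j))"
        unfolding sum_distrib_left[symmetric] by simp
    qed simp
    also have "\<dots> = (\<Sum>j\<in>B. \<Sum>K\<in>Pow B. (V * s) ^ card K * (kernel_weight_right s ?A B a b K * cauchy_weight n A B a (shift s K b) j))"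
      by (rule sum.swap)
    also have "\<dots> = (\<Sum>j\<in>B. c j * R j)"
    proof (rule sum.cong)
      fix j assume j: "j \<in> B"
      have Bj: "Pow B = Pow (insert j (B - {j}))" using j by (simp add: insert_absorb)
      have "(\<Sum>K\<in>Pow B. (V * s) ^ card K * (kernel_weight_right s ?A B a b K * cauchy_weight n A B a (shift s K b) j))
        = (\<Sum>K\<in>Pow (B - {j}). c j * ((V * s) ^ card K * kernel_weight_right s A (B - {j}) a b K))"
        unfolding Bj
      proof (subst sum_Pow_insert, use B in simp, simp, rule sum.cong)
        fix K assume "K \<in> Pow (B - {j})"
        then have K: "K \<subseteq> B - {j}" "j \<notin> K" "finite K" using B finite_subset[of K "B - {j}"] by auto
        have st1: "kernel_weight_right s ?A B a b K * cauchy_weight n A B a (shift s K b) j =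
            cauchy_weight n A B a b j * kernel_weight_right s A (B - {j}) a b K"
          by (rule kernel_weight_right_step(1); (fact | rule a b ab; assumption))
        have st2: "kernel_weight_right s ?A B a b (insert j K) * cauchy_weight n A B a (shift s (insert j K) b) j =
            cauchy_weight n A B a b j * ((a n - b j) / (a n - s * b j)) * kernel_weight_right s A (B - {j}) a b K"
          by (rule kernel_weight_right_step(2); (fact | rule a b ab; assumption))
        show "(V * s) ^ card K * (kernel_weight_right s ?A B a b K * cauchy_weight n A B a (shift s K b) j) +
           (V * s) ^ card (insert j K) * (kernel_weight_right s ?A B a b (insert j K) * cauchy_weight n A B a (shift s (insert j K) b) j) =
           c j * ((V * s) ^ card K * kernel_weight_right s A (B - {j}) a b K)"
          unfolding st1 st2 c_def using K by (simp add: algebra_simps)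
      qed simp
      also have "\<dots> = c j * R j" unfolding sum_distrib_left[symmetric] R_def ..
      finally show "(\<Sum>K\<in>Pow B. (V * s) ^ card K * (kernel_weight_right s ?A B a b K * cauchy_weight n A B a (shift s K b) j))
        = c j * R j" .
    qed simp
    finally show ?thesis .
  qed
  show ?case unfolding left right ..
qed

section \<open>Alternating sums over subsets\<close>

text \<open>
  The factor \<open>\<Prod>\<^sub>k (a\<^sub>k - Y\<^sub>i) / \<Prod>\<^sub>j (Y\<^sub>i - Y\<^sub>j)\<close> of a Lagrange interpolant at the shifted points \<open>Y\<close> makes
  the coefficients of \<open>J\<close> and \<open>J \<union> {i}\<close> equal.
\<close>
lemma pair_cancellation:
  assumes N: "finite N" "i \<in> N" "J \<subseteq> N - {i}" and "finite K"
    and y: "\<And>i j. i \<in> N \<Longrightarrow> j \<in> N \<Longrightarrow> i \<noteq> j \<Longrightarrow> y i \<noteq> y j \<and> y i \<noteq> s * y j"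
    and a: "\<And>k i. k \<in> K \<Longrightarrow> i \<in> N \<Longrightarrow> a k \<noteq> s * y i"
    and "s \<noteq> 0"
  shows "kernel_weight_right s K N a y J * ((\<Prod>k\<in>K. a k - y i) / (\<Prod>j\<in>N - {i}. y i - shift s J y j)) =
    kernel_weight_right s K N a y (insert i J) *
      ((\<Prod>k\<in>K. a k - s * y i) / (\<Prod>j\<in>N - {i}. s * y i - shift s J y j))"
proof -
  let ?M = "N - {i}"
  let ?y = "shift s J y"
  have finJ: "finite J" and iJ: "i \<notin> J" using N finite_subset by auto
  have Ni: "N = insert i ?M" using N by auto
  have eq: "shift s (insert i J) y j = ?y j" if "j \<in> ?M" for j
    using that by (metis DiffD2 insertI1 shift_insert_other)
  have sw: "(\<Prod>k\<in>?M. (f k - w) / (g k - w')) = (\<Prod>k\<in>?M. w - f k) / (\<Prod>k\<in>?M. w' - g k)"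
    for f g :: "nat \<Rightarrow> complex" and w w'
  proof -
    have "(f k - w) / (g k - w') = (w - f k) / (w' - g k)" for k
      using minus_divide_divide[of "f k - w" "g k - w'"] by simp
    then show ?thesis by (simp add: prod_dividef)
  qed
  have nz1: "(\<Prod>j\<in>?M. y i - ?y j) \<noteq> 0"
    using y N by (auto simp: shift_def)
  have nz2: "(\<Prod>j\<in>?M. s * y i - ?y j) \<noteq> 0"
    using y[of _ i] N \<open>s \<noteq> 0\<close> by (auto simp: shift_def) (metis y)+
  have nz3: "(\<Prod>k\<in>K. a k - s * y i) \<noteq> 0" using a N \<open>finite K\<close> by auto
  have vr1: "vandermonde_ratio N ?y y = vandermonde_ratio ?M ?y y *
       ((\<Prod>k\<in>?M. y i - ?y k) / (\<Prod>k\<in>?M. y i - y k))"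
    using N(1) iJ by (subst Ni, subst vandermonde_ratio_insert) (auto simp: sw)
  have vr2: "vandermonde_ratio N (shift s (insert i J) y) y = vandermonde_ratio ?M ?y y *
       ((\<Prod>k\<in>?M. s * y i - ?y k) / (\<Prod>k\<in>?M. y i - y k))"
  proof -
    have "vandermonde_ratio ?M (shift s (insert i J) y) y = vandermonde_ratio ?M ?y y"
      by (intro vandermonde_ratio_cong) (simp_all add: eq del: Diff_iff)
    moreover have "(\<Prod>k\<in>?M. (shift s (insert i J) y k - s * y i) / (y k - y i)) =
        (\<Prod>k\<in>?M. (?y k - s * y i) / (y k - y i))"
      by (intro prod.cong refl) (simp add: eq del: Diff_iff)
    ultimately show ?thesis
      using N(1) by (subst Ni, subst vandermonde_ratio_insert) (auto simp: sw)
  qed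
  have ins: "(\<Prod>j\<in>insert i J. \<Prod>k\<in>K. (a k - y j) / (a k - s * y j)) =
     ((\<Prod>k\<in>K. a k - y i) / (\<Prod>k\<in>K. a k - s * y i)) * (\<Prod>j\<in>J. \<Prod>k\<in>K. (a k - y j) / (a k - s * y j))"
    using finJ iJ by (subst prod.insert) (auto simp: prod_dividef)
  show ?thesis
    unfolding kernel_weight_right_def vr1 vr2 ins using nz1 nz2 nz3 by simp
qed

text \<open>
  The summands for \<open>J\<close> and \<open>J \<union> {i}\<close> cancel, because their signs differ and \<open>pair_cancellation\<close>
  identifies the rest. The function \<open>\<phi>\<close> absorbs the factor \<open>w\<close> by which they differ beyond the
  sign (\<open>\<phi> = 1\<close> for \<open>w = 1\<close>, \<open>\<phi>(y) = 1 / y\<close> for \<open>w = s\<close>), and \<open>Z\<close> collects what does not see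
  whether \<open>i\<close> is shifted.
\<close>
lemma alternating_sum_zero:
  assumes N: "finite N" "finite K" "s \<noteq> 0"
    and y: "\<And>i j. i \<in> N \<Longrightarrow> j \<in> N \<Longrightarrow> i \<noteq> j \<Longrightarrow> y i \<noteq> y j \<and> y i \<noteq> s * y j"
    and a: "\<And>k i. k \<in> K \<Longrightarrow> i \<in> N \<Longrightarrow> a k \<noteq> s * y i"
    and \<phi>: "\<And>i. i \<in> N \<Longrightarrow> w * \<phi> (s * y i) = \<phi> (y i)"
    and Z: "\<And>i J. i \<in> N \<Longrightarrow> J \<subseteq> N - {i} \<Longrightarrow> Z i (shift s (insert i J) y) = Z i (shift s J y)"
  shows "(\<Sum>J\<in>Pow N. (- w) ^ card J * kernel_weight_right s K N a y J *
    (\<Sum>i\<in>N. \<phi> (shift s J y i) * ((\<Prod>k\<in>K. a k - shift s J y i) /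
       (\<Prod>j\<in>N - {i}. shift s J y i - shift s J y j)) * Z i (shift s J y))) = 0"
proof -
  define T where "T J i = (- w) ^ card J * kernel_weight_right s K N a y J *
    (\<phi> (shift s J y i) * ((\<Prod>k\<in>K. a k - shift s J y i) /
       (\<Prod>j\<in>N - {i}. shift s J y i - shift s J y j)) * Z i (shift s J y))" for J i
  have "(\<Sum>J\<in>Pow N. T J i) = 0" if i: "i \<in> N" for i
  proof -
    have Ni: "Pow N = Pow (insert i (N - {i}))" using i by (simp add: insert_absorb)
    have "(\<Sum>J\<in>Pow N. T J i) = (\<Sum>J\<in>Pow (N - {i}). T J i + T (insert i J) i)"
      unfolding Ni using N by (subst sum_Pow_insert) auto
    also have "\<dots> = 0"
    proof (intro sum.neutral ballI)
      fix J assume "J \<in> Pow (N - {i})"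
      then have J: "J \<subseteq> N - {i}" and iJ: "i \<notin> J" and finJ: "finite J"
        using N finite_subset[of J "N - {i}"] by auto
      have eq: "shift s (insert i J) y j = shift s J y j" if "j \<in> N - {i}" for j
        using that by (metis DiffD2 insertI1 shift_insert_other)
      have p: "(\<Prod>j\<in>N - {i}. s * y i - shift s (insert i J) y j) = (\<Prod>j\<in>N - {i}. s * y i - shift s J y j)"
        by (intro prod.cong refl) (simp add: eq del: Diff_iff)
      have c: "kernel_weight_right s K N a y J * ((\<Prod>k\<in>K. a k - y i) / (\<Prod>j\<in>N - {i}. y i - shift s J y j)) =
        kernel_weight_right s K N a y (insert i J) *
        ((\<Prod>k\<in>K. a k - s * y i) / (\<Prod>j\<in>N - {i}. s * y i - shift s J y j))"
        by (rule pair_cancellation) (use N i J y a in auto)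
      have "T (insert i J) i = (- w) ^ card J * (- w) * (kernel_weight_right s K N a y (insert i J) *
          ((\<Prod>k\<in>K. a k - s * y i) / (\<Prod>j\<in>N - {i}. s * y i - shift s J y j))) *
          \<phi> (s * y i) * Z i (shift s J y)"
        unfolding T_def using finJ iJ Z[OF i J] by (simp add: p mult_ac)
      also have "\<dots> = (- w) ^ card J * (kernel_weight_right s K N a y J *
          ((\<Prod>k\<in>K. a k - y i) / (\<Prod>j\<in>N - {i}. y i - shift s J y j))) *
          (- (w * \<phi> (s * y i))) * Z i (shift s J y)"
        unfolding c by (simp add: mult_ac)
      also have "\<dots> = - T J i"
        unfolding T_def \<phi>[OF i] using iJ by (simp add: mult_ac)
      finally show "T J i + T (insert i J) i = 0" by simp
    qed
    finally show ?thesis .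
  qed
  then have "(\<Sum>i\<in>N. \<Sum>J\<in>Pow N. T J i) = 0" by simp
  then have "(\<Sum>J\<in>Pow N. \<Sum>i\<in>N. T J i) = 0" by (subst sum.swap)
  then show ?thesis unfolding T_def by (simp add: sum_distrib_left)
qed

lemma monic_prod_linear:
  fixes y :: "nat \<Rightarrow> complex"
  assumes "finite N"
  shows "degree (\<Prod>i\<in>N. [:- y i, 1:]) = card N" "coeff (\<Prod>i\<in>N. [:- y i, 1:]) (card N) = 1"
proof -
  show 1: "degree (\<Prod>i\<in>N. [:- y i, 1:]) = card N"
    by (subst degree_prod_eq_sum_degree) auto
  have "lead_coeff (\<Prod>i\<in>N. [:- y i, 1:]) = 1"
    by (simp add: lead_coeff_prod)
  then show "coeff (\<Prod>i\<in>N. [:- y i, 1:]) (card N) = 1"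
    unfolding 1 .
qed

lemma degree_diff_monic:
  fixes p q :: "complex poly"
  assumes "degree p = n" "degree q = n" "coeff p n = 1" "coeff q n = 1" "n > 0"
  shows "degree (p - q) < n"
proof (rule degree_lessI)
  show "\<forall>k\<ge>n. coeff (p - q) k = 0"
    using assms by (auto simp: le_less coeff_eq_0)
qed (use assms in auto)

text \<open>
  Lagrange interpolation of the difference of two monic polynomials of the same degree at the roots
  of one of them, written with the factors that \<open>alternating_sum_zero\<close> asks for (\<open>\<phi> = 1\<close>).
\<close>
lemma monic_difference_balanced:
  fixes y a :: "nat \<Rightarrow> complex"
  assumes "finite N" "finite K" "card K = card N" "inj_on y N"
  shows "(\<Prod>i\<in>N. z - y i) - (\<Prod>k\<in>K. z - a k) =
    (\<Sum>i\<in>N. 1 * ((\<Prod>k\<in>K. a k - y i) / (\<Prod>j\<in>N - {i}. y i - y j)) *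
      (- ((-1) ^ card K) * (\<Prod>j\<in>N - {i}. z - y j)))"
proof (cases "N = {}")
  case True
  then show ?thesis using assms by simp
next
  case False
  then have n: "card N > 0" using assms by (simp add: card_gt_0_iff)
  define p where "p = (\<Prod>k\<in>K. [:- a k, 1:]) - (\<Prod>i\<in>N. [:- y i, 1:])"
  have deg: "degree p < card N"
    unfolding p_def using monic_prod_linear[OF assms(1), of y] monic_prod_linear[OF assms(2), of a] assms n
    by (intro degree_diff_monic) auto
  have p: "poly p w = (\<Prod>k\<in>K. w - a k) - (\<Prod>i\<in>N. w - y i)" for w
    unfolding p_def by (simp add: poly_prod)
  have py: "poly p (y i) = (-1) ^ card K * (\<Prod>k\<in>K. a k - y i)" if "i \<in> N" for i
  proof -
    have "(\<Prod>j\<in>N. y i - y j) = 0" using that assms by (auto intro!: prod_zero)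
    moreover have "(\<Prod>k\<in>K. y i - a k) = (\<Prod>k\<in>K. (-1) * (a k - y i))" by simp
    ultimately show ?thesis unfolding p prod.distrib by simp
  qed
  have "(\<Prod>i\<in>N. z - y i) - (\<Prod>k\<in>K. z - a k) = - poly p z" by (simp add: p)
  also have "poly p z = (\<Sum>i\<in>N. poly p (y i) * (\<Prod>j\<in>N - {i}. (z - y j) / (y i - y j)))"
    by (rule lagrange_interpolation) (use assms deg in auto)
  finally show ?thesis
    unfolding sum_negf[symmetric] by (simp add: py prod_dividef mult_ac cong: sum.cong)
qed

text \<open>
  With one more \<open>a\<^sub>k\<close> than there are \<open>y\<^sub>i\<close>, the missing root is chosen such that the difference
  vanishes at \<open>0\<close>; then \<open>0\<close> is a further node, without a summand of its own, and the remaining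
  summands carry the factor \<open>z / y\<^sub>i\<close>.
\<close>
lemma monic_difference_unbalanced:
  fixes y a :: "nat \<Rightarrow> complex"
  assumes "finite N" "finite K" "card K = Suc (card N)" "inj_on y N" "\<And>i. i \<in> N \<Longrightarrow> y i \<noteq> 0"
  shows "(\<Prod>i\<in>N. z - y i) * (z - (\<Prod>k\<in>K. a k) / (\<Prod>i\<in>N. y i)) - (\<Prod>k\<in>K. z - a k) =
    (\<Sum>i\<in>N. inverse (y i) * ((\<Prod>k\<in>K. a k - y i) / (\<Prod>j\<in>N - {i}. y i - y j)) *
      (- ((-1) ^ card K) * z * (\<Prod>j\<in>N - {i}. z - y j)))"
proof -
  define \<beta> where "\<beta> = (\<Prod>k\<in>K. a k) / (\<Prod>i\<in>N. y i)"
  obtain m where m: "m \<notin> N" using assms(1) ex_new_if_finite infinite_UNIV_nat by blast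
  \<comment> \<open>Under a fresh index \<open>m\<close>, \<open>x\<close> receives the additional node \<open>0\<close> and \<open>x'\<close> the additional root \<open>\<beta>\<close>.\<close>
  define x where "x = y(m := 0)"
  define x' where "x' = y(m := \<beta>)"
  let ?S = "insert m N"
  define p where "p = (\<Prod>k\<in>K. [:- a k, 1:]) - (\<Prod>i\<in>?S. [:- x' i, 1:])"
  have S: "finite ?S" "card ?S = card K" using assms m by auto
  have deg: "degree p < card ?S"
    unfolding p_def using monic_prod_linear[OF S(1), of x'] monic_prod_linear[OF assms(2), of a] S assms(3)
    by (intro degree_diff_monic) auto
  have pN: "(\<Prod>i\<in>N. w - x' i) = (\<Prod>i\<in>N. w - y i)" for w
    using m by (intro prod.cong) (auto simp: x'_def)
  have p: "poly p w = (\<Prod>k\<in>K. w - a k) - (\<Prod>i\<in>N. w - y i) * (w - \<beta>)" for w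
    unfolding p_def using assms(1) m by (simp add: poly_prod pN) (simp add: x'_def algebra_simps)
  have py: "poly p (y i) = (-1) ^ card K * (\<Prod>k\<in>K. a k - y i)" if "i \<in> N" for i
  proof -
    have "(\<Prod>j\<in>N. y i - y j) = 0" using that assms by (auto intro!: prod_zero)
    moreover have "(\<Prod>k\<in>K. y i - a k) = (\<Prod>k\<in>K. (-1) * (a k - y i))" by simp
    ultimately show ?thesis unfolding p prod.distrib by simp
  qed
  have p0: "poly p 0 = 0"
  proof -
    have "(\<Prod>i\<in>N. - y i) = (\<Prod>i\<in>N. (-1) * y i)" "(\<Prod>k\<in>K. - a k) = (\<Prod>k\<in>K. (-1) * a k)" by simp_all
    then have "(\<Prod>i\<in>N. - y i) = (-1) ^ card N * (\<Prod>i\<in>N. y i)" "(\<Prod>k\<in>K. - a k) = (-1) ^ card K * (\<Prod>k\<in>K. a k)"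
      unfolding prod.distrib by simp_all
    moreover have "(\<Prod>i\<in>N. y i) \<noteq> 0" using assms by auto
    ultimately show ?thesis unfolding p using assms(3) by (simp add: \<beta>_def)
  qed
  have inj: "inj_on x ?S"
    using assms(4,5) m unfolding x_def inj_on_def by auto
  have "(\<Prod>i\<in>N. z - y i) * (z - \<beta>) - (\<Prod>k\<in>K. z - a k) = - poly p z" by (simp add: p)
  also have "poly p z = (\<Sum>i\<in>?S. poly p (x i) * (\<Prod>j\<in>?S - {i}. (z - x j) / (x i - x j)))"
    by (rule lagrange_interpolation) (use S inj deg in auto)
  also have "\<dots> = (\<Sum>i\<in>N. poly p (x i) * (\<Prod>j\<in>?S - {i}. (z - x j) / (x i - x j)))"
    using assms(1) m p0 by (simp add: x_def)
  also have "\<dots> = (\<Sum>i\<in>N. (-1) ^ card K * (\<Prod>k\<in>K. a k - y i) * ((z / y i) * (\<Prod>j\<in>N - {i}. (z - y j) / (y i - y j))))"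
  proof (intro sum.cong refl)
    fix i assume i: "i \<in> N"
    then have "?S - {i} = insert m (N - {i})" "m \<noteq> i" using m by auto
    moreover have "(\<Prod>j\<in>N - {i}. (z - x j) / (y i - x j)) = (\<Prod>j\<in>N - {i}. (z - y j) / (y i - y j))"
      using m by (intro prod.cong) (auto simp: x_def)
    ultimately show "poly p (x i) * (\<Prod>j\<in>?S - {i}. (z - x j) / (x i - x j)) =
      (-1) ^ card K * (\<Prod>k\<in>K. a k - y i) * ((z / y i) * (\<Prod>j\<in>N - {i}. (z - y j) / (y i - y j)))"
      using i m assms(1) py[OF i] by (simp add: x_def)
  qed
  finally show ?thesis
    unfolding sum_negf[symmetric] \<beta>_def prod_dividef by (simp add: divide_inverse mult_ac)
qed

lemma inj_on_shift:
  assumes y: "\<And>i j. i \<in> N \<Longrightarrow> j \<in> N \<Longrightarrow> i \<noteq> j \<Longrightarrow> y i \<noteq> y j \<and> y i \<noteq> s * y j" and "s \<noteq> 0"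
  shows "inj_on (shift s J y) N"
proof (rule inj_onI, rule ccontr)
  fix i j assume *: "i \<in> N" "j \<in> N" "shift s J y i = shift s J y j" "i \<noteq> j"
  then show False
    using y[of i j] y[of j i] \<open>s \<noteq> 0\<close> by (auto simp: shift_def split: if_splits)
qed

lemma prod_diff_shift_insert:
  "(\<Prod>j\<in>N - {i}. (z::complex) - shift s (insert i J) y j) = (\<Prod>j\<in>N - {i}. z - shift s J y j)"
  by (intro prod.cong) auto

lemma alternating_sum_balanced:
  fixes y a :: "nat \<Rightarrow> complex"
  assumes N: "finite N" "finite K" "card K = card N" "s \<noteq> 0"
    and y: "\<And>i j. i \<in> N \<Longrightarrow> j \<in> N \<Longrightarrow> i \<noteq> j \<Longrightarrow> y i \<noteq> y j \<and> y i \<noteq> s * y j"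
    and a: "\<And>k i. k \<in> K \<Longrightarrow> i \<in> N \<Longrightarrow> a k \<noteq> s * y i"
  shows "(\<Sum>J\<in>Pow N. (-1) ^ card J * kernel_weight_right s K N a y J *
    ((\<Prod>i\<in>N. z - shift s J y i) - (\<Prod>k\<in>K. z - a k))) = 0"
proof -
  have "(\<Sum>J\<in>Pow N. (- 1) ^ card J * kernel_weight_right s K N a y J *
    (\<Sum>i\<in>N. (\<lambda>_. 1) (shift s J y i) * ((\<Prod>k\<in>K. a k - shift s J y i) /
       (\<Prod>j\<in>N - {i}. shift s J y i - shift s J y j)) *
       (\<lambda>i Y. - ((-1) ^ card K) * (\<Prod>j\<in>N - {i}. z - Y j)) i (shift s J y))) = 0"
    by (rule alternating_sum_zero) (use N y a in \<open>auto simp: prod_diff_shift_insert\<close>)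
  then show ?thesis
    using inj_on_shift[of N y s] N y by (subst monic_difference_balanced) auto
qed

lemma alternating_sum_unbalanced:
  fixes y a :: "nat \<Rightarrow> complex"
  assumes N: "finite N" "finite K" "card K = Suc (card N)" "s \<noteq> 0"
    and y: "\<And>i j. i \<in> N \<Longrightarrow> j \<in> N \<Longrightarrow> i \<noteq> j \<Longrightarrow> y i \<noteq> y j \<and> y i \<noteq> s * y j"
    and a: "\<And>k i. k \<in> K \<Longrightarrow> i \<in> N \<Longrightarrow> a k \<noteq> s * y i"
    and y0: "\<And>i. i \<in> N \<Longrightarrow> y i \<noteq> 0"
  shows "(\<Sum>J\<in>Pow N. (-s) ^ card J * kernel_weight_right s K N a y J *
    ((\<Prod>i\<in>N. z - shift s J y i) * (z - (\<Prod>k\<in>K. a k) / (\<Prod>i\<in>N. shift s J y i)) - (\<Prod>k\<in>K. z - a k))) = 0"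
proof -
  have nz: "shift s J y i \<noteq> 0" if "i \<in> N" for i J
    using y0[OF that] \<open>s \<noteq> 0\<close> by (simp add: shift_def)
  have "(\<Sum>J\<in>Pow N. (- s) ^ card J * kernel_weight_right s K N a y J *
    (\<Sum>i\<in>N. inverse (shift s J y i) * ((\<Prod>k\<in>K. a k - shift s J y i) /
       (\<Prod>j\<in>N - {i}. shift s J y i - shift s J y j)) *
       (\<lambda>i Y. - ((-1) ^ card K) * z * (\<Prod>j\<in>N - {i}. z - Y j)) i (shift s J y))) = 0"
    by (rule alternating_sum_zero) (use N y a in \<open>auto simp: prod_diff_shift_insert\<close>)
  then show ?thesis
    using inj_on_shift[of N y s] N y nz by (subst monic_difference_unbalanced) auto
qed

lemma prod_one_minus_eq:
  "u \<noteq> 0 \<Longrightarrow> finite N \<Longrightarrow> (\<Prod>i\<in>N. 1 - u * y i) = u ^ card N * (\<Prod>i\<in>N. 1 / u - (y i :: complex))"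
  unfolding prod_constant[symmetric] prod.distrib[symmetric]
  by (intro prod.cong) (auto simp: field_simps)

text \<open>
  In the form in which it is applied: the variable is \<open>z = 1 / u\<close>, and the polynomials are
  normalised to have constant term \<open>1\<close> in \<open>u\<close>.
\<close>
lemma alternating_sum_balanced':
  fixes y a :: "nat \<Rightarrow> complex"
  assumes N: "finite N" "finite K" "card K = card N" "s \<noteq> 0"
    and y: "\<And>i j. i \<in> N \<Longrightarrow> j \<in> N \<Longrightarrow> i \<noteq> j \<Longrightarrow> y i \<noteq> y j \<and> y i \<noteq> s * y j"
    and a: "\<And>k i. k \<in> K \<Longrightarrow> i \<in> N \<Longrightarrow> a k \<noteq> s * y i"
  shows "(\<Sum>J\<in>Pow N. (-1) ^ card J * kernel_weight_right s K N a y J * (\<Prod>i\<in>N. 1 - u * shift s J y i)) =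
    (\<Prod>k\<in>K. 1 - u * a k) * (\<Sum>J\<in>Pow N. (-1) ^ card J * kernel_weight_right s K N a y J)"
proof (cases "u = 0")
  case False
  have "(\<Sum>J\<in>Pow N. (-1) ^ card J * kernel_weight_right s K N a y J * (\<Prod>i\<in>N. 1 - u * shift s J y i)) -
    (\<Prod>k\<in>K. 1 - u * a k) * (\<Sum>J\<in>Pow N. (-1) ^ card J * kernel_weight_right s K N a y J) =
    (\<Sum>J\<in>Pow N. (-1) ^ card J * kernel_weight_right s K N a y J *
      ((\<Prod>i\<in>N. 1 - u * shift s J y i) - (\<Prod>k\<in>K. 1 - u * a k)))"
    by (simp add: sum_distrib_left right_diff_distrib sum_subtractf mult_ac)
  also have "\<dots> = u ^ card N * (\<Sum>J\<in>Pow N. (-1) ^ card J * kernel_weight_right s K N a y J *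
    ((\<Prod>i\<in>N. 1 / u - shift s J y i) - (\<Prod>k\<in>K. 1 / u - a k)))"
    using N False by (simp add: prod_one_minus_eq sum_distrib_left right_diff_distrib mult_ac)
  also have "\<dots> = 0"
    using alternating_sum_balanced[OF N, of y a "1 / u"] y a by simp
  finally show ?thesis by simp
qed simp

lemma alternating_sum_unbalanced':
  fixes y a :: "nat \<Rightarrow> complex"
  assumes N: "finite N" "finite K" "card K = Suc (card N)" "s \<noteq> 0"
    and y: "\<And>i j. i \<in> N \<Longrightarrow> j \<in> N \<Longrightarrow> i \<noteq> j \<Longrightarrow> y i \<noteq> y j \<and> y i \<noteq> s * y j"
    and a: "\<And>k i. k \<in> K \<Longrightarrow> i \<in> N \<Longrightarrow> a k \<noteq> s * y i"
    and y0: "\<And>i. i \<in> N \<Longrightarrow> y i \<noteq> 0"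
  shows "(\<Sum>J\<in>Pow N. (-s) ^ card J * kernel_weight_right s K N a y J *
    ((\<Prod>i\<in>N. 1 - u * shift s J y i) * (1 - u * ((\<Prod>k\<in>K. a k) / (\<Prod>i\<in>N. shift s J y i))) -
     (\<Prod>k\<in>K. 1 - u * a k))) = 0"
proof (cases "u = 0")
  case False
  have e: "1 - u * c = u * (1 / u - c)" for c using False by (simp add: field_simps)
  have r: "P * G * ((u ^ card N * X) * (u * b) - u ^ card K * Y) = u ^ card K * (P * G * (X * b - Y))"
    for P G X b Y using N(3) by (simp add: algebra_simps)
  have "(\<Sum>J\<in>Pow N. (-s) ^ card J * kernel_weight_right s K N a y J *
    ((\<Prod>i\<in>N. 1 - u * shift s J y i) * (1 - u * ((\<Prod>k\<in>K. a k) / (\<Prod>i\<in>N. shift s J y i))) -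
     (\<Prod>k\<in>K. 1 - u * a k))) =
    u ^ card K * (\<Sum>J\<in>Pow N. (-s) ^ card J * kernel_weight_right s K N a y J *
    ((\<Prod>i\<in>N. 1 / u - shift s J y i) * (1 / u - (\<Prod>k\<in>K. a k) / (\<Prod>i\<in>N. shift s J y i)) -
     (\<Prod>k\<in>K. 1 / u - a k)))"
    unfolding prod_one_minus_eq[OF False N(1)] prod_one_minus_eq[OF False N(2)] e[of "_ / _"] r
      sum_distrib_left ..
  also have "\<dots> = 0"
    using alternating_sum_unbalanced[OF N, of y a "1 / u"] y a y0 by simp
  finally show ?thesis .
qed simp

section \<open>The unbalanced kernel identity\<close>

text \<open>
  The coefficients of the Pieri rule. The power of \<open>s\<close> clears denominators: the value is
  \<open>s\<^bsup>r(r-1)/2\<^esup> \<Prod>\<^sub>i\<^sub>\<in>\<^sub>J \<Prod>\<^sub>j\<^sub>\<notin>\<^sub>J (a\<^sub>i - s a\<^sub>j) / (a\<^sub>i - a\<^sub>j)\<close> with \<open>r = |J|\<close>, see \<open>dual_coeff_pairs\<close>.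
\<close>
definition dual_coeff :: "complex \<Rightarrow> nat set \<Rightarrow> nat set \<Rightarrow> (nat \<Rightarrow> complex) \<Rightarrow> complex" where
  "dual_coeff s N J a = s ^ ((card N - 1) * card J) * vandermonde_ratio N (shift (1 / s) J a) a"

text \<open>
  The kernel identity with one point \<open>b\<^sub>k\<close> placed at \<open>0\<close>: shifting it does nothing, so the subsets
  with and without that point combine into the factor \<open>1 + x\<close>.
\<close>
lemma kernel_identity_unbalanced:
  fixes s x :: complex
  assumes A: "finite A" "finite N" "card A = Suc (card N)" "s \<noteq> 0"
    and a: "\<And>i i'. i \<in> A \<Longrightarrow> i' \<in> A \<Longrightarrow> i \<noteq> i' \<Longrightarrow> a i \<noteq> a i' \<and> a i \<noteq> s * a i'"
    and b: "\<And>k k'. k \<in> N \<Longrightarrow> k' \<in> N \<Longrightarrow> k \<noteq> k' \<Longrightarrow> b k \<noteq> b k' \<and> b k \<noteq> s * b k'"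
    and ab: "\<And>i k. i \<in> A \<Longrightarrow> k \<in> N \<Longrightarrow> a i \<noteq> s * b k"
    and a0: "\<And>i. i \<in> A \<Longrightarrow> a i \<noteq> 0" and b0: "\<And>k. k \<in> N \<Longrightarrow> b k \<noteq> 0"
  shows "(\<Sum>J\<in>Pow A. x ^ card J * dual_coeff s A J a * (\<Prod>i\<in>J. \<Prod>k\<in>N. (a i - b k) / (a i - s * b k))) =
    (1 + x) * (\<Sum>K\<in>Pow N. (x * s) ^ card K * kernel_weight_right s A N a b K)"
proof -
  obtain m where m: "m \<notin> N" using A(2) ex_new_if_finite infinite_UNIV_nat by blast
  define b' where "b' = b(m := 0)"
  let ?B = "insert m N"
  have b': "b' m = 0" "\<And>k. k \<in> N \<Longrightarrow> b' k = b k" using m by (auto simp: b'_def)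
  have id: "(\<Sum>J\<in>Pow A. (x / s) ^ card J * kernel_weight_left s A ?B a b' J) =
    (\<Sum>K\<in>Pow ?B. (x / s * s) ^ card K * kernel_weight_right s A ?B a b' K)"
  proof (rule kernel_identity)
    fix k k' assume "k \<in> ?B" "k' \<in> ?B" "k \<noteq> k'"
    then show "b' k \<noteq> b' k' \<and> b' k \<noteq> s * b' k'"
      using b[of k k'] b0[of k] b0[of k'] \<open>s \<noteq> 0\<close> b' by auto
  next
    fix i k assume "i \<in> A" "k \<in> ?B"
    then show "a i \<noteq> s * b' k" using ab[of i k] a0[of i] b' by auto
  qed (use A m a in auto)
  have left: "(x / s) ^ card J * kernel_weight_left s A ?B a b' J =
     x ^ card J * dual_coeff s A J a * (\<Prod>i\<in>J. \<Prod>k\<in>N. (a i - b k) / (a i - s * b k))" if "J \<in> Pow A" for J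
  proof -
    have finJ: "finite J" using that A finite_subset by auto
    have "(\<Prod>i\<in>J. \<Prod>k\<in>?B. (a i - b' k) / (a i / s - b' k)) =
      (\<Prod>i\<in>J. s ^ Suc (card N) * (\<Prod>k\<in>N. (a i - b k) / (a i - s * b k)))"
    proof (intro prod.cong refl)
      fix i assume i: "i \<in> J"
      then have iA: "i \<in> A" using that by auto
      have "(\<Prod>k\<in>?B. (a i - b' k) / (a i / s - b' k)) = s * (\<Prod>k\<in>N. (a i - b' k) / (a i / s - b' k))"
        using m A(2) b' a0[of i] iA by simp
      also have "(\<Prod>k\<in>N. (a i - b' k) / (a i / s - b' k)) = (\<Prod>k\<in>N. s * ((a i - b k) / (a i - s * b k)))"
        using \<open>s \<noteq> 0\<close> ab[of i] i that by (intro prod.cong) (auto simp: b' field_simps)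
      finally show "(\<Prod>k\<in>?B. (a i - b' k) / (a i / s - b' k)) =
        s ^ Suc (card N) * (\<Prod>k\<in>N. (a i - b k) / (a i - s * b k))"
        unfolding prod.distrib by simp
    qed
    also have "\<dots> = s ^ (Suc (card N) * card J) * (\<Prod>i\<in>J. \<Prod>k\<in>N. (a i - b k) / (a i - s * b k))"
      unfolding prod.distrib prod_constant power_mult ..
    finally show ?thesis
      unfolding kernel_weight_left_def dual_coeff_def using \<open>s \<noteq> 0\<close> A(3)
      by (simp add: power_divide power_add)
  qed
  have right: "kernel_weight_right s A ?B a b' K = s ^ card K * kernel_weight_right s A N a b K"
    "kernel_weight_right s A ?B a b' (insert m K) = s ^ card K * kernel_weight_right s A N a b K"
    if "K \<in> Pow N" for K
  proof -
    have finK: "finite K" and mK: "m \<notin> K" using that A m finite_subset by auto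
    have c: "shift s K b' k = shift s K b k" if "k \<in> N" for k
      using b' that by (simp add: shift_def)
    have c': "shift s (insert m K) b' k = shift s K b k" if "k \<in> N" for k
      using b' that m by (auto simp: shift_def)
    have pr: "(\<Prod>k\<in>N. shift s K b k / b k) = s ^ card K"
    proof -
      have "(\<Prod>k\<in>N. shift s K b k / b k) = (\<Prod>k\<in>N. if k \<in> K then s else 1)"
        using b0 by (intro prod.cong) (auto simp: shift_def)
      also have "\<dots> = s ^ card K" using that A(2) by (simp add: prod.If_cases Int_absorb1)
      finally show ?thesis .
    qed
    have "vandermonde_ratio ?B (shift s K b') b' = vandermonde_ratio N (shift s K b) b * (\<Prod>k\<in>N. shift s K b k / b k)"
      using A(2) m mK b' c
      by (simp add: vandermonde_ratio_insert cong: prod.cong vandermonde_ratio_cong)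
    then have v1: "vandermonde_ratio ?B (shift s K b') b' = s ^ card K * vandermonde_ratio N (shift s K b) b"
      by (simp add: pr)
    have "vandermonde_ratio ?B (shift s (insert m K) b') b' = vandermonde_ratio N (shift s K b) b * (\<Prod>k\<in>N. shift s K b k / b k)"
      using A(2) m mK b' c'
      by (simp add: vandermonde_ratio_insert cong: prod.cong vandermonde_ratio_cong)
    then have v2: "vandermonde_ratio ?B (shift s (insert m K) b') b' = s ^ card K * vandermonde_ratio N (shift s K b) b"
      by (simp add: pr)
    have q: "(\<Prod>k\<in>K. \<Prod>i\<in>A. (a i - b' k) / (a i - s * b' k)) = (\<Prod>k\<in>K. \<Prod>i\<in>A. (a i - b k) / (a i - s * b k))"
      using b' that by (intro prod.cong) auto
    have q1: "(\<Prod>i\<in>A. (a i - b' m) / (a i - s * b' m)) = 1"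
      using a0 b' by (intro prod.neutral) auto
    show "kernel_weight_right s A ?B a b' K = s ^ card K * kernel_weight_right s A N a b K"
      unfolding kernel_weight_right_def v1 q by simp
    show "kernel_weight_right s A ?B a b' (insert m K) = s ^ card K * kernel_weight_right s A N a b K"
      unfolding kernel_weight_right_def v2 prod.insert[OF finK mK] q q1 by simp
  qed
  have "(\<Sum>J\<in>Pow A. x ^ card J * dual_coeff s A J a * (\<Prod>i\<in>J. \<Prod>k\<in>N. (a i - b k) / (a i - s * b k))) =
      (\<Sum>J\<in>Pow A. (x / s) ^ card J * kernel_weight_left s A ?B a b' J)"
    using left by (intro sum.cong) auto
  also have "\<dots> = (\<Sum>K\<in>Pow ?B. x ^ card K * kernel_weight_right s A ?B a b' K)"
    unfolding id using \<open>s \<noteq> 0\<close> by simp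
  also have "\<dots> = (\<Sum>K\<in>Pow N. (1 + x) * ((x * s) ^ card K * kernel_weight_right s A N a b K))"
    unfolding sum_Pow_insert[OF A(2) m]
  proof (intro sum.cong refl)
    fix K assume K: "K \<in> Pow N"
    then have "finite K" "m \<notin> K" using A m finite_subset[of K N] by auto
    then have "card (insert m K) = Suc (card K)" by simp
    then show "x ^ card K * kernel_weight_right s A ?B a b' K +
        x ^ card (insert m K) * kernel_weight_right s A ?B a b' (insert m K) =
      (1 + x) * ((x * s) ^ card K * kernel_weight_right s A N a b K)"
      unfolding right[OF K] by (simp add: algebra_simps power_mult_distrib)
  qed
  finally show ?thesis unfolding sum_distrib_left .
qed

section \<open>Infinite products and weights on the lattice\<close>

lemma convergent_prod_qpoch:
  assumes "norm q < 1"
  shows "convergent_prod (\<lambda>i. 1 - q ^ i * (x :: complex))"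
proof -
  have "summable (\<lambda>i. norm (q ^ i) * norm x)"
    using assms by (intro summable_mult2) (simp add: norm_power)
  then have "summable (\<lambda>i. norm ((1 - q ^ i * x) - 1))"
    by (simp add: norm_mult)
  then show ?thesis
    by (intro abs_convergent_prod_imp_convergent_prod summable_imp_abs_convergent_prod)
qed

lemma qpoch_inf_rec:
  assumes "norm q < 1"
  shows "qpoch_inf x q = (1 - x) * qpoch_inf (q * x) q"
proof -
  have "(\<lambda>i. 1 - q ^ i * x) has_prod ((\<Prod>k<1. 1 - q ^ k * x) * (\<Prod>k. 1 - q ^ (k + 1) * x))"
    by (rule has_prod_ignore_initial_segment') (rule convergent_prod_qpoch[OF assms])
  moreover have "(\<lambda>i. 1 - q ^ i * x) has_prod (\<Prod>i. 1 - q ^ i * x)"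
    using convergent_prod_qpoch[OF assms] by (simp add: convergent_prod_has_prod_iff)
  ultimately have "(\<Prod>i. 1 - q ^ i * x) = (\<Prod>k<1. 1 - q ^ k * x) * (\<Prod>k. 1 - q ^ (k + 1) * x)"
    by (rule has_prod_unique2[rotated])
  then show ?thesis
    unfolding qpoch_inf_def by (simp add: mult_ac)
qed

lemma qpoch_inf_nonzero:
  assumes "norm q < 1" "\<And>i. q ^ i * x \<noteq> 1"
  shows "qpoch_inf x q \<noteq> 0"
  unfolding qpoch_inf_def using assms
  by (intro prodinf_nonzero convergent_prod_qpoch) (metis right_minus_eq)+

lemma qpoch_inf_zero:
  assumes "norm q < 1" "q ^ i * x = 1"
  shows "qpoch_inf x q = 0"
  using assms(2)
proof (induction i arbitrary: x)
  case 0
  then show ?case by (subst qpoch_inf_rec[OF assms(1)]) simp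
next
  case (Suc i)
  then have "qpoch_inf (q * x) q = 0" by (intro Suc.IH) (simp add: mult_ac)
  then show ?case by (subst qpoch_inf_rec[OF assms(1)]) simp
qed

lemma qtheta_shift:
  assumes "norm q < 1" "q \<noteq> 0" "y \<noteq> 0"
  shows "qtheta (q * y) q = - qtheta y q / y"
proof -
  have 1: "qpoch_inf y q = (1 - y) * qpoch_inf (q * y) q" using qpoch_inf_rec[OF assms(1)] .
  have 2: "qpoch_inf (1 / y) q = (1 - 1 / y) * qpoch_inf (q / y) q"
    using qpoch_inf_rec[OF assms(1), of "1 / y"] by simp
  have 3: "q / (q * y) = 1 / y" using assms by simp
  show ?thesis unfolding qtheta_def 3 1 2 using assms(3) by (simp add: field_simps)
qed

text \<open>
  The hypotheses bound the steps that lead away from \<open>0\<close> only. The functions to which this is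
  applied may vanish for negative arguments, so that no bound on the steps back is available.
\<close>
lemma geometric_growth:
  fixes f :: "int \<Rightarrow> complex"
  assumes up: "\<And>e. e \<ge> 0 \<Longrightarrow> norm (f (e + 1)) \<le> \<rho> * norm (f e)"
    and down: "\<And>e. e \<le> 0 \<Longrightarrow> norm (f (e - 1)) \<le> \<rho> * norm (f e)" and "\<rho> \<ge> 0"
  shows "norm (f e) \<le> norm (f 0) * \<rho> ^ nat \<bar>e\<bar>"
proof -
  have "norm (f (int n)) \<le> norm (f 0) * \<rho> ^ n" for n
  proof (induction n)
    case (Suc n)
    have "norm (f (int (Suc n))) \<le> \<rho> * norm (f (int n))" using up[of "int n"] by (simp add: add_ac)
    also have "\<dots> \<le> \<rho> * (norm (f 0) * \<rho> ^ n)" using Suc \<open>\<rho> \<ge> 0\<close> by (intro mult_left_mono)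
    finally show ?case by (simp add: mult_ac)
  qed simp
  moreover have "norm (f (- int n)) \<le> norm (f 0) * \<rho> ^ n" for n
  proof (induction n)
    case (Suc n)
    have d: "f (- int (Suc n)) = f (- int n - 1)" by (rule arg_cong[where f = f]) simp
    have "norm (f (- int (Suc n))) \<le> \<rho> * norm (f (- int n))" unfolding d by (rule down) simp
    also have "\<dots> \<le> \<rho> * (norm (f 0) * \<rho> ^ n)" using Suc \<open>\<rho> \<ge> 0\<close> by (intro mult_left_mono)
    finally show ?case by (simp add: mult_ac)
  qed simp
  ultimately show ?thesis
    by (cases e rule: int_cases2) auto
qed

text \<open>
  The quotient tends to \<open>1\<close> as \<open>e \<rightarrow> \<infinity>\<close> and to \<open>x / y\<close> as \<open>e \<rightarrow> -\<infinity>\<close>. Where the denominator vanishes, it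
  is \<open>0\<close> by the convention on division.
\<close>
lemma ratio_bounded:
  fixes q x y :: complex
  assumes "q \<noteq> 0" "norm q < 1" "y \<noteq> 0"
  shows "\<exists>B\<ge>1. \<forall>e::int. norm ((1 - x * q powi e) / (1 - y * q powi e)) \<le> B"
proof -
  have lim: "(\<lambda>n. q ^ n) \<longlonglongrightarrow> 0" using assms(2) by (rule LIMSEQ_power_zero)
  have "(\<lambda>n. (1 - x * q ^ n) / (1 - y * q ^ n)) \<longlonglongrightarrow> (1 - x * 0) / (1 - y * 0)"
    by (intro tendsto_intros lim) simp
  then have "Bseq (\<lambda>n. (1 - x * q ^ n) / (1 - y * q ^ n))"
    by (intro convergent_imp_Bseq convergentI)
  then obtain B1 where B1: "\<And>n. norm ((1 - x * q ^ n) / (1 - y * q ^ n)) \<le> B1"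
    unfolding Bseq_def by blast
  have "(\<lambda>n. (q ^ n - x) / (q ^ n - y)) \<longlonglongrightarrow> (0 - x) / (0 - y)"
    using assms(3) by (intro tendsto_intros lim) simp
  then have "Bseq (\<lambda>n. (q ^ n - x) / (q ^ n - y))"
    by (intro convergent_imp_Bseq convergentI)
  then obtain B2 where B2: "\<And>n. norm ((q ^ n - x) / (q ^ n - y)) \<le> B2"
    unfolding Bseq_def by blast
  have "norm ((1 - x * q powi e) / (1 - y * q powi e)) \<le> max 1 (max B1 B2)" for e
  proof (cases e rule: int_cases2)
    case (nonneg n)
    then show ?thesis using B1[of n] by simp
  next
    case (nonpos n)
    have "1 - z * q powi e = (q ^ n - z) / q ^ n" for z
      using nonpos assms(1) by (simp add: power_int_minus field_simps)
    then have "(1 - x * q powi e) / (1 - y * q powi e) = (q ^ n - x) / (q ^ n - y)"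
      using assms(1) by simp
    then show ?thesis using B2[of n] by simp
  qed
  then show ?thesis by (intro exI[of _ "max 1 (max B1 B2)"]) auto
qed

definition up :: "nat set \<Rightarrow> (nat \<Rightarrow> int) \<Rightarrow> nat \<Rightarrow> int" where
  "up J m = (\<lambda>i. if i \<in> J then m i + 1 else m i)"

definition down :: "nat set \<Rightarrow> (nat \<Rightarrow> int) \<Rightarrow> nat \<Rightarrow> int" where
  "down J m = (\<lambda>i. if i \<in> J then m i - 1 else m i)"

lemma up_down [simp]: "up J (down J m) = m" "down J (up J m) = m"
  by (auto simp: up_def down_def)

definition size_on :: "nat set \<Rightarrow> (nat \<Rightarrow> int) \<Rightarrow> nat" where
  "size_on N m = (\<Sum>i\<in>N. nat \<bar>m i\<bar>)"

lemma size_on_ge: "finite N \<Longrightarrow> i \<in> N \<Longrightarrow> nat \<bar>m i\<bar> \<le> size_on N m"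
  unfolding size_on_def by (rule member_le_sum) auto

lemma prod_le_power_card:
  fixes f :: "'a \<Rightarrow> real"
  assumes "finite S" "\<And>i. i \<in> S \<Longrightarrow> 0 \<le> f i \<and> f i \<le> B"
  shows "(\<Prod>i\<in>S. f i) \<le> B ^ card S"
  using prod_mono[of S f "\<lambda>_. B"] assms by simp

text \<open>
  The parameters in the order \<open>\<alpha>\<^sub>1, \<alpha>\<^sub>2, \<dots>\<close> in which the fixed point picks them; \<open>p\<close> bounds the ranks
  that occur. The last two assumptions are genericity with denominators cleared. They hold with
  arbitrary powers of \<open>q\<close>, hence also for all lattice points \<open>\<alpha>\<^sub>i q\<^bsup>m\<^sub>i\<^esup>\<close>.
\<close>
locale trs =
  fixes p :: nat and q h :: complex and \<alpha> :: "nat \<Rightarrow> complex"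
  assumes q0: "q \<noteq> 0" and q1: "norm q < 1" and h0: "h \<noteq> 0"
    and \<alpha>0: "\<And>i. i \<in> {1..p} \<Longrightarrow> \<alpha> i \<noteq> 0"
    and ratio: "\<And>i j m. i \<in> {1..p} \<Longrightarrow> j \<in> {1..p} \<Longrightarrow> i \<noteq> j \<Longrightarrow> \<alpha> i \<noteq> q powi m * \<alpha> j"
    and hratio: "\<And>i j m. i \<in> {1..p} \<Longrightarrow> j \<in> {1..p} \<Longrightarrow> h * \<alpha> i \<noteq> q powi m * \<alpha> j"
begin

definition s :: complex where "s = h / q"

lemma s0: "s \<noteq> 0" using q0 h0 by (simp add: s_def)

lemma s_q: "q * s = h" "s * q = h" using q0 by (simp_all add: s_def)

text \<open>
  The function with \<open>\<omega>(q\<^sup>N X) / \<omega>(X) = (hX)\<^sub>N / (qX)\<^sub>N\<close>, see \<open>qpoch_ratio\<close>.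
\<close>
definition omega :: "complex \<Rightarrow> complex" where
  "omega X = qpoch_inf (q * X) q / qpoch_inf (h * X) q"

lemma omega_shift: "omega (X / q) = (1 - X) / (1 - s * X) * omega X"
proof -
  have e: "q * (X / q) = X" "h * (X / q) = s * X" "q * (s * X) = h * X"
    using q0 by (simp_all add: s_def)
  have "qpoch_inf (s * X) q = (1 - s * X) * qpoch_inf (h * X) q"
    using qpoch_inf_rec[OF q1, of "s * X"] unfolding e .
  then show ?thesis
    unfolding omega_def e qpoch_inf_rec[OF q1, of X] by simp
qed

definition pt :: "(nat \<Rightarrow> int) \<Rightarrow> nat \<Rightarrow> complex" where
  "pt m i = \<alpha> i * q powi m i"

lemma pt_nonzero: "i \<in> {1..p} \<Longrightarrow> pt m i \<noteq> 0"
  using \<alpha>0 q0 by (simp add: pt_def)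

lemma pt_up: "pt (up J m) = shift q J (pt m)"
  using q0 by (auto simp: pt_def up_def shift_def power_int_add)

lemma pt_down: "pt (down J m) = shift (1 / q) J (pt m)"
  using q0 by (auto simp: pt_def down_def shift_def power_int_diff)

lemma pt_ratio:
  assumes "i \<in> {1..p}" "j \<in> {1..p}" "i \<noteq> j"
  shows "pt m i \<noteq> q powi e * pt d j"
proof
  assume *: "pt m i = q powi e * pt d j"
  have "\<alpha> i = q powi (e + d j - m i) * \<alpha> j"
    using * q0 by (simp add: pt_def power_int_add power_int_diff field_simps)
  then show False using ratio[OF assms] by blast
qed

lemma pt_hratio:
  assumes "i \<in> {1..p}" "j \<in> {1..p}"
  shows "h * pt m i \<noteq> q powi e * pt d j"
proof
  assume *: "h * pt m i = q powi e * pt d j"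
  have "h * \<alpha> i = q powi (e + d j - m i) * \<alpha> j"
    using * q0 by (simp add: pt_def power_int_add power_int_diff field_simps)
  then show False using hratio[OF assms] by blast
qed

lemma pt_distinct:
  assumes "i \<in> {1..p}" "j \<in> {1..p}" "i \<noteq> j"
  shows "pt m i \<noteq> pt d j" "pt m i \<noteq> q * pt d j"
  using pt_ratio[OF assms, of m 0 d] pt_ratio[OF assms, of m 1 d] by simp_all

lemma pt_s:
  assumes "i \<in> {1..p}" "j \<in> {1..p}"
  shows "pt d j \<noteq> s * pt m i"
proof
  assume "pt d j = s * pt m i"
  then have "h * pt m i = q powi 1 * pt d j" using q0 by (simp add: s_def field_simps)
  then show False using pt_hratio[OF assms] by blast
qed

lemma pt_h:
  assumes "i \<in> {1..p}" "j \<in> {1..p}"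
  shows "pt d j \<noteq> h * pt m i"
  using pt_hratio[OF assms, of m 0 d] by auto

text \<open>
  A pair of adjacent rows \<open>d\<close> and \<open>m\<close> of the vertex term contributes this ratio, up to a factor
  that does not depend on the degrees.
\<close>
definition weight :: "nat set \<Rightarrow> nat set \<Rightarrow> (nat \<Rightarrow> int) \<Rightarrow> (nat \<Rightarrow> int) \<Rightarrow> complex" where
  "weight N K m d = (\<Prod>j\<in>N. \<Prod>k\<in>K. omega (pt d j / pt m k)) / (\<Prod>j\<in>N. \<Prod>k\<in>N. omega (pt d j / pt d k))"

lemma q_power_neq_one: "i > 0 \<Longrightarrow> q ^ i \<noteq> 1"
  using q1 power_eq_1_iff by fastforce

lemma omega_nonzero:
  assumes "j \<in> {1..p}" "k \<in> {1..p}" "j \<noteq> k \<or> d j \<ge> m k"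
  shows "omega (pt d j / pt m k) \<noteq> 0"
proof -
  have "qpoch_inf (q * (pt d j / pt m k)) q \<noteq> 0"
  proof (rule qpoch_inf_nonzero[OF q1])
    fix i
    show "q ^ i * (q * (pt d j / pt m k)) \<noteq> 1"
    proof (cases "j = k")
      case False
      have "pt m k \<noteq> q powi (int i + 1) * pt d j" using pt_ratio assms False by metis
      then show ?thesis using pt_nonzero[of k m] assms q0
        by (auto simp: power_int_add field_simps)
    next
      case True
      have "pt d j / pt m k = q powi (d j - m k)"
        using True \<alpha>0 assms q0 by (simp add: pt_def power_int_diff)
      also have "\<dots> = q ^ nat (d j - m k)"
        using True assms(3) by (metis diff_ge_0_iff_ge int_nat_eq power_int_of_nat)
      finally have "q ^ i * (q * (pt d j / pt m k)) = q ^ (i + 1 + nat (d j - m k))"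
        by (simp add: power_add)
      moreover have "q ^ (i + 1 + nat (d j - m k)) \<noteq> 1" by (rule q_power_neq_one) simp
      ultimately show ?thesis by (simp only: not_False_eq_True)
    qed
  qed
  moreover have "qpoch_inf (h * (pt d j / pt m k)) q \<noteq> 0"
  proof (rule qpoch_inf_nonzero[OF q1])
    fix i
    have "h * pt d j \<noteq> q powi (- int i) * pt m k" using pt_hratio assms by blast
    then show "q ^ i * (h * (pt d j / pt m k)) \<noteq> 1"
      using pt_nonzero[of k m] assms q0 by (auto simp: power_int_minus field_simps)
  qed
  ultimately show ?thesis by (simp add: omega_def)
qed

text \<open>
  \<open>\<omega>(q\<^sup>e) = 0\<close> for \<open>e < 0\<close>. So the sums over the whole lattice reduce to \<open>d \<ge> m\<close>, and the
  reindexing \<open>d \<mapsto> d - 1\<^sub>J\<close> needs no boundary terms.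
\<close>
lemma weight_zero:
  assumes "finite N" "finite K" "j \<in> N" "j \<in> K" "j \<in> {1..p}" "d j < m j"
  shows "weight N K m d = 0"
proof -
  define i where "i = nat (m j - d j - 1)"
  have "m j = d j + int i + 1" using assms by (simp add: i_def)
  then have "q ^ i * (q * (pt d j / pt m j)) = 1"
    using q0 \<alpha>0[of j] assms by (simp add: pt_def power_int_add)
  then have "omega (pt d j / pt m j) = 0"
    unfolding omega_def using qpoch_inf_zero[OF q1] by auto
  then have "(\<Prod>j\<in>N. \<Prod>k\<in>K. omega (pt d j / pt m k)) = 0"
    using assms by (meson prod_zero)
  then show ?thesis by (simp add: weight_def)
qed

lemma weight_self:
  assumes "N \<subseteq> {1..p}"
  shows "weight N N m m = 1"
proof -
  have "finite N" using assms finite_subset by blast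
  then have "(\<Prod>j\<in>N. \<Prod>k\<in>N. omega (pt m j / pt m k)) \<noteq> 0"
    using omega_nonzero assms by (auto simp: subset_iff)
  then show ?thesis by (simp add: weight_def)
qed

subsection \<open>Shifting the lower argument of the weight\<close>

lemma prod_square_pairs:
  fixes f :: "nat \<Rightarrow> nat \<Rightarrow> complex"
  assumes "finite N"
  shows "(\<Prod>j\<in>N. \<Prod>k\<in>N. f j k) = (\<Prod>j\<in>N. f j j) * (\<Prod>(i, j)\<in>ordered_pairs N. f i j * f j i)"
  using assms
proof (induction rule: finite_induct)
  case (insert n N)
  have "(\<Prod>j\<in>insert n N. \<Prod>k\<in>insert n N. f j k) =
      f n n * (\<Prod>k\<in>N. f n k) * ((\<Prod>j\<in>N. f j n) * (\<Prod>j\<in>N. \<Prod>k\<in>N. f j k))"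
    using insert.hyps by (simp add: prod.distrib mult_ac)
  moreover have "(\<Prod>(i, j)\<in>ordered_pairs (insert n N). f i j * f j i) =
      (\<Prod>(i, j)\<in>ordered_pairs N. f i j * f j i) * (\<Prod>i\<in>N. f i n * f n i)"
    using insert.hyps by (intro prod_ordered_pairs_insert) auto
  ultimately show ?case using insert by (simp add: prod.distrib mult_ac)
qed (simp add: ordered_pairs_def)

text \<open>
  Every element of \<open>J \<inter> N\<close> belongs to \<open>card N - 1\<close> of the pairs. The two factors are kept apart so that
  they can be distributed over the pairs in \<open>dual_coeff_pairs\<close>.
\<close>
lemma prod_pairs_indicator:
  fixes c :: complex
  assumes "finite N"
  shows "(\<Prod>(i, j)\<in>ordered_pairs N. (if i \<in> J then c else 1) * (if j \<in> J then c else 1)) =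
    c ^ ((card N - 1) * card (J \<inter> N))"
  using assms
proof (induction rule: finite_induct)
  case (insert n N)
  have *: "(\<Prod>i\<in>N. if i \<in> J then c else 1) = c ^ card (J \<inter> N)"
    using insert.hyps by (simp add: prod.If_cases Int_commute)
  have "(\<Prod>(i, j)\<in>ordered_pairs (insert n N). (if i \<in> J then c else 1) * (if j \<in> J then c else 1)) =
      c ^ ((card N - 1) * card (J \<inter> N)) * (\<Prod>i\<in>N. (if i \<in> J then c else 1) * (if n \<in> J then c else 1))"
    unfolding insert.IH[symmetric] using insert.hyps by (intro prod_ordered_pairs_insert) auto
  also have "(\<Prod>i\<in>N. (if i \<in> J then c else 1) * (if n \<in> J then c else 1)) =
      c ^ card (J \<inter> N) * (if n \<in> J then c ^ card N else 1)"
    unfolding prod.distrib * by simp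
  also have "c ^ ((card N - 1) * card (J \<inter> N)) * (c ^ card (J \<inter> N) * (if n \<in> J then c ^ card N else 1)) =
      c ^ ((card N - 1) * card (J \<inter> N) + card (J \<inter> N) + (if n \<in> J then card N else 0))"
    by (simp add: power_add)
  also have "(card N - 1) * card (J \<inter> N) + card (J \<inter> N) = card N * card (J \<inter> N)"
  proof (cases "card N = 0")
    case True
    then show ?thesis using insert.hyps by simp
  next
    case False
    then obtain k where "card N = Suc k" by (cases "card N") auto
    then show ?thesis by simp
  qed
  also have "card N * card (J \<inter> N) + (if n \<in> J then card N else 0) = card N * card (J \<inter> insert n N)"
    using insert.hyps by (auto simp: Int_insert_right)
  finally show ?case using insert.hyps by simp
qed (simp add: ordered_pairs_def)

lemma dual_coeff_pairs:
  assumes "finite N" "J \<subseteq> N"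
  shows "dual_coeff c N J a = (\<Prod>(i, j)\<in>ordered_pairs N. (if i \<in> J then c else 1) * (if j \<in> J then c else 1) *
    ((shift (1 / c) J a i - shift (1 / c) J a j) / (a i - a j)))"
proof -
  have "J \<inter> N = J" using assms by auto
  moreover have "(\<Prod>(i, j)\<in>ordered_pairs N. (if i \<in> J then c else 1) * (if j \<in> J then c else 1) *
      ((shift (1 / c) J a i - shift (1 / c) J a j) / (a i - a j))) =
    (\<Prod>(i, j)\<in>ordered_pairs N. (if i \<in> J then c else 1) * (if j \<in> J then c else 1)) *
    (\<Prod>(i, j)\<in>ordered_pairs N. (shift (1 / c) J a i - shift (1 / c) J a j) / (a i - a j))"
    by (simp only: case_prod_unfold prod.distrib)
  ultimately show ?thesis
    unfolding dual_coeff_def vandermonde_ratio_def prod_pairs_indicator[OF assms(1)] by simp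
qed

text \<open>
  The part of \<open>weight_shift\<close> that involves a single pair \<open>{i, j}\<close>. Only the case in which exactly one of
  \<open>i\<close> and \<open>j\<close> is shifted has content; it is the functional equation of \<open>\<omega>\<close>, used once in each
  direction.
\<close>
lemma weight_shift_pair:
  fixes d :: "nat \<Rightarrow> int" and J :: "nat set"
  assumes ij: "i \<in> {1..p}" "j \<in> {1..p}" "i \<noteq> j"
  defines "b \<equiv> pt d" and "b' \<equiv> pt (down J d)"
  shows "(if i \<in> J then s else 1) * (if j \<in> J then s else 1) *
      ((shift (1 / s) J b' i - shift (1 / s) J b' j) / (b' i - b' j)) *
      (omega (b i / b j) * omega (b j / b i)) =
    ((shift s J b i - shift s J b j) / (b i - b j)) * (omega (b' i / b' j) * omega (b' j / b' i))"
proof -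
  have b': "b' = shift (1 / q) J b" unfolding b_def b'_def by (rule pt_down)
  have nz: "b i \<noteq> 0" "b j \<noteq> 0" unfolding b_def using pt_nonzero ij by auto
  have ne: "b i \<noteq> b j" "b i \<noteq> q * b j" "b j \<noteq> q * b i"
    unfolding b_def using pt_distinct ij by metis+
  have ns: "b i \<noteq> s * b j" "b j \<noteq> s * b i" "b i \<noteq> h * b j" "b j \<noteq> h * b i"
    unfolding b_def using pt_s pt_h ij by metis+
  have one: "s * ((x / q / s - y) / (x / q - y)) * (omega (x / y) * omega (y / x)) =
      ((s * x - y) / (x - y)) * (omega (x / q / y) * omega (y / (x / q)))"
    if "x \<noteq> 0" "y \<noteq> 0" "x \<noteq> y" "x \<noteq> q * y" "y \<noteq> s * x" "x \<noteq> h * y" for x y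
  proof -
    have e: "1 - x / y = (y - x) / y" "1 - s * (x / y) = (y - s * x) / y" "x / q / y = x / y / q"
      using that by (simp_all add: field_simps)
    have 1: "omega (x / q / y) = (y - x) / (y - s * x) * omega (x / y)"
      unfolding e(3) omega_shift e(1,2) using that by simp
    have e': "1 - q * y / x = (x - q * y) / x" "1 - s * (q * y / x) = (x - h * y) / x" "q * y / x / q = y / x"
      "y / (x / q) = q * y / x"
      using that q0 by (simp_all add: s_def field_simps)
    have "omega (y / x) = (x - q * y) / (x - h * y) * omega (y / (x / q))"
      unfolding e'(4) using omega_shift[of "q * y / x"] that unfolding e'(1-3) by simp
    then have 2: "omega (y / (x / q)) = (x - h * y) / (x - q * y) * omega (y / x)"
      using that by simp
    have 3: "s * ((x / q / s - y) / (x / q - y)) = (x - h * y) / (x - q * y)"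
    proof -
      have e: "s * (x / q / s - y) = (x - h * y) / q" "x / q - y = (x - q * y) / q"
        using q0 h0 by (simp_all add: s_def field_simps)
      show ?thesis unfolding times_divide_eq_right e using q0 by simp
    qed
    have 4: "(s * x - y) / (x - y) * ((y - x) / (y - s * x)) = 1"
    proof -
      have "s * x - y = - (y - s * x)" "x - y = - (y - x)" by simp_all
      moreover have "y - s * x \<noteq> 0" "y - x \<noteq> 0" using that by auto
      ultimately show ?thesis by (simp del: minus_diff_eq) (simp add: algebra_simps)
    qed
    have "((s * x - y) / (x - y)) * (omega (x / q / y) * omega (y / (x / q))) =
      ((s * x - y) / (x - y) * ((y - x) / (y - s * x))) * omega (x / y) * ((x - h * y) / (x - q * y) * omega (y / x))"
      unfolding 1 2 by (simp add: mult_ac)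
    then show ?thesis unfolding 3 4 by simp
  qed
  show ?thesis
  proof (cases "i \<in> J"; cases "j \<in> J")
    assume "i \<in> J" "j \<in> J"
    moreover have "s * s * ((b i / q / s - b j / q / s) / (b i / q - b j / q)) = s"
    proof -
      have "b i / q / s - b j / q / s = (b i / q - b j / q) / s" by (simp add: diff_divide_distrib)
      moreover have "b i / q - b j / q \<noteq> 0" using ne(1) q0 by simp
      ultimately show ?thesis using s0 by simp
    qed
    moreover have "(s * b i - s * b j) / (b i - b j) = s"
    proof -
      have "s * b i - s * b j = s * (b i - b j)" by (simp add: right_diff_distrib)
      then show ?thesis using ne(1) by simp
    qed
    moreover have e: "b' i = b i / q" "b' j = b j / q" "shift (1 / s) J b' i = b i / q / s"
      "shift (1 / s) J b' j = b j / q / s" "shift s J b i = s * b i" "shift s J b j = s * b j"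
      unfolding b' using \<open>i \<in> J\<close> \<open>j \<in> J\<close> by simp_all
    moreover have "b i / q / (b j / q) = b i / b j" "b j / q / (b i / q) = b j / b i" using q0 by simp_all
    ultimately show ?thesis by (simp only: if_True)
  next
    assume J: "i \<in> J" "j \<notin> J"
    have e: "b' i = b i / q" "b' j = b j" "shift (1 / s) J b' i = b i / q / s"
      "shift (1 / s) J b' j = b j" "shift s J b i = s * b i" "shift s J b j = b j"
      unfolding b' using J by simp_all
    show ?thesis
      using one[of "b i" "b j"] nz ne ns unfolding e if_P[OF J(1)] if_not_P[OF J(2)] mult_1_right
      by blast
  next
    assume J: "i \<notin> J" "j \<in> J"
    have sw: "(u - v) / (w - z) = (v - u) / (z - w)" for u v w z :: complex
      by (metis minus_diff_eq minus_divide_divide)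
    have e: "b' i = b i" "b' j = b j / q" "shift (1 / s) J b' i = b i"
      "shift (1 / s) J b' j = b j / q / s" "shift s J b i = b i" "shift s J b j = s * b j"
      unfolding b' using J by simp_all
    have "s * ((b j / q / s - b i) / (b j / q - b i)) * (omega (b j / b i) * omega (b i / b j)) =
      ((s * b j - b i) / (b j - b i)) * (omega (b j / q / b i) * omega (b i / (b j / q)))"
      using one[of "b j" "b i"] nz ne ns by metis
    then show ?thesis
      unfolding e if_P[OF J(2)] if_not_P[OF J(1)] mult_1_left
        sw[of "b i" "b j / q / s"] sw[of "b i" "s * b j"]
        mult.commute[of "omega (b i / b j)"] mult.commute[of "omega (b i / (b j / q))"] .
  next
    assume "i \<notin> J" "j \<notin> J"
    then show ?thesis unfolding b' using ne by simp
  qed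
qed

text \<open>
  Pieri coefficients at \<open>d - 1\<^sub>J\<close>, multiplied by the weight there, become the right-hand coefficients
  of the kernel identity at \<open>d\<close>. All lattice shifts below are moved off \<open>\<Psi>\<close> in this way.
\<close>
theorem weight_shift:
  assumes "J \<subseteq> N" "N \<subseteq> {1..p}" "K \<subseteq> {1..p}"
  shows "weight N K m (down J d) * dual_coeff s N J (pt (down J d)) =
    weight N K m d * kernel_weight_right s K N (pt m) (pt d) J"
proof -
  have fin: "finite N" "finite K" using assms finite_subset by blast+
  let ?b = "pt d" and ?b' = "pt (down J d)"
  define num where "num e = (\<Prod>j\<in>N. \<Prod>k\<in>K. omega (pt e j / pt m k))" for e
  define den where "den e = (\<Prod>j\<in>N. \<Prod>k\<in>N. omega (pt e j / pt e k))" for e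
  have denz: "den e \<noteq> 0" for e
    unfolding den_def using omega_nonzero fin assms by (auto simp: subset_iff)
  have "num (down J d) = (\<Prod>j\<in>N. (if j \<in> J then \<Prod>k\<in>K. (pt m k - ?b j) / (pt m k - s * ?b j) else 1) *
      (\<Prod>k\<in>K. omega (?b j / pt m k)))"
    unfolding num_def
  proof (intro prod.cong refl)
    fix j assume j: "j \<in> N"
    show "(\<Prod>k\<in>K. omega (?b' j / pt m k)) = (if j \<in> J then \<Prod>k\<in>K. (pt m k - ?b j) / (pt m k - s * ?b j) else 1) *
      (\<Prod>k\<in>K. omega (?b j / pt m k))"
    proof (cases "j \<in> J")
      case True
      have "(\<Prod>k\<in>K. omega (?b' j / pt m k)) = (\<Prod>k\<in>K. (pt m k - ?b j) / (pt m k - s * ?b j) * omega (?b j / pt m k))"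
      proof (intro prod.cong refl)
        fix k assume k: "k \<in> K"
        have nz: "pt m k \<noteq> 0" using pt_nonzero k assms by auto
        have "?b' j / pt m k = (?b j / pt m k) / q" unfolding pt_down using True by simp
        moreover have "1 - ?b j / pt m k = (pt m k - ?b j) / pt m k"
          "1 - s * (?b j / pt m k) = (pt m k - s * ?b j) / pt m k"
          using nz q0 by (simp_all add: field_simps)
        ultimately show "omega (?b' j / pt m k) = (pt m k - ?b j) / (pt m k - s * ?b j) * omega (?b j / pt m k)"
          using omega_shift[of "?b j / pt m k"] nz by simp
      qed
      then show ?thesis by (simp only: True if_True prod.distrib)
    next
      case False
      then show ?thesis unfolding pt_down by simp
    qed
  qed
  also have "\<dots> = (\<Prod>j\<in>J. \<Prod>k\<in>K. (pt m k - ?b j) / (pt m k - s * ?b j)) * num d"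
    unfolding prod.distrib num_def using fin assms(1) by (simp add: prod.If_cases Int_absorb1)
  finally have num: "num (down J d) = (\<Prod>j\<in>J. \<Prod>k\<in>K. (pt m k - ?b j) / (pt m k - s * ?b j)) * num d" .
  have "dual_coeff s N J ?b' * den d = vandermonde_ratio N (shift s J ?b) ?b * den (down J d)"
  proof -
    have "dual_coeff s N J ?b' * (\<Prod>(i, j)\<in>ordered_pairs N. omega (?b i / ?b j) * omega (?b j / ?b i)) =
      vandermonde_ratio N (shift s J ?b) ?b * (\<Prod>(i, j)\<in>ordered_pairs N. omega (?b' i / ?b' j) * omega (?b' j / ?b' i))"
      unfolding dual_coeff_pairs[OF fin(1) assms(1)] vandermonde_ratio_def prod.distrib[symmetric]
    proof (intro prod.cong refl, clarsimp simp only: case_prod_conv split_paired_all)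
      fix i j assume "(i, j) \<in> ordered_pairs N"
      then have "i \<in> {1..p}" "j \<in> {1..p}" "i \<noteq> j" using assms by (auto simp: ordered_pairs_def)
      then show "(if i \<in> J then s else 1) * (if j \<in> J then s else 1) *
      ((shift (1 / s) J ?b' i - shift (1 / s) J ?b' j) / (?b' i - ?b' j)) *
      (omega (?b i / ?b j) * omega (?b j / ?b i)) =
    ((shift s J ?b i - shift s J ?b j) / (?b i - ?b j)) * (omega (?b' i / ?b' j) * omega (?b' j / ?b' i))"
        by (rule weight_shift_pair)
    qed
    moreover have "(\<Prod>j\<in>N. omega (pt e j / pt e j)) = omega 1 ^ card N" for e
    proof -
      have "(\<Prod>j\<in>N. omega (pt e j / pt e j)) = (\<Prod>j\<in>N. omega 1)"
        using pt_nonzero assms by (intro prod.cong) auto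
      then show ?thesis by simp
    qed
    ultimately show ?thesis
      unfolding den_def prod_square_pairs[OF fin(1)] by (simp add: mult_ac)
  qed
  then have "dual_coeff s N J ?b' / den (down J d) = vandermonde_ratio N (shift s J ?b) ?b / den d"
    using denz[of d] denz[of "down J d"] by (simp add: frac_eq_eq)
  moreover have "num (down J d) / den (down J d) * dual_coeff s N J ?b' =
     num (down J d) * (dual_coeff s N J ?b' / den (down J d))"
    by simp
  ultimately have "num (down J d) / den (down J d) * dual_coeff s N J ?b' =
     num (down J d) * (vandermonde_ratio N (shift s J ?b) ?b / den d)"
    by (simp only:)
  then show ?thesis
    unfolding weight_def num_def[symmetric] den_def[symmetric] num kernel_weight_right_def by simp
qed

lemma weight_shift_upper:
  assumes "J \<subseteq> K" "N \<subseteq> {1..p}" "K \<subseteq> {1..p}"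
  shows "weight N K (up J m) d =
    weight N K m d * (\<Prod>i\<in>J. \<Prod>k\<in>N. (pt m i - pt d k) / (pt m i - s * pt d k))"
proof -
  have fin: "finite N" "finite K" using assms finite_subset by blast+
  have eq: "(\<Prod>k\<in>N. omega (pt d k / pt (up J m) i)) =
    (\<Prod>k\<in>N. omega (pt d k / pt m i)) * (if i \<in> J then \<Prod>k\<in>N. (pt m i - pt d k) / (pt m i - s * pt d k) else 1)"
    if i: "i \<in> K" for i
  proof (cases "i \<in> J")
    case True
    have "omega (pt d k / pt (up J m) i) = omega (pt d k / pt m i) * ((pt m i - pt d k) / (pt m i - s * pt d k))"
      if "k \<in> N" for k
    proof -
      have nz: "pt m i \<noteq> 0" using pt_nonzero i assms by auto
      have "pt (up J m) i = q * pt m i" unfolding pt_up using True by simp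
      then have e1: "pt d k / pt (up J m) i = (pt d k / pt m i) / q" by simp
      have e2: "1 - pt d k / pt m i = (pt m i - pt d k) / pt m i"
        "1 - s * (pt d k / pt m i) = (pt m i - s * pt d k) / pt m i"
        using nz q0 by (simp_all add: field_simps)
      show ?thesis unfolding e1 omega_shift e2 using nz by simp
    qed
    then have "(\<Prod>k\<in>N. omega (pt d k / pt (up J m) i)) =
      (\<Prod>k\<in>N. omega (pt d k / pt m i) * ((pt m i - pt d k) / (pt m i - s * pt d k)))"
      by (intro prod.cong) auto
    then show ?thesis by (simp only: True if_True prod.distrib)
  next
    case False
    then show ?thesis unfolding pt_up by simp
  qed
  have "(\<Prod>j\<in>N. \<Prod>k\<in>K. omega (pt d j / pt (up J m) k)) = (\<Prod>k\<in>K. \<Prod>j\<in>N. omega (pt d j / pt (up J m) k))"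
    by (rule prod.swap)
  also have "\<dots> = (\<Prod>k\<in>K. \<Prod>j\<in>N. omega (pt d j / pt m k)) * (\<Prod>i\<in>J. \<Prod>k\<in>N. (pt m i - pt d k) / (pt m i - s * pt d k))"
    using eq fin assms(1) by (simp add: prod.distrib prod.If_cases Int_absorb1 cong: prod.cong)
  also have "(\<Prod>k\<in>K. \<Prod>j\<in>N. omega (pt d j / pt m k)) = (\<Prod>j\<in>N. \<Prod>k\<in>K. omega (pt d j / pt m k))"
    by (rule prod.swap)
  finally show ?thesis by (simp add: weight_def)
qed

subsection \<open>Growth of the weight\<close>

text \<open>
  By the functional equation of \<open>\<omega>\<close>, consecutive values along \<open>X q\<^sup>e\<close> have the bounded quotients
  of \<open>ratio_bounded\<close>. For the inverses this argument breaks down if \<open>j = k\<close>, as \<open>\<omega>(q\<^sup>e)\<close> vanishes for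
  \<open>e < 0\<close>; in the denominator of \<open>weight\<close> the factors with \<open>j = k\<close> are the constant \<open>\<omega>(1)\<close>.
\<close>
lemma omega_growth:
  assumes jk: "j \<in> {1..p}" "k \<in> {1..p}"
  shows "\<exists>C\<ge>1. \<exists>\<rho>\<ge>1. \<forall>m d. norm (omega (pt d j / pt m k)) \<le> C * \<rho> ^ nat \<bar>d j - m k\<bar> \<and>
    (j \<noteq> k \<longrightarrow> norm (inverse (omega (pt d j / pt m k))) \<le> C * \<rho> ^ nat \<bar>d j - m k\<bar>)"
proof -
  define X where "X = \<alpha> j / \<alpha> k"
  have X0: "X \<noteq> 0" using \<alpha>0 jk by (simp add: X_def)
  obtain B1 where B1: "B1 \<ge> 1" "\<And>e::int. norm ((1 - X * q powi e) / (1 - s * X * q powi e)) \<le> B1"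
    using ratio_bounded[OF q0 q1, of "s * X" X] X0 s0 by auto
  obtain B2 where B2: "B2 \<ge> 1" "\<And>e::int. norm ((1 - s * X * q powi e) / (1 - X * q powi e)) \<le> B2"
    using ratio_bounded[OF q0 q1, of X "s * X"] X0 by auto
  define \<rho> where "\<rho> = max B1 B2"
  define f where "f e = omega (X * q powi e)" for e :: int
  have X1: "X * q powi e \<noteq> 1" if "j \<noteq> k \<or> e > 0" for e
  proof (cases "j = k")
    case True
    then have "X = 1" using \<alpha>0 jk by (simp add: X_def)
    moreover have "q powi e = q ^ nat e" using that True by (metis less_imp_le int_nat_eq power_int_of_nat)
    ultimately show ?thesis using q_power_neq_one[of "nat e"] that True by simp
  next
    case False
    then show ?thesis using ratio[of k j e] jk \<alpha>0 by (auto simp: X_def field_simps)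
  qed
  have X2: "s * X * q powi e \<noteq> 1" for e
  proof
    assume *: "s * X * q powi e = 1"
    have nz: "q powi e \<noteq> 0" using q0 by simp
    have "h * \<alpha> j * q powi e = q * \<alpha> k" using * q0 \<alpha>0 jk by (simp add: X_def s_def field_simps)
    then have "h * \<alpha> j = q powi (1 - e) * \<alpha> k" using q0 nz by (simp add: power_int_diff field_simps)
    then show False using hratio jk by blast
  qed
  have rec: "f (e - 1) = (1 - X * q powi e) / (1 - s * X * q powi e) * f e" for e
    using omega_shift[of "X * q powi e"] q0 unfolding f_def by (simp add: power_int_diff mult.assoc)
  have rec': "f (e + 1) = (1 - s * X * q powi (e + 1)) / (1 - X * q powi (e + 1)) * f e"
    if "j \<noteq> k \<or> e + 1 > 0" for e
    using rec[of "e + 1"] X1[OF that] X2[of "e + 1"] by simp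
  have up: "norm (f (e + 1)) \<le> \<rho> * norm (f e)" if "e \<ge> 0" for e
  proof -
    have "norm (f (e + 1)) = norm ((1 - s * X * q powi (e + 1)) / (1 - X * q powi (e + 1))) * norm (f e)"
      using that by (subst rec') (simp_all only: norm_mult, simp)
    also have "\<dots> \<le> \<rho> * norm (f e)" using B2(2)[of "e + 1"] by (intro mult_right_mono) (auto simp: \<rho>_def)
    finally show ?thesis .
  qed
  have down: "norm (f (e - 1)) \<le> \<rho> * norm (f e)" for e
  proof -
    have "norm (f (e - 1)) = norm ((1 - X * q powi e) / (1 - s * X * q powi e)) * norm (f e)"
      by (subst rec) (simp only: norm_mult)
    also have "\<dots> \<le> \<rho> * norm (f e)" using B1(2)[of e] by (intro mult_right_mono) (auto simp: \<rho>_def)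
    finally show ?thesis .
  qed
  have b1: "norm (f e) \<le> norm (f 0) * \<rho> ^ nat \<bar>e\<bar>" for e
    using up down B1(1) by (intro geometric_growth) (auto simp: \<rho>_def)
  have b2: "norm (inverse (f e)) \<le> norm (inverse (f 0)) * \<rho> ^ nat \<bar>e\<bar>" if jk': "j \<noteq> k" for e
  proof (rule geometric_growth)
    fix e :: int
    have "inverse (f (e + 1)) = (1 - X * q powi (e + 1)) / (1 - s * X * q powi (e + 1)) * inverse (f e)"
      using jk' by (subst rec') (simp_all only: divide_inverse inverse_mult_distrib inverse_inverse_eq mult_ac simp_thms)
    then have "norm (inverse (f (e + 1))) = norm ((1 - X * q powi (e + 1)) / (1 - s * X * q powi (e + 1))) * norm (inverse (f e))"
      by (metis norm_mult)
    also have "\<dots> \<le> \<rho> * norm (inverse (f e))" using B1(2)[of "e + 1"] by (intro mult_right_mono) (auto simp: \<rho>_def)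
    finally show "norm (inverse (f (e + 1))) \<le> \<rho> * norm (inverse (f e))" .
    have "inverse (f (e - 1)) = (1 - s * X * q powi e) / (1 - X * q powi e) * inverse (f e)"
      by (subst rec) (simp only: divide_inverse inverse_mult_distrib inverse_inverse_eq mult_ac)
    then have "norm (inverse (f (e - 1))) = norm ((1 - s * X * q powi e) / (1 - X * q powi e)) * norm (inverse (f e))"
      by (metis norm_mult)
    also have "\<dots> \<le> \<rho> * norm (inverse (f e))" using B2(2)[of e] by (intro mult_right_mono) (auto simp: \<rho>_def)
    finally show "norm (inverse (f (e - 1))) \<le> \<rho> * norm (inverse (f e))" .
  qed (use B1(1) in \<open>auto simp: \<rho>_def\<close>)
  define C where "C = max 1 (max (norm (f 0)) (norm (inverse (f 0))))"
  have fpt: "omega (pt d j / pt m k) = f (d j - m k)" for m d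
    using q0 \<alpha>0 jk by (simp add: f_def X_def pt_def power_int_diff)
  have \<rho>1: "\<rho> \<ge> 1" using B1(1) by (simp add: \<rho>_def)
  have w: "norm z * \<rho> ^ n \<le> C * \<rho> ^ n" if "norm z \<le> C" for z :: complex and n
    using that \<rho>1 by (intro mult_right_mono) auto
  have "norm (f 0) \<le> C" "norm (inverse (f 0)) \<le> C" by (auto simp: C_def)
  then have "norm (omega (pt d j / pt m k)) \<le> C * \<rho> ^ nat \<bar>d j - m k\<bar> \<and>
    (j \<noteq> k \<longrightarrow> norm (inverse (omega (pt d j / pt m k))) \<le> C * \<rho> ^ nat \<bar>d j - m k\<bar>)" for m d
    unfolding fpt using b1 b2 w by (meson order_trans)
  then show ?thesis using \<rho>1 by (intro exI[of _ C] exI[of _ \<rho>] conjI) (auto simp: C_def)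
qed

lemma omega_growth_uniform:
  "\<exists>C\<ge>1. \<exists>\<rho>\<ge>1. \<forall>j\<in>{1..p}. \<forall>k\<in>{1..p}. \<forall>m d.
    norm (omega (pt d j / pt m k)) \<le> C * \<rho> ^ nat \<bar>d j - m k\<bar> \<and>
    (j \<noteq> k \<longrightarrow> norm (inverse (omega (pt d j / pt m k))) \<le> C * \<rho> ^ nat \<bar>d j - m k\<bar>)"
proof -
  have "\<forall>j k. \<exists>C \<rho>. j \<in> {1..p} \<longrightarrow> k \<in> {1..p} \<longrightarrow> C \<ge> 1 \<and> \<rho> \<ge> 1 \<and> (\<forall>m d.
    norm (omega (pt d j / pt m k)) \<le> C * \<rho> ^ nat \<bar>d j - m k\<bar> \<and>
    (j \<noteq> k \<longrightarrow> norm (inverse (omega (pt d j / pt m k))) \<le> C * \<rho> ^ nat \<bar>d j - m k\<bar>))"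
    using omega_growth by blast
  then obtain C \<rho> where *: "\<And>j k. j \<in> {1..p} \<Longrightarrow> k \<in> {1..p} \<Longrightarrow> C j k \<ge> (1::real) \<and> \<rho> j k \<ge> (1::real) \<and> (\<forall>m d.
    norm (omega (pt d j / pt m k)) \<le> C j k * \<rho> j k ^ nat \<bar>d j - m k\<bar> \<and>
    (j \<noteq> k \<longrightarrow> norm (inverse (omega (pt d j / pt m k))) \<le> C j k * \<rho> j k ^ nat \<bar>d j - m k\<bar>))"
    unfolding choice_iff by blast
  define C' where "C' = 1 + (\<Sum>j\<in>{1..p}. \<Sum>k\<in>{1..p}. \<bar>C j k\<bar>)"
  define \<rho>' where "\<rho>' = 1 + (\<Sum>j\<in>{1..p}. \<Sum>k\<in>{1..p}. \<bar>\<rho> j k\<bar>)"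
  have le: "x j k \<le> 1 + (\<Sum>j\<in>{1..p}. \<Sum>k\<in>{1..p}. \<bar>x j k\<bar>)" if "j \<in> {1..p}" "k \<in> {1..p}" for x :: "nat \<Rightarrow> nat \<Rightarrow> real" and j k
  proof -
    have "x j k \<le> \<bar>x j k\<bar>" by simp
    also have "\<dots> \<le> (\<Sum>k\<in>{1..p}. \<bar>x j k\<bar>)" using that by (intro member_le_sum) auto
    also have "\<dots> \<le> (\<Sum>j\<in>{1..p}. \<Sum>k\<in>{1..p}. \<bar>x j k\<bar>)"
      using that by (intro member_le_sum[of j "{1..p}" "\<lambda>j. \<Sum>k\<in>{1..p}. \<bar>x j k\<bar>"] sum_nonneg) auto
    finally show ?thesis by simp
  qed
  have ge: "C' \<ge> 1" "\<rho>' \<ge> 1" by (auto simp: C'_def \<rho>'_def intro!: sum_nonneg)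
  have "C j k * \<rho> j k ^ n \<le> C' * \<rho>' ^ n" if "j \<in> {1..p}" "k \<in> {1..p}" for j k n
    using le[OF that, of C] le[OF that, of \<rho>] *[OF that]
    unfolding C'_def[symmetric] \<rho>'_def[symmetric] by (intro mult_mono power_mono) auto
  then have "\<forall>j\<in>{1..p}. \<forall>k\<in>{1..p}. \<forall>m d.
    norm (omega (pt d j / pt m k)) \<le> C' * \<rho>' ^ nat \<bar>d j - m k\<bar> \<and>
    (j \<noteq> k \<longrightarrow> norm (inverse (omega (pt d j / pt m k))) \<le> C' * \<rho>' ^ nat \<bar>d j - m k\<bar>)"
    using * by (meson order_trans)
  then show ?thesis using ge by blast
qed

lemma weight_growth:
  assumes "N \<subseteq> {1..p}" "K \<subseteq> {1..p}"
  shows "\<exists>C\<ge>1. \<exists>\<rho>\<ge>1. \<forall>m d. norm (weight N K m d) \<le> C * \<rho> ^ (size_on K m + size_on N d)"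
proof -
  have fin: "finite N" "finite K" using assms finite_subset by blast+
  obtain C \<rho> where C: "C \<ge> 1" and \<rho>: "\<rho> \<ge> 1" and
    1: "\<And>j k m d. j \<in> {1..p} \<Longrightarrow> k \<in> {1..p} \<Longrightarrow> norm (omega (pt d j / pt m k)) \<le> C * \<rho> ^ nat \<bar>d j - m k\<bar>" and
    2: "\<And>j k m d. j \<in> {1..p} \<Longrightarrow> k \<in> {1..p} \<Longrightarrow> j \<noteq> k \<Longrightarrow> norm (inverse (omega (pt d j / pt m k))) \<le> C * \<rho> ^ nat \<bar>d j - m k\<bar>"
    using omega_growth_uniform by blast
  define C1 where "C1 = max C (norm (inverse (omega 1)))"
  have C1: "C1 \<ge> 1" using C by (simp add: C1_def)
  define P where "P = card N * card K + card N * card N"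
  have "norm (weight N K m d) \<le> (C1 ^ P) * (\<rho> ^ (2 * P)) ^ (size_on K m + size_on N d)" for m d
  proof -
    define S where "S = size_on K m + size_on N d"
    define B where "B = C1 * \<rho> ^ (2 * S)"
    have B1: "B \<ge> 1" unfolding B_def using mult_mono[of 1 C1 1 "\<rho> ^ (2 * S)"] C1 \<rho> by (simp add: one_le_power)
    have two: "a \<le> x \<Longrightarrow> b \<le> y \<Longrightarrow> a + b \<le> 2 * (y + x)" "a \<le> x \<Longrightarrow> b \<le> x \<Longrightarrow> a + b \<le> 2 * (y + x)"
      for a b x y :: nat by auto
    have le: "C * \<rho> ^ e \<le> B" if "e \<le> 2 * S" for e
      unfolding B_def C1_def using that \<rho> C by (intro mult_mono power_increasing) auto
    have a: "norm (omega (pt d j / pt m k)) \<le> B" if "j \<in> N" "k \<in> K" for j k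
    proof -
      have "nat \<bar>d j - m k\<bar> \<le> nat \<bar>d j\<bar> + nat \<bar>m k\<bar>" by linarith
      also have "\<dots> \<le> 2 * S"
        unfolding S_def using size_on_ge[OF fin(1) that(1), of d] size_on_ge[OF fin(2) that(2), of m] by (rule two(1))
      finally show ?thesis using 1[of j k d m] le that assms by (meson order_trans subsetD)
    qed
    have b: "norm (inverse (omega (pt d j / pt d k))) \<le> B" if "j \<in> N" "k \<in> N" for j k
    proof (cases "j = k")
      case True
      have "omega (pt d j / pt d k) = omega 1" using True pt_nonzero[of k d] that assms by auto
      then have "norm (inverse (omega (pt d j / pt d k))) \<le> C1 * 1" by (simp add: C1_def)
      also have "\<dots> \<le> B" unfolding B_def using C1 \<rho> by (intro mult_left_mono) auto
      finally show ?thesis .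
    next
      case False
      have "nat \<bar>d j - d k\<bar> \<le> nat \<bar>d j\<bar> + nat \<bar>d k\<bar>" by linarith
      also have "\<dots> \<le> 2 * S"
        unfolding S_def using size_on_ge[OF fin(1) that(1), of d] size_on_ge[OF fin(1) that(2), of d] by (rule two(2))
      finally show ?thesis using 2[of j k d d] False le that assms by (meson order_trans subsetD)
    qed
    have "norm (weight N K m d) = (\<Prod>j\<in>N. \<Prod>k\<in>K. norm (omega (pt d j / pt m k))) *
       (\<Prod>j\<in>N. \<Prod>k\<in>N. norm (inverse (omega (pt d j / pt d k))))"
      unfolding weight_def norm_divide prod_norm[symmetric] norm_inverse
      by (simp only: prod_inversef[unfolded o_def] divide_inverse)
    also have "\<dots> \<le> (B ^ card K) ^ card N * (B ^ card N) ^ card N"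
      using a b fin B1
      by (intro mult_mono prod_le_power_card) (auto intro!: prod_nonneg prod_le_power_card)
    also have "\<dots> = B ^ P" unfolding P_def by (simp add: power_add power_mult mult.commute)
    also have "\<dots> = (C1 ^ P) * (\<rho> ^ (2 * P)) ^ S"
      unfolding B_def power_mult_distrib by (simp add: power_mult[symmetric] mult_ac)
    finally show ?thesis unfolding S_def .
  qed
  moreover have "C1 ^ P \<ge> 1" "\<rho> ^ (2 * P) \<ge> 1" using C1 \<rho> by (simp_all add: one_le_power)
  ultimately show ?thesis by blast
qed

text \<open>
  Each factor is a quotient as in \<open>ratio_bounded\<close>. So moving a lattice shift does not affect
  summability.
\<close>
lemma kernel_weight_bounded:
  assumes "J \<subseteq> N" "N \<subseteq> {1..p}" "K \<subseteq> {1..p}"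
  shows "\<exists>B. \<forall>d. norm (kernel_weight_right s K N (pt m) (pt d) J) \<le> B"
proof -
  have fin: "finite N" "finite K" "finite J" using assms finite_subset by (blast, blast, meson finite_atLeastAtMost)
  have 1: "\<exists>B. \<forall>d. norm ((shift s J (pt d) i - shift s J (pt d) j) / (pt d i - pt d j)) \<le> B"
    if ij: "i \<in> N" "j \<in> N" "i \<noteq> j" for i j
  proof -
    define c where "c k = (if k \<in> J then s else 1)" for k
    have nz: "\<alpha> i \<noteq> 0" "\<alpha> j \<noteq> 0" "c i \<noteq> 0" using \<alpha>0 that assms s0 by (auto simp: c_def)
    obtain B where B: "B \<ge> 1" "\<And>e::int. norm ((1 - (c j * \<alpha> j / (c i * \<alpha> i)) * q powi e) / (1 - (\<alpha> j / \<alpha> i) * q powi e)) \<le> B"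
      using ratio_bounded[OF q0 q1, of "\<alpha> j / \<alpha> i" "c j * \<alpha> j / (c i * \<alpha> i)"] nz by auto
    have "norm ((shift s J (pt d) i - shift s J (pt d) j) / (pt d i - pt d j)) \<le> norm (c i) * B" for d
    proof -
      have "shift s J (pt d) i - shift s J (pt d) j = c i * pt d i - c j * pt d j"
        by (simp add: shift_def c_def)
      also have "\<dots> = c i * pt d i * (1 - (c j * \<alpha> j / (c i * \<alpha> i)) * q powi (d j - d i))"
        using nz q0 by (simp add: pt_def power_int_diff field_simps)
      finally have n: "shift s J (pt d) i - shift s J (pt d) j = \<dots>" .
      have dd: "pt d i - pt d j = pt d i * (1 - (\<alpha> j / \<alpha> i) * q powi (d j - d i))"
        using nz q0 by (simp add: pt_def power_int_diff field_simps)
      have "(shift s J (pt d) i - shift s J (pt d) j) / (pt d i - pt d j) =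
        c i * ((1 - (c j * \<alpha> j / (c i * \<alpha> i)) * q powi (d j - d i)) / (1 - (\<alpha> j / \<alpha> i) * q powi (d j - d i)))"
        unfolding n dd using pt_nonzero[of i d] ij assms by auto
      then have "norm ((shift s J (pt d) i - shift s J (pt d) j) / (pt d i - pt d j)) =
        norm (c i) * norm ((1 - (c j * \<alpha> j / (c i * \<alpha> i)) * q powi (d j - d i)) / (1 - (\<alpha> j / \<alpha> i) * q powi (d j - d i)))"
        by (simp only: norm_mult)
      also have "\<dots> \<le> norm (c i) * B" by (intro mult_left_mono B(2)) simp
      finally show ?thesis .
    qed
    then show ?thesis by blast
  qed
  have 2: "\<exists>B. \<forall>d. norm ((pt m k - pt d i) / (pt m k - s * pt d i)) \<le> B" if ik: "i \<in> N" "k \<in> K" for i k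
  proof -
    have nz: "\<alpha> i \<noteq> 0" "pt m k \<noteq> 0" using \<alpha>0 pt_nonzero that assms by auto
    obtain B where B: "B \<ge> 1" "\<And>e::int. norm ((1 - (\<alpha> i / pt m k) * q powi e) / (1 - (s * \<alpha> i / pt m k) * q powi e)) \<le> B"
      using ratio_bounded[OF q0 q1, of "s * \<alpha> i / pt m k" "\<alpha> i / pt m k"] nz s0 by auto
    have "norm ((pt m k - pt d i) / (pt m k - s * pt d i)) \<le> B" for d
    proof -
      have "pt m k - c * pt d i = pt m k * (1 - (c * \<alpha> i / pt m k) * q powi (d i))" for c
        using nz by (simp add: pt_def[of d] field_simps)
      from this[of 1] this[of s]
      have "(pt m k - pt d i) / (pt m k - s * pt d i) =
         (1 - (\<alpha> i / pt m k) * q powi (d i)) / (1 - (s * \<alpha> i / pt m k) * q powi (d i))"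
        using nz by simp
      then show ?thesis using B(2)[of "d i"] by simp
    qed
    then show ?thesis by blast
  qed
  have prod_bd: "\<exists>B. \<forall>d. norm (\<Prod>x\<in>S. f d x) \<le> B" if "finite S" "\<And>x. x \<in> S \<Longrightarrow> \<exists>B. \<forall>d. norm (f d x) \<le> B"
    for S :: "'x set" and f :: "(nat \<Rightarrow> int) \<Rightarrow> 'x \<Rightarrow> complex"
  proof -
    have "\<forall>x. \<exists>B. x \<in> S \<longrightarrow> (\<forall>d. norm (f d x) \<le> B)" using that by blast
    then obtain B where B: "\<And>x d. x \<in> S \<Longrightarrow> norm (f d x) \<le> B x" unfolding choice_iff by blast
    have "norm (\<Prod>x\<in>S. f d x) \<le> (\<Prod>x\<in>S. B x)" for d
      unfolding prod_norm[symmetric] using B by (intro prod_mono) auto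
    then show ?thesis by blast
  qed
  have "\<exists>B. \<forall>d. norm (vandermonde_ratio N (shift s J (pt d)) (pt d)) \<le> B"
    unfolding vandermonde_ratio_def
  proof (rule prod_bd)
    show "finite (ordered_pairs N)" using fin by simp
  qed (auto simp: ordered_pairs_def intro!: 1)
  then obtain B1 where B1: "\<And>d. norm (vandermonde_ratio N (shift s J (pt d)) (pt d)) \<le> B1" by blast
  have "\<exists>B. \<forall>d. norm (\<Prod>i\<in>J. \<Prod>k\<in>K. (pt m k - pt d i) / (pt m k - s * pt d i)) \<le> B"
    using fin assms(1) by (intro prod_bd 2) auto
  then obtain B2 where B2: "\<And>d. norm (\<Prod>i\<in>J. \<Prod>k\<in>K. (pt m k - pt d i) / (pt m k - s * pt d i)) \<le> B2" by blast
  have "norm (kernel_weight_right s K N (pt m) (pt d) J) \<le> B1 * B2" for d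
    unfolding kernel_weight_right_def norm_mult
    by (intro mult_mono B1 B2) (auto intro: order_trans[OF norm_ge_zero B1])
  then show ?thesis by blast
qed

end

text \<open>
  In what follows \<open>abs_summable_on\<close> is the notion that belongs to \<open>infsum\<close> and \<open>has_sum\<close>.
\<close>
no_notation Infinite_Set_Sum.abs_summable_on (infix \<open>abs'_summable'_on\<close> 50)

section \<open>The series over triangular arrays\<close>

text \<open>
  Rows and arrays are extensional functions, so that they are determined by their entries. Row \<open>i\<close> of
  an array has \<open>i\<close> entries, indexed from \<open>1\<close>; the rows are indexed from \<open>0\<close>, and row \<open>0\<close> is empty.
\<close>
definition lattice :: "nat \<Rightarrow> (nat \<Rightarrow> int) set" where
  "lattice k = PiE {1..k} (\<lambda>_. UNIV)"

definition arrays :: "nat \<Rightarrow> (nat \<Rightarrow> nat \<Rightarrow> int) set" where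
  "arrays k = PiE {..<k} lattice"

definition tot :: "nat \<Rightarrow> (nat \<Rightarrow> int) \<Rightarrow> int" where
  "tot k m = (\<Sum>i=1..k. m i)"

lemma tot_up: "J \<subseteq> {1..k} \<Longrightarrow> tot k (up J m) = tot k m + int (card J)"
proof -
  assume J: "J \<subseteq> {1..k}"
  have "tot k (up J m) = (\<Sum>i=1..k. m i + (if i \<in> J then 1 else 0))"
    unfolding tot_def up_def by (intro sum.cong) auto
  also have "\<dots> = tot k m + (\<Sum>i=1..k. if i \<in> J then 1 else 0)"
    by (simp add: sum.distrib tot_def)
  also have "(\<Sum>i=1..k. if i \<in> J then 1 else 0 :: int) = int (card J)"
    using J by (simp add: sum.If_cases Int_absorb1)
  finally show ?thesis .
qed

lemma bij_down_lattice:
  assumes "J \<subseteq> {1..k}"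
  shows "bij_betw (down J) (lattice k) (lattice k)"
proof (rule bij_betwI[where g = "up J"])
  show "down J \<in> lattice k \<rightarrow> lattice k" "up J \<in> lattice k \<rightarrow> lattice k"
    using assms by (auto simp: lattice_def PiE_def extensional_def up_def down_def)
qed simp_all

lemma bij_arrays_Suc: "bij_betw (\<lambda>(d, D). D(k := d)) (lattice k \<times> arrays k) (arrays (Suc k))"
  unfolding bij_betw_def arrays_def lessThan_Suc PiE_insert_eq
  using inj_combinator[of k "{..<k}" lattice] by simp

text \<open>
  A product of geometric series, each with sum at most \<open>2\<close>.
\<close>
lemma sum_geometric_lattice:
  fixes y :: "nat \<Rightarrow> real"
  assumes "\<And>i. i \<in> {1..k} \<Longrightarrow> 0 \<le> y i \<and> y i \<le> 1 / 2"
  shows "(\<lambda>e. \<Prod>i=1..k. y i ^ e i) summable_on PiE {1..k} (\<lambda>_. UNIV :: nat set)"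
    and "(\<Sum>\<^sub>\<infinity>e\<in>PiE {1..k} (\<lambda>_. UNIV :: nat set). \<Prod>i=1..k. y i ^ e i) \<le> 2 ^ k"
proof -
  have hs: "((\<lambda>n. y i ^ n) has_sum (1 / (1 - y i))) UNIV" if "i \<in> {1..k}" for i
    using assms[OF that] by (intro norm_summable_imp_has_sum geometric_sums)
      (auto simp: norm_power intro!: summable_geometric)
  have abs: "(\<lambda>n. y i ^ n) abs_summable_on UNIV" if "i \<in> {1..k}" for i
    using hs[OF that] assms[OF that] by (auto simp: summable_on_def)
  have eq: "infsum (\<lambda>e. \<Prod>i\<in>{1..k}. y i ^ e i) (PiE {1..k} (\<lambda>_. UNIV)) = (\<Prod>i\<in>{1..k}. infsum (\<lambda>n. y i ^ n) UNIV)"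
    using abs by (intro infsum_prod_PiE_abs) auto
  also have "\<dots> = (\<Prod>i\<in>{1..k}. 1 / (1 - y i))"
    by (intro prod.cong refl infsumI hs)
  finally have eq: "infsum (\<lambda>e. \<Prod>i\<in>{1..k}. y i ^ e i) (PiE {1..k} (\<lambda>_. UNIV)) = (\<Prod>i\<in>{1..k}. 1 / (1 - y i))" .
  have nz: "(\<Prod>i\<in>{1..k}. 1 / (1 - y i)) \<noteq> 0"
    using assms by (force simp: prod_zero_iff)
  show "(\<lambda>e. \<Prod>i=1..k. y i ^ e i) summable_on PiE {1..k} (\<lambda>_. UNIV :: nat set)"
  proof (rule ccontr)
    assume "\<not> ?thesis"
    from infsum_not_exists[OF this] show False using eq nz by simp
  qed
  have "(\<Prod>i\<in>{1..k}. 1 / (1 - y i)) \<le> 2 ^ card {1..k}"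
  proof (rule prod_le_power_card)
    fix i assume "i \<in> {1..k}"
    then have "0 \<le> y i" "y i \<le> 1 / 2" using assms by auto
    then show "0 \<le> 1 / (1 - y i) \<and> 1 / (1 - y i) \<le> 2" by (simp add: field_simps)
  qed simp
  then show "(\<Sum>\<^sub>\<infinity>e\<in>PiE {1..k} (\<lambda>_. UNIV :: nat set). \<Prod>i=1..k. y i ^ e i) \<le> 2 ^ k"
    unfolding eq by simp
qed

text \<open>
  The condition is imposed on all pairs \<open>i < j\<close>, not only on neighbours, because the branching sum of
  rank \<open>k + 1\<close> is a series in the ratios of all \<open>\<zeta>\<^sub>i\<close> to \<open>\<zeta>\<^sub>k\<^sub>+\<^sub>1\<close>.
\<close>
definition convergence_region :: "real \<Rightarrow> nat \<Rightarrow> (nat \<Rightarrow> complex) \<Rightarrow> bool" where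
  "convergence_region \<delta> k \<zeta> \<longleftrightarrow> (\<forall>i\<in>{1..k}. \<zeta> i \<noteq> 0) \<and>
     (\<forall>i\<in>{1..k}. \<forall>j\<in>{1..k}. i < j \<longrightarrow> norm (\<zeta> i / \<zeta> j) < \<delta>)"

lemma power_int_le_power:
  fixes x b :: real
  assumes "x > 0" "b \<ge> 1" "x \<le> b" "inverse x \<le> b"
  shows "x powi n \<le> b ^ nat \<bar>n\<bar>"
proof (cases n rule: int_cases2)
  case (nonneg m)
  then show ?thesis using assms by (auto intro: power_mono)
next
  case (nonpos m)
  have "x powi n = inverse x ^ m" using nonpos by (simp add: power_int_minus power_inverse)
  also have "\<dots> \<le> b ^ m" using assms by (intro power_mono) auto
  finally show ?thesis using nonpos by simp
qed

context trs
begin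

definition t :: complex where "t = inverse s"

lemma t0: "t \<noteq> 0" using s0 by (simp add: t_def)

text \<open>
  The coefficient of \<open>\<Psi>\<^sub>k(d)\<close> in the branching sum of \<open>\<Psi>\<^sub>k\<^sub>+\<^sub>1(m)\<close>.
\<close>
definition branch_coeff :: "nat \<Rightarrow> (nat \<Rightarrow> int) \<Rightarrow> (nat \<Rightarrow> complex) \<Rightarrow> (nat \<Rightarrow> int) \<Rightarrow> complex" where
  "branch_coeff k m \<zeta> d = t powi tot k d * \<zeta> (Suc k) powi (tot (Suc k) m - tot k d) *
     weight {1..k} {1..Suc k} m d"

primrec array_term :: "nat \<Rightarrow> (nat \<Rightarrow> int) \<Rightarrow> (nat \<Rightarrow> complex) \<Rightarrow> (nat \<Rightarrow> nat \<Rightarrow> int) \<Rightarrow> complex" where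
  "array_term 0 m \<zeta> D = 1"
| "array_term (Suc k) m \<zeta> D = branch_coeff k m \<zeta> (D k) * array_term k (D k) \<zeta> D"

definition Psi :: "nat \<Rightarrow> (nat \<Rightarrow> int) \<Rightarrow> (nat \<Rightarrow> complex) \<Rightarrow> complex" where
  "Psi k m \<zeta> = infsum (array_term k m \<zeta>) (arrays k)"

text \<open>
  The eigenvalue equation relates values of \<open>\<Psi>\<close> at different lattice points and is proved by induction
  on the rank, so convergence is needed for all \<open>m\<close> and all ranks up to \<open>k\<close>.
\<close>
definition converges :: "nat \<Rightarrow> (nat \<Rightarrow> complex) \<Rightarrow> bool" where
  "converges k \<zeta> \<longleftrightarrow> (\<forall>k'\<le>k. \<forall>m. array_term k' m \<zeta> abs_summable_on arrays k')"

lemma array_term_cong: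
  assumes "\<And>i. i < k \<Longrightarrow> D i = D' i"
  shows "array_term k m \<zeta> D = array_term k m \<zeta> D'"
  using assms by (induction k arbitrary: m) auto

lemma array_term_upd: "array_term (Suc k) m \<zeta> (D(k := d)) = branch_coeff k m \<zeta> d * array_term k d \<zeta> D"
  using array_term_cong[of k "D(k := d)" D d \<zeta>] by simp

lemma array_term_cong_zeta:
  assumes "\<And>i. i \<in> {1..k} \<Longrightarrow> \<zeta> i = \<zeta>' i"
  shows "array_term k m \<zeta> = array_term k m \<zeta>'"
proof -
  have "array_term k m \<zeta> D = array_term k m \<zeta>' D" for D
    using assms by (induction k arbitrary: m) (auto simp: branch_coeff_def)
  then show ?thesis by blast
qed

lemma Psi_cong_zeta:
  assumes "\<And>i. i \<in> {1..k} \<Longrightarrow> \<zeta> i = \<zeta>' i"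
  shows "Psi k m \<zeta> = Psi k m \<zeta>'"
  unfolding Psi_def using array_term_cong_zeta[OF assms] by simp

text \<open>
  The weight and the sum of rank \<open>k\<close> grow at most geometrically in \<open>d\<close>, while the monomials
  contribute \<open>(\<zeta>\<^sub>i / \<zeta>\<^sub>k\<^sub>+\<^sub>1)\<close> to the power \<open>d\<^sub>i - m\<^sub>i \<ge> 0\<close>; small ratios win. The bound has to be
  explicit in \<open>m\<close>, since the next rank sums over it, and the region may not depend on \<open>m\<close>.
\<close>
lemma array_term_bound_step:
  assumes k: "Suc k \<le> p" and C: "C \<ge> 1" "R \<ge> 1" and \<delta>: "\<delta> > 0"
    and IH: "\<And>\<zeta> m. convergence_region \<delta> k \<zeta> \<Longrightarrow> array_term k m \<zeta> abs_summable_on arrays k \<and>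
      (\<Sum>\<^sub>\<infinity>D\<in>arrays k. norm (array_term k m \<zeta> D)) \<le>
        C * R ^ size_on {1..k} m * (\<Prod>i=1..k. norm (\<zeta> i) powi m i)"
  shows "\<exists>\<delta>'>0. \<delta>' \<le> \<delta> \<and> (\<exists>C'\<ge>1. \<exists>R'\<ge>1. \<forall>\<zeta> m. convergence_region \<delta>' (Suc k) \<zeta> \<longrightarrow>
    array_term (Suc k) m \<zeta> abs_summable_on arrays (Suc k) \<and>
      (\<Sum>\<^sub>\<infinity>D\<in>arrays (Suc k). norm (array_term (Suc k) m \<zeta> D)) \<le>
        C' * R' ^ size_on {1..Suc k} m * (\<Prod>i=1..Suc k. norm (\<zeta> i) powi m i))"
proof -
  obtain Cw \<rho> where Cw: "Cw \<ge> 1" "\<rho> \<ge> 1" and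
    w: "\<And>m d. norm (weight {1..k} {1..Suc k} m d) \<le> Cw * \<rho> ^ (size_on {1..Suc k} m + size_on {1..k} d)"
    using weight_growth[of "{1..k}" "{1..Suc k}"] k by auto
  define \<tau> where "\<tau> = max 1 (max (norm t) (inverse (norm t)))"
  define Q where "Q = \<tau> * \<rho> * R"
  define C' where "C' = Cw * C * 2 ^ k"
  have \<tau>: "\<tau> \<ge> 1" by (simp add: \<tau>_def)
  have Q: "Q \<ge> 1" unfolding Q_def using \<tau> Cw C mult_mono[of 1 \<tau> 1 \<rho>] mult_mono[of 1 "\<tau> * \<rho>" 1 R] by auto
  have C': "C' \<ge> 1" unfolding C'_def
    using Cw C mult_mono[of 1 Cw 1 C] mult_mono[of 1 "Cw * C" 1 "2 ^ k"] by auto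
  have R': "\<rho> * Q \<ge> 1" using Cw Q mult_mono[of 1 \<rho> 1 Q] by auto
  define \<delta>' where "\<delta>' = min \<delta> (1 / (2 * Q))"
  have main: "array_term (Suc k) m \<zeta> abs_summable_on arrays (Suc k) \<and>
      (\<Sum>\<^sub>\<infinity>D\<in>arrays (Suc k). norm (array_term (Suc k) m \<zeta> D)) \<le>
        C' * (\<rho> * Q) ^ size_on {1..Suc k} m * (\<Prod>i=1..Suc k. norm (\<zeta> i) powi m i)"
    if conv: "convergence_region \<delta>' (Suc k) \<zeta>" for \<zeta> m
  proof -
    have convk: "convergence_region \<delta> k \<zeta>"
      using conv unfolding convergence_region_def \<delta>'_def by fastforce
    have nz: "\<zeta> i \<noteq> 0" if "i \<in> {1..Suc k}" for i using conv that by (auto simp: convergence_region_def)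
    define x where "x i = norm (\<zeta> i) / norm (\<zeta> (Suc k))" for i
    have x: "0 \<le> Q * x i \<and> Q * x i \<le> 1 / 2" if "i \<in> {1..k}" for i
    proof -
      have "norm (\<zeta> i / \<zeta> (Suc k)) < \<delta>'" using conv that unfolding convergence_region_def by auto
      then have "x i < 1 / (2 * Q)" unfolding x_def \<delta>'_def by (simp add: norm_divide)
      then have "Q * x i \<le> Q * (1 / (2 * Q))" using Q by (intro mult_left_mono) auto
      then show ?thesis using Q by (simp add: x_def)
    qed
    define S where "S d = (\<Sum>\<^sub>\<infinity>D\<in>arrays k. norm (array_term k d \<zeta> D))" for d
    define G where "G d = norm (branch_coeff k m \<zeta> d) * S d" for d
    define L where "L = {d\<in>lattice k. \<forall>i\<in>{1..k}. m i \<le> d i}"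
    \<comment> \<open>Only \<open>d \<ge> m\<close> contributes, and \<open>emb\<close> parametrises these rows by \<open>e = d - m\<close>.\<close>
    define emb where "emb e = restrict (\<lambda>i. m i + int (e i)) {1..k}" for e :: "nat \<Rightarrow> nat"
    define M where "M = Cw * C * (\<rho> * Q) ^ size_on {1..Suc k} m * (\<Prod>i=1..Suc k. norm (\<zeta> i) powi m i)"
    have bij: "bij_betw emb (PiE {1..k} (\<lambda>_. UNIV)) L"
    proof (rule bij_betwI[where g = "\<lambda>d. restrict (\<lambda>i. nat (d i - m i)) {1..k}"])
      show "emb \<in> PiE {1..k} (\<lambda>_. UNIV) \<rightarrow> L" by (auto simp: emb_def L_def lattice_def)
      show "(\<lambda>d. restrict (\<lambda>i. nat (d i - m i)) {1..k}) \<in> L \<rightarrow> PiE {1..k} (\<lambda>_. UNIV)" by auto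
      fix e :: "nat \<Rightarrow> nat" assume "e \<in> PiE {1..k} (\<lambda>_. UNIV)"
      then show "restrict (\<lambda>i. nat (emb e i - m i)) {1..k} = e"
        by (auto simp: emb_def PiE_def extensional_def fun_eq_iff)
    next
      fix d assume "d \<in> L"
      then show "emb (restrict (\<lambda>i. nat (d i - m i)) {1..k}) = d"
        by (auto simp: emb_def L_def lattice_def PiE_def extensional_def fun_eq_iff)
    qed
    have S0: "S d \<ge> 0" for d unfolding S_def by (intro infsum_nonneg) auto
    have bound: "G (emb e) \<le> M * (\<Prod>i=1..k. (Q * x i) ^ e i)" for e
    proof -
      let ?d = "emb e"
      have d: "?d i = m i + int (e i)" if "i \<in> {1..k}" for i using that by (simp add: emb_def)
      have size: "size_on {1..k} ?d \<le> size_on {1..Suc k} m + (\<Sum>i=1..k. e i)"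
      proof -
        have "size_on {1..k} ?d \<le> (\<Sum>i=1..k. nat \<bar>m i\<bar> + e i)"
          unfolding size_on_def by (intro sum_mono) (auto simp: d)
        then show ?thesis by (simp add: size_on_def sum.distrib)
      qed
      have tot_le: "nat \<bar>tot k ?d\<bar> \<le> size_on {1..k} ?d"
      proof -
        have "\<bar>tot k ?d\<bar> \<le> (\<Sum>i=1..k. \<bar>?d i\<bar>)" unfolding tot_def by (rule sum_abs)
        also have "\<dots> = int (size_on {1..k} ?d)" by (simp add: size_on_def)
        finally show ?thesis by linarith
      qed
      have "norm t powi tot k ?d \<le> \<tau> ^ nat \<bar>tot k ?d\<bar>"
        using t0 by (intro power_int_le_power) (auto simp: \<tau>_def)
      also have "\<dots> \<le> \<tau> ^ size_on {1..k} ?d" using \<tau> tot_le by (intro power_increasing) auto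
      finally have b1: "norm t powi tot k ?d \<le> \<tau> ^ size_on {1..k} ?d" .
      have tot_d: "tot (Suc k) m - tot k ?d = m (Suc k) - int (\<Sum>i=1..k. e i)"
        by (simp add: tot_def d sum.distrib)
      have z: "norm (\<zeta> (Suc k)) > 0" using nz by simp
      have mon: "norm (\<zeta> (Suc k)) powi (tot (Suc k) m - tot k ?d) * (\<Prod>i=1..k. norm (\<zeta> i) powi ?d i) =
          (\<Prod>i=1..Suc k. norm (\<zeta> i) powi m i) * (\<Prod>i=1..k. x i ^ e i)"
      proof -
        have "(\<Prod>i=1..k. norm (\<zeta> i) powi ?d i) = (\<Prod>i=1..k. norm (\<zeta> i) powi m i * norm (\<zeta> i) ^ e i)"
          using nz by (intro prod.cong) (auto simp: d power_int_add)
        moreover have "(\<Prod>i=1..k. x i ^ e i) = (\<Prod>i=1..k. norm (\<zeta> i) ^ e i) / norm (\<zeta> (Suc k)) ^ (\<Sum>i=1..k. e i)"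
          unfolding x_def by (simp add: power_divide prod_dividef power_sum)
        moreover have "norm (\<zeta> (Suc k)) powi (tot (Suc k) m - tot k ?d) =
            norm (\<zeta> (Suc k)) powi m (Suc k) / norm (\<zeta> (Suc k)) ^ (\<Sum>i=1..k. e i)"
          unfolding tot_d using z by (subst power_int_diff) (auto simp del: of_nat_sum)
        ultimately show ?thesis by (simp add: prod.distrib)
      qed
      have "G ?d = norm t powi tot k ?d * norm (\<zeta> (Suc k)) powi (tot (Suc k) m - tot k ?d) *
          norm (weight {1..k} {1..Suc k} m ?d) * S ?d"
        unfolding G_def branch_coeff_def by (simp add: norm_mult norm_power_int)
      also have "\<dots> \<le> \<tau> ^ size_on {1..k} ?d * norm (\<zeta> (Suc k)) powi (tot (Suc k) m - tot k ?d) *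
          (Cw * \<rho> ^ (size_on {1..Suc k} m + size_on {1..k} ?d)) *
          (C * R ^ size_on {1..k} ?d * (\<Prod>i=1..k. norm (\<zeta> i) powi ?d i))"
        using IH[OF convk, of ?d] S0 \<tau> Cw C unfolding S_def[symmetric]
        by (intro mult_mono b1 w order_refl mult_nonneg_nonneg) (auto intro!: prod_nonneg)
      also have "\<dots> = Cw * C * \<rho> ^ size_on {1..Suc k} m * Q ^ size_on {1..k} ?d *
          (norm (\<zeta> (Suc k)) powi (tot (Suc k) m - tot k ?d) * (\<Prod>i=1..k. norm (\<zeta> i) powi ?d i))"
        unfolding Q_def by (simp add: power_add power_mult_distrib mult_ac)
      also have "\<dots> = Cw * C * \<rho> ^ size_on {1..Suc k} m * Q ^ size_on {1..k} ?d *
          ((\<Prod>i=1..Suc k. norm (\<zeta> i) powi m i) * (\<Prod>i=1..k. x i ^ e i))"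
        unfolding mon ..
      also have "\<dots> \<le> Cw * C * \<rho> ^ size_on {1..Suc k} m * Q ^ (size_on {1..Suc k} m + (\<Sum>i=1..k. e i)) *
          ((\<Prod>i=1..Suc k. norm (\<zeta> i) powi m i) * (\<Prod>i=1..k. x i ^ e i))"
        using size Q Cw C by (intro mult_right_mono mult_left_mono power_increasing)
          (auto intro!: prod_nonneg mult_nonneg_nonneg simp: x_def)
      also have "\<dots> = M * (\<Prod>i=1..k. (Q * x i) ^ e i)"
        unfolding M_def by (simp add: power_add power_mult_distrib prod.distrib power_sum mult_ac del: prod.cl_ivl_Suc)
      finally show ?thesis .
    qed
    have M0: "M \<ge> 0" unfolding M_def using Cw C Q by (intro mult_nonneg_nonneg prod_nonneg) auto
    have G0: "G d \<ge> 0" for d unfolding G_def using S0 by simp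
    have Gz: "G d = 0" if "d \<in> lattice k - L" for d
    proof -
      have "\<exists>i\<in>{1..k}. d i < m i" using that unfolding L_def by (auto simp: not_le)
      then obtain i where i: "i \<in> {1..k}" "d i < m i" by blast
      then have "weight {1..k} {1..Suc k} m d = 0" using k by (intro weight_zero[of _ _ i]) auto
      then show ?thesis by (simp add: G_def branch_coeff_def)
    qed
    have sumE: "(\<lambda>e. M * (\<Prod>i=1..k. (Q * x i) ^ e i)) summable_on PiE {1..k} (\<lambda>_. UNIV)"
      using x by (intro summable_on_cmult_right sum_geometric_lattice(1)) auto
    have "(\<lambda>e. G (emb e)) summable_on PiE {1..k} (\<lambda>_. UNIV)"
      by (rule summable_on_comparison_test[OF sumE]) (use bound G0 in auto)
    then have sumL: "G summable_on L" using summable_on_reindex_bij_betw[OF bij] by blast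
    then have sumG: "G summable_on lattice k"
      by (subst summable_on_cong_neutral[where T = L and g = G]) (auto simp: Gz L_def)
    have "infsum G (lattice k) = infsum G L"
      by (rule infsum_cong_neutral) (auto simp: Gz L_def)
    also have "\<dots> = infsum (\<lambda>e. G (emb e)) (PiE {1..k} (\<lambda>_. UNIV))"
      by (rule infsum_reindex_bij_betw[OF bij, symmetric])
    also have "\<dots> \<le> infsum (\<lambda>e. M * (\<Prod>i=1..k. (Q * x i) ^ e i)) (PiE {1..k} (\<lambda>_. UNIV))"
      by (rule infsum_mono) (use \<open>(\<lambda>e. G (emb e)) summable_on _\<close> sumE bound in auto)
    also have "\<dots> = M * infsum (\<lambda>e. \<Prod>i=1..k. (Q * x i) ^ e i) (PiE {1..k} (\<lambda>_. UNIV))"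
      using x by (intro infsum_cmult_right sum_geometric_lattice(1)) auto
    also have "\<dots> \<le> M * 2 ^ k"
      using x M0 by (intro mult_left_mono sum_geometric_lattice(2)) auto
    finally have infG: "infsum G (lattice k) \<le> M * 2 ^ k" .
    define F where "F = (\<lambda>(d, D). branch_coeff k m \<zeta> d * array_term k d \<zeta> D)"
    have inner: "infsum (\<lambda>D. norm (F (d, D))) (arrays k) = G d" for d
      unfolding F_def G_def S_def using IH[OF convk, of d]
      by (simp add: norm_mult infsum_cmult_right)
    have absF: "F abs_summable_on lattice k \<times> arrays k"
      unfolding Infinite_Sum.abs_summable_on_Sigma_iff inner using sumG G0 IH[OF convk]
      by (auto simp: F_def norm_mult intro: summable_on_cmult_right)
    have reidx: "array_term (Suc k) m \<zeta> (case x of (d, D) \<Rightarrow> D(k := d)) = F x" for x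
      by (cases x) (simp add: F_def array_term_upd del: array_term.simps)
    have 1: "array_term (Suc k) m \<zeta> abs_summable_on arrays (Suc k)"
      using absF summable_on_reindex_bij_betw[OF bij_arrays_Suc[of k], of "\<lambda>D. norm (array_term (Suc k) m \<zeta> D)"]
      unfolding reidx by simp
    have "infsum (\<lambda>D. norm (array_term (Suc k) m \<zeta> D)) (arrays (Suc k)) = infsum (\<lambda>x. norm (F x)) (lattice k \<times> arrays k)"
      using infsum_reindex_bij_betw[OF bij_arrays_Suc[of k], of "\<lambda>D. norm (array_term (Suc k) m \<zeta> D)"]
      unfolding reidx by simp
    also have "\<dots> = infsum (\<lambda>d. infsum (\<lambda>D. norm (F (d, D))) (arrays k)) (lattice k)"
      by (rule infsum_Sigma_banach[symmetric]) (use absF in simp)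
    also have "\<dots> = infsum G (lattice k)" unfolding inner ..
    also note infG
    also have "M * 2 ^ k = C' * (\<rho> * Q) ^ size_on {1..Suc k} m * (\<Prod>i=1..Suc k. norm (\<zeta> i) powi m i)"
      unfolding M_def C'_def by (simp add: mult_ac del: prod.cl_ivl_Suc)
    finally show ?thesis using 1 by blast
  qed
  have "\<delta>' > 0" "\<delta>' \<le> \<delta>" using \<delta> Q by (auto simp: \<delta>'_def)
  then show ?thesis using main C' R' by blast
qed

lemma array_term_bound:
  assumes "k \<le> p"
  shows "\<exists>\<delta>>0. \<exists>C\<ge>1. \<exists>R\<ge>1. \<forall>\<zeta> m. convergence_region \<delta> k \<zeta> \<longrightarrow> converges k \<zeta> \<and>
      (\<Sum>\<^sub>\<infinity>D\<in>arrays k. norm (array_term k m \<zeta> D)) \<le>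
        C * R ^ size_on {1..k} m * (\<Prod>i=1..k. norm (\<zeta> i) powi m i)"
  using assms
proof (induction k)
  case 0
  show ?case
    by (intro exI[of _ 1] conjI) (auto simp: converges_def arrays_def size_on_def)
next
  case (Suc k)
  then obtain \<delta> C R where "\<delta> > 0" "C \<ge> 1" "R \<ge> 1" and
    IH: "\<And>\<zeta> m. convergence_region \<delta> k \<zeta> \<Longrightarrow> converges k \<zeta> \<and>
      (\<Sum>\<^sub>\<infinity>D\<in>arrays k. norm (array_term k m \<zeta> D)) \<le>
        C * R ^ size_on {1..k} m * (\<Prod>i=1..k. norm (\<zeta> i) powi m i)"
    by (meson Suc_leD)
  obtain \<delta>' C' R' where \<delta>': "\<delta>' > 0" "\<delta>' \<le> \<delta>" "C' \<ge> 1" "R' \<ge> 1" and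
    b: "\<And>\<zeta> m. convergence_region \<delta>' (Suc k) \<zeta> \<Longrightarrow>
      array_term (Suc k) m \<zeta> abs_summable_on arrays (Suc k) \<and>
      (\<Sum>\<^sub>\<infinity>D\<in>arrays (Suc k). norm (array_term (Suc k) m \<zeta> D)) \<le>
        C' * R' ^ size_on {1..Suc k} m * (\<Prod>i=1..Suc k. norm (\<zeta> i) powi m i)"
    using array_term_bound_step[OF Suc.prems \<open>C \<ge> 1\<close> \<open>R \<ge> 1\<close> \<open>\<delta> > 0\<close>] IH unfolding converges_def by blast
  have "converges (Suc k) \<zeta>" if c: "convergence_region \<delta>' (Suc k) \<zeta>" for \<zeta>
  proof -
    have "convergence_region \<delta> k \<zeta>" using c \<delta>'(2) unfolding convergence_region_def by fastforce
    then show ?thesis using IH b[OF c] unfolding converges_def le_Suc_eq by blast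
  qed
  then show ?case using b \<delta>' by blast
qed

lemma convergence:
  assumes "k \<le> p"
  shows "\<exists>\<delta>>0. \<forall>\<zeta>. convergence_region \<delta> k \<zeta> \<longrightarrow> converges k \<zeta>"
  using array_term_bound[OF assms] by blast

subsection \<open>Branching\<close>

text \<open>
  Fubini for the last row of the array.
\<close>
lemma branching:
  assumes "converges (Suc k) \<zeta>"
  shows "(\<lambda>d. branch_coeff k m \<zeta> d * Psi k d \<zeta>) abs_summable_on lattice k"
    and "((\<lambda>d. branch_coeff k m \<zeta> d * Psi k d \<zeta>) has_sum Psi (Suc k) m \<zeta>) (lattice k)"
proof -
  define F where "F = (\<lambda>(d, D). branch_coeff k m \<zeta> d * array_term k d \<zeta> D)"
  have reidx: "array_term (Suc k) m \<zeta> (case x of (d, D) \<Rightarrow> D(k := d)) = F x" for x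
    by (cases x) (simp add: F_def array_term_upd del: array_term.simps)
  have abs: "array_term (Suc k) m \<zeta> abs_summable_on arrays (Suc k)"
    and absk: "array_term k d \<zeta> abs_summable_on arrays k" for d
    using assms unfolding converges_def by auto
  have absF: "F abs_summable_on lattice k \<times> arrays k"
    using abs summable_on_reindex_bij_betw[OF bij_arrays_Suc[of k], of "\<lambda>D. norm (array_term (Suc k) m \<zeta> D)"]
    unfolding reidx by simp
  have inner: "infsum (\<lambda>D. F (d, D)) (arrays k) = branch_coeff k m \<zeta> d * Psi k d \<zeta>" for d
    unfolding F_def Psi_def using abs_summable_summable[OF absk] by (simp add: infsum_cmult_right)
  have "(\<lambda>d. infsum (\<lambda>D. norm (F (d, D))) (arrays k)) abs_summable_on lattice k"
    using absF unfolding Infinite_Sum.abs_summable_on_Sigma_iff by blast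
  then show abs': "(\<lambda>d. branch_coeff k m \<zeta> d * Psi k d \<zeta>) abs_summable_on lattice k"
  proof (rule Infinite_Sum.abs_summable_on_comparison_test)
    fix d assume "d \<in> lattice k"
    then have "(\<lambda>D. F (d, D)) abs_summable_on arrays k"
      using absF unfolding Infinite_Sum.abs_summable_on_Sigma_iff by blast
    then have "norm (infsum (\<lambda>D. F (d, D)) (arrays k)) \<le> infsum (\<lambda>D. norm (F (d, D))) (arrays k)"
      by (rule norm_infsum_bound)
    then show "norm (branch_coeff k m \<zeta> d * Psi k d \<zeta>) \<le> norm (infsum (\<lambda>D. norm (F (d, D))) (arrays k))"
      unfolding inner by simp
  qed
  have "Psi (Suc k) m \<zeta> = infsum F (lattice k \<times> arrays k)"
    using infsum_reindex_bij_betw[OF bij_arrays_Suc[of k], of "array_term (Suc k) m \<zeta>"]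
    unfolding reidx Psi_def by simp
  also have "\<dots> = infsum (\<lambda>d. infsum (\<lambda>D. F (d, D)) (arrays k)) (lattice k)"
    by (rule infsum_Sigma_banach[symmetric]) (rule abs_summable_summable[OF absF])
  finally have "Psi (Suc k) m \<zeta> = infsum (\<lambda>d. branch_coeff k m \<zeta> d * Psi k d \<zeta>) (lattice k)"
    unfolding inner .
  then show "((\<lambda>d. branch_coeff k m \<zeta> d * Psi k d \<zeta>) has_sum Psi (Suc k) m \<zeta>) (lattice k)"
    using has_sum_infsum[OF abs_summable_summable[OF abs']] by simp
qed

lemma branch_coeff_zero:
  assumes "i \<in> {1..k}" "d i < m i" "k \<le> p"
  shows "branch_coeff k m \<zeta> d = 0"
  using weight_zero[of "{1..k}" "{1..Suc k}" i d m] assms by (simp add: branch_coeff_def)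

text \<open>
  The monomial contributes \<open>(s \<zeta>\<^sub>k\<^sub>+\<^sub>1)\<^bsup>|J|\<^esup>\<close>, the weight contributes \<open>weight_shift\<close>.
\<close>
lemma branch_coeff_down:
  assumes "J \<subseteq> {1..k}" "Suc k \<le> p" "\<zeta> (Suc k) \<noteq> 0"
  shows "branch_coeff k m \<zeta> (down J e) * dual_coeff s {1..k} J (pt (down J e)) =
    branch_coeff k m \<zeta> e * ((s * \<zeta> (Suc k)) ^ card J * kernel_weight_right s {1..Suc k} {1..k} (pt m) (pt e) J)"
proof -
  have w: "weight {1..k} {1..Suc k} m (down J e) * dual_coeff s {1..k} J (pt (down J e)) =
    weight {1..k} {1..Suc k} m e * kernel_weight_right s {1..Suc k} {1..k} (pt m) (pt e) J"
    using assms by (intro weight_shift) auto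
  have tt: "tot k (down J e) = tot k e - int (card J)"
    using tot_up[OF assms(1), of "down J e"] by simp
  have mon: "t powi tot k (down J e) * \<zeta> (Suc k) powi (tot (Suc k) m - tot k (down J e)) =
    t powi tot k e * \<zeta> (Suc k) powi (tot (Suc k) m - tot k e) * (s * \<zeta> (Suc k)) ^ card J"
  proof -
    have "t powi (tot k e - int (card J)) = t powi tot k e * s ^ card J"
      using t0 s0 by (simp add: power_int_diff t_def field_simps)
    moreover have "\<zeta> (Suc k) powi (tot (Suc k) m - (tot k e - int (card J))) =
      \<zeta> (Suc k) powi (tot (Suc k) m - tot k e) * \<zeta> (Suc k) ^ card J"
    proof -
      have e: "tot (Suc k) m - (tot k e - int (card J)) = (tot (Suc k) m - tot k e) + int (card J)" by simp
      show ?thesis unfolding e using assms(3) by (subst power_int_add) auto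
    qed
    ultimately show ?thesis unfolding tt by (simp add: power_mult_distrib)
  qed
  have "branch_coeff k m \<zeta> (down J e) * dual_coeff s {1..k} J (pt (down J e)) =
    (t powi tot k (down J e) * \<zeta> (Suc k) powi (tot (Suc k) m - tot k (down J e))) *
    (weight {1..k} {1..Suc k} m (down J e) * dual_coeff s {1..k} J (pt (down J e)))"
    unfolding branch_coeff_def by (simp only: mult.assoc)
  also have "\<dots> = branch_coeff k m \<zeta> e * ((s * \<zeta> (Suc k)) ^ card J *
      kernel_weight_right s {1..Suc k} {1..k} (pt m) (pt e) J)"
    unfolding branch_coeff_def mon w by (simp only: mult_ac)
  finally show ?thesis .
qed

lemma summable_bounded_multiplier:
  fixes f g :: "'x \<Rightarrow> complex"
  assumes "f abs_summable_on A" "\<And>x. x \<in> A \<Longrightarrow> f x \<noteq> 0 \<Longrightarrow> norm (g x) \<le> B"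
  shows "(\<lambda>x. f x * g x) summable_on A"
proof -
  have "(\<lambda>x. of_real B * f x) abs_summable_on A"
    using assms(1) by (simp add: norm_mult summable_on_cmult_right)
  then have "(\<lambda>x. f x * g x) abs_summable_on A"
  proof (rule Infinite_Sum.abs_summable_on_comparison_test)
    fix x assume x: "x \<in> A"
    show "norm (f x * g x) \<le> norm (complex_of_real B * f x)"
    proof (cases "f x = 0")
      case False
      then have "norm (g x) \<le> \<bar>B\<bar>" using assms(2)[OF x] by linarith
      then have "norm (f x) * norm (g x) \<le> norm (f x) * \<bar>B\<bar>" by (intro mult_left_mono) auto
      then show ?thesis by (simp add: norm_mult mult.commute[of _ "norm (f x)"])
    qed simp
  qed
  then show ?thesis by (rule abs_summable_summable)
qed

text \<open>
  Reindexing \<open>d = e - 1\<^sub>J\<close> moves the lattice shift from \<open>\<Psi>\<close> to the branching coefficient. The product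
  over \<open>j\<close> is the eigenvalue at the shifted point. It is unbounded on the lattice, but
  bounded on \<open>e \<ge> m\<close>, where alone the branching coefficient does not vanish.
\<close>
lemma branch_shift:
  assumes conv: "converges (Suc k) \<zeta>" and k: "Suc k \<le> p" and \<zeta>: "\<zeta> (Suc k) \<noteq> 0"
    and J: "J \<subseteq> {1..k}"
  shows "((\<lambda>d. branch_coeff k m \<zeta> d * (dual_coeff s {1..k} J (pt d) *
        (\<Prod>j=1..k. 1 - u * shift h J (pt d) j) * Psi k (up J d) \<zeta>)) has_sum
     (\<Sum>\<^sub>\<infinity>e\<in>lattice k. branch_coeff k m \<zeta> e * Psi k e \<zeta> * ((s * \<zeta> (Suc k)) ^ card J *
        kernel_weight_right s {1..Suc k} {1..k} (pt m) (pt e) J * (\<Prod>j=1..k. 1 - u * shift s J (pt e) j)))) (lattice k)"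
    (is "(?f has_sum infsum ?g _) _")
    and "(\<lambda>e. branch_coeff k m \<zeta> e * Psi k e \<zeta> * ((s * \<zeta> (Suc k)) ^ card J *
        kernel_weight_right s {1..Suc k} {1..k} (pt m) (pt e) J * (\<Prod>j=1..k. 1 - u * shift s J (pt e) j)))
      summable_on lattice k"
proof -
  have eq: "?f (down J e) = ?g e" for e
  proof -
    have "shift h J (pt (down J e)) = shift s J (pt e)"
      unfolding pt_down using q0 by (auto simp: shift_def s_def)
    then have "?f (down J e) = (branch_coeff k m \<zeta> (down J e) * dual_coeff s {1..k} J (pt (down J e))) *
       ((\<Prod>j=1..k. 1 - u * shift s J (pt e) j) * Psi k e \<zeta>)"
      by simp
    also have "\<dots> = ?g e" unfolding branch_coeff_down[of J k \<zeta> m e, OF J k \<zeta>] by simp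
    finally show ?thesis .
  qed
  obtain B1 where B1: "\<And>e. norm (kernel_weight_right s {1..Suc k} {1..k} (pt m) (pt e) J) \<le> B1"
    using kernel_weight_bounded[OF J, of "{1..Suc k}" m] k by auto
  \<comment> \<open>Since \<open>norm q < 1\<close>, \<open>norm (pt e j) \<le> norm (pt m j)\<close> for \<open>e \<ge> m\<close>.\<close>
  define B2 where "B2 = (\<Prod>j=1..k. 1 + norm u * ((1 + norm s) * (norm (pt m j))))"
  have B2: "norm (\<Prod>j=1..k. 1 - u * shift s J (pt e) j) \<le> B2" if "branch_coeff k m \<zeta> e \<noteq> 0" for e
    unfolding B2_def prod_norm[symmetric]
  proof (intro prod_mono conjI)
    fix j assume j: "j \<in> {1..k}"
    have "m j \<le> e j" using branch_coeff_zero[OF j, of e m \<zeta>] that k by (meson Suc_leD not_le)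
    then have "norm (pt e j) \<le> norm (pt m j)"
    proof -
      assume "m j \<le> e j"
      then have "pt e j = pt m j * q ^ nat (e j - m j)"
        using q0 by (simp add: pt_def power_int_add[symmetric] flip: power_int_of_nat)
      moreover have "norm (q ^ nat (e j - m j)) \<le> 1" using q1 by (simp add: norm_power power_le_one)
      ultimately show ?thesis by (simp add: norm_mult mult_left_le)
    qed
    have "norm (shift s J (pt e) j) \<le> (1 + norm s) * norm (pt e j)"
      by (auto simp: shift_def norm_mult algebra_simps)
    also have "\<dots> \<le> (1 + norm s) * norm (pt m j)"
      using \<open>norm (pt e j) \<le> norm (pt m j)\<close> by (intro mult_left_mono) auto
    finally have "norm (u * shift s J (pt e) j) \<le> norm u * ((1 + norm s) * norm (pt m j))"
      unfolding norm_mult by (intro mult_left_mono) auto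
    then show "norm (1 - u * shift s J (pt e) j) \<le> 1 + norm u * ((1 + norm s) * norm (pt m j))"
      using norm_triangle_ineq4[of 1 "u * shift s J (pt e) j"] by simp
  qed simp
  show g: "?g summable_on lattice k"
  proof (rule summable_bounded_multiplier)
    show "(\<lambda>e. branch_coeff k m \<zeta> e * Psi k e \<zeta>) abs_summable_on lattice k" by (rule branching(1)[OF conv])
    fix e assume "branch_coeff k m \<zeta> e * Psi k e \<zeta> \<noteq> 0"
    then have "norm (\<Prod>j=1..k. 1 - u * shift s J (pt e) j) \<le> B2" by (intro B2) auto
    moreover have "0 \<le> B1" using B1 norm_ge_zero order_trans by blast
    ultimately show "norm ((s * \<zeta> (Suc k)) ^ card J * kernel_weight_right s {1..Suc k} {1..k} (pt m) (pt e) J *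
        (\<Prod>j=1..k. 1 - u * shift s J (pt e) j)) \<le> norm ((s * \<zeta> (Suc k)) ^ card J) * B1 * B2"
      unfolding norm_mult[of "_ * _"] norm_mult[of "_ ^ _"]
      by (intro mult_mono B1 order_refl mult_nonneg_nonneg) auto
  qed
  then have "(?g has_sum infsum ?g (lattice k)) (lattice k)" by (rule has_sum_infsum)
  then have "((\<lambda>e. ?f (down J e)) has_sum infsum ?g (lattice k)) (lattice k)" unfolding eq .
  then show "(?f has_sum infsum ?g (lattice k)) (lattice k)"
    using has_sum_reindex_bij_betw[OF bij_down_lattice[OF J], of ?f "infsum ?g (lattice k)"] by blast
qed

end

lemma has_sum_finite_sum:
  fixes f :: "'i \<Rightarrow> 'x \<Rightarrow> complex"
  assumes "finite F" "\<And>i. i \<in> F \<Longrightarrow> (f i has_sum S i) A"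
  shows "((\<lambda>x. \<Sum>i\<in>F. f i x) has_sum (\<Sum>i\<in>F. S i)) A"
  using assms by (induction F rule: finite_induct) (auto intro!: has_sum_add)

lemma dual_coeff_empty [simp]:
  "dual_coeff c {} J a = 1"
  by (simp add: dual_coeff_def vandermonde_ratio_def ordered_pairs_def)

context trs
begin

lemma pt_separated:
  assumes "i \<in> {1..p}" "j \<in> {1..p}" "i \<noteq> j"
  shows "pt m i \<noteq> pt m j \<and> pt m i \<noteq> s * pt m j"
  using pt_distinct(1)[OF assms] pt_s[OF assms(2,1)] by blast

section \<open>Pieri rule\<close>

lemma converges_Suc: "converges (Suc k) \<zeta> \<Longrightarrow> converges k \<zeta>"
  by (auto simp: converges_def)

lemma branch_coeff_up:
  assumes "J \<subseteq> {1..Suc k}" "Suc k \<le> p" "\<zeta> (Suc k) \<noteq> 0"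
  shows "branch_coeff k (up J m) \<zeta> e = branch_coeff k m \<zeta> e *
    (\<zeta> (Suc k) ^ card J * (\<Prod>i\<in>J. \<Prod>k\<in>{1..k}. (pt m i - pt e k) / (pt m i - s * pt e k)))"
proof -
  have w: "weight {1..k} {1..Suc k} (up J m) e = weight {1..k} {1..Suc k} m e *
      (\<Prod>i\<in>J. \<Prod>k\<in>{1..k}. (pt m i - pt e k) / (pt m i - s * pt e k))"
    using assms by (intro weight_shift_upper) auto
  have e: "tot (Suc k) (up J m) - tot k e = (tot (Suc k) m - tot k e) + int (card J)"
    unfolding tot_up[OF assms(1)] by simp
  have "\<zeta> (Suc k) powi (tot (Suc k) (up J m) - tot k e) =
      \<zeta> (Suc k) powi (tot (Suc k) m - tot k e) * \<zeta> (Suc k) ^ card J"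
    unfolding e using assms(3) by (subst power_int_add) auto
  then show ?thesis unfolding branch_coeff_def w by (simp only: mult_ac)
qed

text \<open>
  Induction on the rank. Inside the branching sum, the rule of rank \<open>k\<close> and \<open>branch_shift\<close> produce, at
  each lattice point \<open>e\<close>, the right-hand side of the unbalanced kernel identity with
  \<open>x = - v \<zeta>\<^sub>k\<^sub>+\<^sub>1\<close>; its left-hand side is what the shifts of \<open>m\<close> do to the branching coefficient
  (\<open>branch_coeff_up\<close>), and the factor \<open>1 + x\<close> is the missing factor \<open>1 - v \<zeta>\<^sub>k\<^sub>+\<^sub>1\<close>.
\<close>
theorem pieri:
  assumes "k \<le> p" "converges k \<zeta>" "\<And>i. i \<in> {1..k} \<Longrightarrow> \<zeta> i \<noteq> 0"
  shows "(\<Prod>i=1..k. 1 - v * \<zeta> i) * Psi k m \<zeta> =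
    (\<Sum>J\<in>Pow {1..k}. (- v) ^ card J * dual_coeff s {1..k} J (pt m) * Psi k (up J m) \<zeta>)"
  using assms
proof (induction k arbitrary: m)
  case 0
  have "array_term 0 m \<zeta> = (\<lambda>_. 1)" for m by (rule ext) simp
  then show ?case by (simp add: Psi_def)
next
  case (Suc k)
  let ?N = "{1..k}" and ?K = "{1..Suc k}"
  note conv = Suc.prems(2)
  define z where "z = \<zeta> (Suc k)"
  have z: "\<zeta> (Suc k) \<noteq> 0" using Suc.prems(3) by simp
  define T where "T e = branch_coeff k m \<zeta> e * Psi k e \<zeta>" for e
  define g where "g J e = T e * ((s * z) ^ card J * kernel_weight_right s ?K ?N (pt m) (pt e) J)" for J e
  have IH: "(\<Prod>i=1..k. 1 - v * \<zeta> i) * Psi k d \<zeta> =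
    (\<Sum>J\<in>Pow ?N. (- v) ^ card J * dual_coeff s ?N J (pt d) * Psi k (up J d) \<zeta>)" for d
    by (rule Suc.IH) (use Suc.prems converges_Suc[OF conv] in auto)
  have sh: "((\<lambda>d. branch_coeff k m \<zeta> d * (dual_coeff s ?N J (pt d) * Psi k (up J d) \<zeta>)) has_sum
      infsum (g J) (lattice k)) (lattice k)" "g J summable_on lattice k" if "J \<in> Pow ?N" for J
    using branch_shift[OF conv Suc.prems(1) z, of J m 0] that unfolding g_def T_def z_def by auto
  have "((\<lambda>d. \<Sum>J\<in>Pow ?N. (- v) ^ card J * (branch_coeff k m \<zeta> d * (dual_coeff s ?N J (pt d) * Psi k (up J d) \<zeta>)))
      has_sum (\<Sum>J\<in>Pow ?N. (- v) ^ card J * infsum (g J) (lattice k))) (lattice k)"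
    by (intro has_sum_finite_sum has_sum_cmult_right sh) auto
  moreover have "(\<Sum>J\<in>Pow ?N. (- v) ^ card J * (branch_coeff k m \<zeta> d * (dual_coeff s ?N J (pt d) * Psi k (up J d) \<zeta>))) =
      (\<Prod>i=1..k. 1 - v * \<zeta> i) * (branch_coeff k m \<zeta> d * Psi k d \<zeta>)" for d
  proof -
    have "(\<Sum>J\<in>Pow ?N. (- v) ^ card J * (branch_coeff k m \<zeta> d * (dual_coeff s ?N J (pt d) * Psi k (up J d) \<zeta>))) =
      branch_coeff k m \<zeta> d * (\<Sum>J\<in>Pow ?N. (- v) ^ card J * dual_coeff s ?N J (pt d) * Psi k (up J d) \<zeta>)"
      unfolding sum_distrib_left by (simp only: mult_ac)
    then show ?thesis unfolding IH[symmetric] by (simp only: mult_ac)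
  qed
  moreover have "((\<lambda>d. (\<Prod>i=1..k. 1 - v * \<zeta> i) * (branch_coeff k m \<zeta> d * Psi k d \<zeta>)) has_sum
      (\<Prod>i=1..k. 1 - v * \<zeta> i) * Psi (Suc k) m \<zeta>) (lattice k)"
    by (intro has_sum_cmult_right branching(2) conv)
  ultimately have left: "(\<Prod>i=1..k. 1 - v * \<zeta> i) * Psi (Suc k) m \<zeta> =
      (\<Sum>J\<in>Pow ?N. (- v) ^ card J * infsum (g J) (lattice k))"
    using has_sum_unique by fastforce
  have "((\<lambda>e. \<Sum>J\<in>Pow ?N. (- v) ^ card J * g J e) has_sum
      (\<Sum>J\<in>Pow ?N. (- v) ^ card J * infsum (g J) (lattice k))) (lattice k)"
    by (intro has_sum_finite_sum has_sum_cmult_right has_sum_infsum sh(2)) auto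
  then have 1: "((\<lambda>e. (1 - v * z) * (\<Sum>J\<in>Pow ?N. (- v) ^ card J * g J e)) has_sum
      (1 - v * z) * ((\<Prod>i=1..k. 1 - v * \<zeta> i) * Psi (Suc k) m \<zeta>)) (lattice k)"
    unfolding left by (rule has_sum_cmult_right)
  have 2: "((\<lambda>e. \<Sum>J\<in>Pow ?K. (- v) ^ card J * dual_coeff s ?K J (pt m) * (branch_coeff k (up J m) \<zeta> e * Psi k e \<zeta>)) has_sum
      (\<Sum>J\<in>Pow ?K. (- v) ^ card J * dual_coeff s ?K J (pt m) * Psi (Suc k) (up J m) \<zeta>)) (lattice k)"
    by (intro has_sum_finite_sum has_sum_cmult_right branching(2) conv) auto
  have 3: "(1 - v * z) * (\<Sum>J\<in>Pow ?N. (- v) ^ card J * g J e) =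
     (\<Sum>J\<in>Pow ?K. (- v) ^ card J * dual_coeff s ?K J (pt m) * (branch_coeff k (up J m) \<zeta> e * Psi k e \<zeta>))" for e
  proof -
    have sub: "?K \<subseteq> {1..p}" "?N \<subseteq> {1..p}" using Suc.prems(1) by auto
    have ker: "(\<Sum>J\<in>Pow ?K. (- (v * z)) ^ card J * dual_coeff s ?K J (pt m) *
         (\<Prod>i\<in>J. \<Prod>k\<in>?N. (pt m i - pt e k) / (pt m i - s * pt e k))) =
      (1 + (- (v * z))) * (\<Sum>J\<in>Pow ?N. (- (v * z) * s) ^ card J * kernel_weight_right s ?K ?N (pt m) (pt e) J)"
    proof (rule kernel_identity_unbalanced)
      show "finite ?K" "finite ?N" "card ?K = Suc (card ?N)" "s \<noteq> 0" by (simp_all add: s0)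
      show "pt m i \<noteq> pt m i' \<and> pt m i \<noteq> s * pt m i'" if "i \<in> ?K" "i' \<in> ?K" "i \<noteq> i'" for i i'
        using that pt_separated sub by blast
      show "pt e i \<noteq> pt e i' \<and> pt e i \<noteq> s * pt e i'" if "i \<in> ?N" "i' \<in> ?N" "i \<noteq> i'" for i i'
        using that pt_separated sub by blast
      show "pt m i \<noteq> s * pt e i'" if "i \<in> ?K" "i' \<in> ?N" for i i'
        using that pt_s sub by blast
      show "pt m i \<noteq> 0" if "i \<in> ?K" for i using that pt_nonzero sub by blast
      show "pt e i \<noteq> 0" if "i \<in> ?N" for i using that pt_nonzero sub by blast
    qed
    have "(\<Sum>J\<in>Pow ?K. (- v) ^ card J * dual_coeff s ?K J (pt m) * (branch_coeff k (up J m) \<zeta> e * Psi k e \<zeta>)) =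
      (\<Sum>J\<in>Pow ?K. T e * ((- (v * z)) ^ card J * dual_coeff s ?K J (pt m) *
         (\<Prod>i\<in>J. \<Prod>k\<in>?N. (pt m i - pt e k) / (pt m i - s * pt e k))))"
    proof (intro sum.cong refl)
      fix J assume "J \<in> Pow ?K"
      then have bc: "branch_coeff k (up J m) \<zeta> e = branch_coeff k m \<zeta> e *
          (z ^ card J * (\<Prod>i\<in>J. \<Prod>k\<in>?N. (pt m i - pt e k) / (pt m i - s * pt e k)))"
        unfolding z_def using Suc.prems(1) z by (intro branch_coeff_up) auto
      have "(- (v * z)) ^ card J = (- v) ^ card J * z ^ card J" by (simp flip: power_mult_distrib)
      then show "(- v) ^ card J * dual_coeff s ?K J (pt m) * (branch_coeff k (up J m) \<zeta> e * Psi k e \<zeta>) =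
        T e * ((- (v * z)) ^ card J * dual_coeff s ?K J (pt m) *
         (\<Prod>i\<in>J. \<Prod>k\<in>?N. (pt m i - pt e k) / (pt m i - s * pt e k)))"
        unfolding bc T_def by (simp only: mult_ac)
    qed
    also have "\<dots> = T e * ((1 - v * z) * (\<Sum>J\<in>Pow ?N. (- (v * z) * s) ^ card J * kernel_weight_right s ?K ?N (pt m) (pt e) J))"
      unfolding sum_distrib_left[symmetric] ker by simp
    also have "\<dots> = (1 - v * z) * (\<Sum>J\<in>Pow ?N. T e * ((- (v * z) * s) ^ card J * kernel_weight_right s ?K ?N (pt m) (pt e) J))"
      unfolding sum_distrib_left by (simp only: mult_ac)
    also have "(\<Sum>J\<in>Pow ?N. T e * ((- (v * z) * s) ^ card J * kernel_weight_right s ?K ?N (pt m) (pt e) J)) =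
       (\<Sum>J\<in>Pow ?N. (- v) ^ card J * g J e)"
    proof (intro sum.cong refl)
      fix J
      have e: "- (v * z) * s = (- v) * (s * z)" by simp
      show "T e * ((- (v * z) * s) ^ card J * kernel_weight_right s ?K ?N (pt m) (pt e) J) = (- v) ^ card J * g J e"
        unfolding g_def e power_mult_distrib[of "- v" "s * z"] by (simp only: mult_ac)
    qed
    finally show ?thesis by simp
  qed
  have "(1 - v * z) * ((\<Prod>i=1..k. 1 - v * \<zeta> i) * Psi (Suc k) m \<zeta>) =
    (\<Sum>J\<in>Pow ?K. (- v) ^ card J * dual_coeff s ?K J (pt m) * Psi (Suc k) (up J m) \<zeta>)"
    by (rule has_sum_unique[OF 1]) (use 2 in \<open>simp only: 3\<close>)
  then show ?case by (simp add: z_def mult_ac)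
qed

end

section \<open>From the eigenvalue equation to its two-parameter refinement\<close>

text \<open>
  Functions are required to vanish outside \<open>N\<close>, which makes the set finite.
\<close>
definition comps :: "nat set \<Rightarrow> nat \<Rightarrow> (nat \<Rightarrow> nat) set" where
  "comps N l = {\<mu>. (\<forall>i. i \<notin> N \<longrightarrow> \<mu> i = 0) \<and> (\<Sum>i\<in>N. \<mu> i) = l}"

definition plus_comp :: "(nat \<Rightarrow> int) \<Rightarrow> (nat \<Rightarrow> nat) \<Rightarrow> nat \<Rightarrow> int" where
  "plus_comp m \<mu> = (\<lambda>i. m i + int (\<mu> i))"

lemma finite_comps [simp]: "finite N \<Longrightarrow> finite (comps N l)"
proof -
  assume N: "finite N"
  have "\<mu> i \<le> l" if "\<mu> \<in> comps N l" "i \<in> N" for \<mu> i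
    using that member_le_sum[of i N \<mu>] N by (auto simp: comps_def)
  then have "comps N l \<subseteq> {\<mu>. \<forall>i. (i \<in> N \<longrightarrow> \<mu> i \<in> {..l}) \<and> (i \<notin> N \<longrightarrow> \<mu> i = 0)}"
    by (auto simp: comps_def)
  then show ?thesis using N finite_subset finite_set_of_finite_funs[of N "{..l}" 0] by blast
qed

lemma comps_0: "finite N \<Longrightarrow> comps N 0 = {\<lambda>_. 0}"
  by (auto simp: comps_def fun_eq_iff)

lemma plus_comp_0 [simp]: "plus_comp m (\<lambda>_. 0) = m"
  by (simp add: plus_comp_def)

definition elem_poly :: "nat set \<Rightarrow> (nat \<Rightarrow> complex) \<Rightarrow> complex poly" where
  "elem_poly N \<zeta> = (\<Prod>i\<in>N. [:1, - \<zeta> i:])"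

lemma poly_elem_poly: "poly (elem_poly N \<zeta>) v = (\<Prod>i\<in>N. 1 - v * \<zeta> i)"
  by (simp add: elem_poly_def poly_prod)

text \<open>
  An expansion of the values over subsets with weight \<open>(- v)\<^bsup>|J|\<^esup>\<close>, as in the Pieri rule and the
  eigenvalue equation, determines the coefficients.
\<close>
lemma coeff_eq_sum_subsets:
  fixes P :: "complex poly"
  assumes "finite N" "\<And>v. poly P v = (\<Sum>J\<in>Pow N. (- v) ^ card J * X J)"
  shows "coeff P j = (\<Sum>J\<in>{J\<in>Pow N. card J = j}. (-1) ^ j * X J)"
proof -
  have "poly P = poly (\<Sum>J\<in>Pow N. monom ((-1) ^ card J * X J) (card J))"
  proof (rule ext)
    fix v
    show "poly P v = poly (\<Sum>J\<in>Pow N. monom ((-1) ^ card J * X J) (card J)) v"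
      by (simp only: assms(2) poly_sum poly_monom power_minus[of v] mult_ac)
  qed
  then have "P = (\<Sum>J\<in>Pow N. monom ((-1) ^ card J * X J) (card J))"
    by (simp only: poly_eq_poly_eq_iff)
  then have "coeff P j = (\<Sum>J\<in>Pow N. if card J = j then (-1) ^ j * X J else 0)"
    by (simp add: coeff_sum cong: if_cong sum.cong)
  also have "\<dots> = (\<Sum>J\<in>{J\<in>Pow N. card J = j}. (-1) ^ j * X J)"
    using assms(1) by (subst sum.inter_filter) auto
  finally show ?thesis .
qed

lemma coeff_elem_poly_scale: "coeff (elem_poly N (\<lambda>i. c * \<zeta> i)) j = c ^ j * coeff (elem_poly N \<zeta>) j"
proof -
  have "elem_poly N (\<lambda>i. c * \<zeta> i) = pcompose (elem_poly N \<zeta>) [:0, c:]"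
    unfolding elem_poly_def pcompose_prod by (intro prod.cong) (auto simp: pcompose_pCons)
  then show ?thesis by (simp add: coeff_pcompose_linear)
qed

context trs
begin

text \<open>
  \<open>(h)\<^sub>n / (q)\<^sub>n\<close>, the coefficients of \<open>(hX)\<^sub>\<infinity> / (X)\<^sub>\<infinity>\<close> by the \<open>q\<close>-binomial theorem. Thus \<open>binom_series\<close> is
  the formal series of \<open>\<Prod>\<^sub>i (h \<zeta>\<^sub>i X)\<^sub>\<infinity> / (\<zeta>\<^sub>i X)\<^sub>\<infinity>\<close>, called \<open>G(X)\<close> below.
\<close>
definition binom_coeff :: "nat \<Rightarrow> complex" where
  "binom_coeff n = (\<Prod>i<n. (1 - h * q ^ i) / (1 - q ^ Suc i))"

lemma binom_coeff_rec: "(1 - q ^ Suc n) * binom_coeff (Suc n) = (1 - h * q ^ n) * binom_coeff n"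
  using q_power_neq_one[of "Suc n"] by (simp add: binom_coeff_def)

definition binom_series :: "nat set \<Rightarrow> (nat \<Rightarrow> complex) \<Rightarrow> complex fps" where
  "binom_series N \<zeta> = (\<Prod>i\<in>N. Abs_fps (\<lambda>n. binom_coeff n * \<zeta> i ^ n))"

lemma binom_series_functional_equation:
  "fps_of_poly (elem_poly N (shift h I \<zeta>)) * binom_series N (shift q I \<zeta>) =
   fps_of_poly (elem_poly N \<zeta>) * binom_series N \<zeta>"
proof -
  have one: "fps_of_poly [:1, - (h * x):] * Abs_fps (\<lambda>n. binom_coeff n * (q * x) ^ n) =
      fps_of_poly [:1, - x:] * Abs_fps (\<lambda>n. binom_coeff n * x ^ n)" for x
  proof (rule fps_ext)
    fix n
    have lin: "fps_of_poly [:1, c:] = 1 + fps_const c * fps_X" for c :: complex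
      by (simp add: fps_of_poly_pCons mult.commute)
    show "fps_nth (fps_of_poly [:1, - (h * x):] * Abs_fps (\<lambda>n. binom_coeff n * (q * x) ^ n)) n =
      fps_nth (fps_of_poly [:1, - x:] * Abs_fps (\<lambda>n. binom_coeff n * x ^ n)) n"
    proof (cases n)
      case 0
      then show ?thesis unfolding lin by (simp add: fps_mult_nth_0)
    next
      case (Suc k)
      have "binom_coeff (Suc k) * (q * x) ^ Suc k - h * x * (binom_coeff k * (q * x) ^ k) =
        binom_coeff (Suc k) * x ^ Suc k - x * (binom_coeff k * x ^ k)"
      proof -
        have "((1 - q ^ Suc k) * binom_coeff (Suc k) - (1 - h * q ^ k) * binom_coeff k) * x ^ Suc k = 0"
          by (simp only: binom_coeff_rec) simp
        then show ?thesis by (simp add: power_mult_distrib algebra_simps)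
      qed
      then show ?thesis unfolding lin Suc
        by (simp add: distrib_right mult.assoc)
    qed
  qed
  have e: "shift c I \<zeta> i = (if i \<in> I then c * \<zeta> i else \<zeta> i)" for c i by (simp add: shift_def)
  have "fps_of_poly (elem_poly N (shift h I \<zeta>)) * binom_series N (shift q I \<zeta>) =
    (\<Prod>i\<in>N. fps_of_poly [:1, - shift h I \<zeta> i:] * Abs_fps (\<lambda>n. binom_coeff n * shift q I \<zeta> i ^ n))"
    by (simp add: elem_poly_def binom_series_def fps_of_poly_prod prod.distrib)
  also have "\<dots> = (\<Prod>i\<in>N. fps_of_poly [:1, - \<zeta> i:] * Abs_fps (\<lambda>n. binom_coeff n * \<zeta> i ^ n))"
    using one by (intro prod.cong refl) (simp add: e)
  finally show ?thesis by (simp add: elem_poly_def binom_series_def fps_of_poly_prod prod.distrib)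
qed

lemma binom_series_scale: "fps_nth (binom_series N (\<lambda>i. c * \<zeta> i)) n = c ^ n * fps_nth (binom_series N \<zeta>) n"
proof -
  have mult: "Abs_fps (\<lambda>n. c ^ n * fps_nth (f * g) n) = Abs_fps (\<lambda>n. c ^ n * fps_nth f n) * Abs_fps (\<lambda>n. c ^ n * fps_nth g n)"
    for f g :: "complex fps"
    by (rule fps_ext) (auto simp: fps_mult_nth sum_distrib_left power_add[symmetric] intro!: sum.cong
        simp flip: power_add)
  have "binom_series N (\<lambda>i. c * \<zeta> i) = Abs_fps (\<lambda>n. c ^ n * fps_nth (binom_series N \<zeta>) n)"
    unfolding binom_series_def
  proof (induction N rule: infinite_finite_induct)
    case (insert x F)
    then show ?case by (simp add: mult power_mult_distrib mult_ac)
  qed (auto intro!: fps_ext)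
  then show ?thesis by simp
qed

lemma binom_series_0: "fps_nth (binom_series N \<zeta>) 0 = 1"
  unfolding binom_series_def
  by (induction N rule: infinite_finite_induct) (auto simp: fps_mult_nth_0 binom_coeff_def)

text \<open>
  The factor with \<open>k = i\<close> vanishes. In \<open>weight_regroup\<close> this removes the subsets by which a
  composition cannot be lowered.
\<close>
lemma kernel_weight_zero:
  assumes "J \<subseteq> N" "finite N" "i \<in> J" "pt d i = pt m i"
  shows "kernel_weight_right s N N (pt m) (pt d) J = 0"
proof -
  have fin: "finite J" using assms finite_subset by blast
  have "(\<Prod>k\<in>N. (pt m k - pt d i) / (pt m k - s * pt d i)) = 0"
    using assms by (intro prod_zero bexI[of _ i]) auto
  then have "\<exists>j\<in>J. (\<Prod>k\<in>N. (pt m k - pt d j) / (pt m k - s * pt d j)) = 0"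
    using assms(3) by blast
  then have "(\<Prod>j\<in>J. \<Prod>k\<in>N. (pt m k - pt d j) / (pt m k - s * pt d j)) = 0"
    by (rule prod_zero[OF fin])
  then show ?thesis by (simp add: kernel_weight_right_def)
qed

text \<open>
  The substitution \<open>\<mu> = \<nu> - 1\<^sub>J\<close>, in which \<open>weight_shift\<close> exchanges the Pieri coefficients for the
  kernel coefficients. The left-hand side is the coefficient of degree \<open>l\<close> of a product of an elementary
  and a one-row generating function.
\<close>
lemma weight_regroup:
  fixes f :: "nat set \<Rightarrow> (nat \<Rightarrow> int) \<Rightarrow> complex"
  assumes N: "N \<subseteq> {1..p}"
  shows "(\<Sum>j\<le>l. \<Sum>\<mu>\<in>comps N (l - j). weight N N m (plus_comp m \<mu>) *
      (\<Sum>J\<in>{J\<in>Pow N. card J = j}. dual_coeff s N J (pt (plus_comp m \<mu>)) * f J (up J (plus_comp m \<mu>)))) =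
    (\<Sum>\<nu>\<in>comps N l. \<Sum>J\<in>Pow N. weight N N m (plus_comp m \<nu>) *
      kernel_weight_right s N N (pt m) (pt (plus_comp m \<nu>)) J * f J (plus_comp m \<nu>))"
    (is "?lhs = ?rhs")
proof -
  have fin: "finite N" using N finite_subset by blast
  define X where "X J \<mu> = weight N N m (plus_comp m \<mu>) *
      (dual_coeff s N J (pt (plus_comp m \<mu>)) * f J (up J (plus_comp m \<mu>)))" for J \<mu>
  define Y where "Y J \<nu> = weight N N m (plus_comp m \<nu>) *
      kernel_weight_right s N N (pt m) (pt (plus_comp m \<nu>)) J * f J (plus_comp m \<nu>)" for J \<nu>
  let ?P = "{J\<in>Pow N. card J \<le> l}"
  have "?lhs = (\<Sum>j\<le>l. \<Sum>J\<in>{J\<in>Pow N. card J = j}. \<Sum>\<mu>\<in>comps N (l - j). X J \<mu>)"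
    unfolding X_def sum_distrib_left by (intro sum.cong refl sum.swap)
  also have "\<dots> = (\<Sum>j\<le>l. \<Sum>J\<in>{J\<in>?P. card J = j}. \<Sum>\<mu>\<in>comps N (l - card J). X J \<mu>)"
    by (intro sum.cong) auto
  also have "\<dots> = (\<Sum>J\<in>?P. \<Sum>\<mu>\<in>comps N (l - card J). X J \<mu>)"
    using fin by (intro sum.group) auto
  also have "\<dots> = (\<Sum>J\<in>?P. \<Sum>\<nu>\<in>comps N l. Y J \<nu>)"
  proof (rule sum.cong[OF refl])
    fix J assume "J \<in> ?P"
    then have J: "J \<subseteq> N" "card J \<le> l" and finJ: "finite J" using fin finite_subset by auto
    define C where "C = {\<nu>\<in>comps N l. \<forall>i\<in>J. \<nu> i > 0}"
    have sumJ: "(\<Sum>i\<in>N. if i \<in> J then 1 else 0 :: nat) = card J"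
      using fin J by (simp add: sum.If_cases Int_absorb1)
    have "(\<Sum>\<mu>\<in>comps N (l - card J). X J \<mu>) = (\<Sum>\<nu>\<in>C. Y J \<nu>)"
    proof (rule sum.reindex_bij_witness[where j = "\<lambda>\<mu> i. if i \<in> J then \<mu> i + 1 else \<mu> i" and i = "\<lambda>\<nu> i. if i \<in> J then \<nu> i - 1 else \<nu> i"])
      fix \<mu> assume \<mu>: "\<mu> \<in> comps N (l - card J)"
      let ?\<nu> = "\<lambda>i. if i \<in> J then \<mu> i + 1 else \<mu> i"
      have "(\<Sum>i\<in>N. ?\<nu> i) = (\<Sum>i\<in>N. \<mu> i + (if i \<in> J then 1 else 0))" by (intro sum.cong) auto
      then have "(\<Sum>i\<in>N. ?\<nu> i) = l" using \<mu> J by (simp add: sum.distrib sumJ comps_def)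
      then show "?\<nu> \<in> C" using \<mu> J by (auto simp: C_def comps_def)
      show "(\<lambda>i. if i \<in> J then (if i \<in> J then \<mu> i + 1 else \<mu> i) - 1 else if i \<in> J then \<mu> i + 1 else \<mu> i) = \<mu>"
        by auto
      have e: "plus_comp m \<mu> = down J (plus_comp m ?\<nu>)" by (auto simp: plus_comp_def down_def)
      show "Y J ?\<nu> = X J \<mu>"
        unfolding X_def Y_def e mult.assoc[symmetric] weight_shift[OF J(1) N N] by simp
    next
      fix \<nu> assume \<nu>: "\<nu> \<in> C"
      let ?\<mu> = "\<lambda>i. if i \<in> J then \<nu> i - 1 else \<nu> i"
      have "(\<Sum>i\<in>N. \<nu> i) = (\<Sum>i\<in>N. ?\<mu> i + (if i \<in> J then 1 else 0))" using \<nu> by (intro sum.cong) (auto simp: C_def)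
      then have "l = (\<Sum>i\<in>N. ?\<mu> i) + card J" using \<nu> unfolding sum.distrib sumJ by (simp add: C_def comps_def)
      then show "?\<mu> \<in> comps N (l - card J)" using \<nu> J by (auto simp: C_def comps_def)
      show "(\<lambda>i. if i \<in> J then (if i \<in> J then \<nu> i - 1 else \<nu> i) + 1 else if i \<in> J then \<nu> i - 1 else \<nu> i) = \<nu>"
        using \<nu> by (auto simp: C_def)
    qed
    also have "\<dots> = (\<Sum>\<nu>\<in>comps N l. Y J \<nu>)"
    proof (rule sum.mono_neutral_left)
      show "\<forall>\<nu>\<in>comps N l - C. Y J \<nu> = 0"
      proof
        fix \<nu> assume "\<nu> \<in> comps N l - C"
        then obtain i where i: "i \<in> J" "\<nu> i = 0" by (auto simp: C_def)
        then have "pt (plus_comp m \<nu>) i = pt m i" by (simp add: pt_def plus_comp_def)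
        then have "kernel_weight_right s N N (pt m) (pt (plus_comp m \<nu>)) J = 0"
          using i J fin by (intro kernel_weight_zero[of J N i]) auto
        then show "Y J \<nu> = 0" by (simp add: Y_def)
      qed
    qed (use fin in \<open>auto simp: C_def\<close>)
    finally show "(\<Sum>\<mu>\<in>comps N (l - card J). X J \<mu>) = (\<Sum>\<nu>\<in>comps N l. Y J \<nu>)" .
  qed
  also have "\<dots> = (\<Sum>J\<in>Pow N. \<Sum>\<nu>\<in>comps N l. Y J \<nu>)"
  proof (rule sum.mono_neutral_left)
    show "\<forall>J\<in>Pow N - ?P. (\<Sum>\<nu>\<in>comps N l. Y J \<nu>) = 0"
    proof (intro ballI sum.neutral)
      fix J \<nu> assume J: "J \<in> Pow N - ?P" and \<nu>: "\<nu> \<in> comps N l"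
      then have finJ: "finite J" using fin finite_subset by auto
      have "\<exists>i\<in>J. \<nu> i = 0"
      proof (rule ccontr)
        assume "\<not> ?thesis"
        then have "card J \<le> (\<Sum>i\<in>J. \<nu> i)" using finJ sum_mono[of J "\<lambda>_. 1" \<nu>] by (simp add: Suc_leI)
        also have "\<dots> \<le> (\<Sum>i\<in>N. \<nu> i)" using J fin by (intro sum_mono2) auto
        finally show False using J \<nu> by (auto simp: comps_def)
      qed
      then obtain i where i: "i \<in> J" "\<nu> i = 0" by blast
      then have "pt (plus_comp m \<nu>) i = pt m i" by (simp add: pt_def plus_comp_def)
      then have "kernel_weight_right s N N (pt m) (pt (plus_comp m \<nu>)) J = 0"
        using i J fin by (intro kernel_weight_zero[of J N i]) auto
      then show "Y J \<nu> = 0" by (simp add: Y_def)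
    qed
  qed (use fin in auto)
  also have "\<dots> = ?rhs" unfolding Y_def by (rule sum.swap)
  finally show ?thesis .
qed

lemma shift_upper_conv: "shift h J (pt (down J d)) = shift s J (pt d)"
  unfolding pt_down using q0 by (auto simp: shift_def s_def)

text \<open>
  If multiplication by the elementary symmetric functions of \<open>\<zeta>\<close> acts on \<open>F\<close> by the Pieri rule, then
  multiplication by the coefficients of \<open>G\<close> acts by the weights \<open>W(m, m + \<mu>)\<close> with \<open>|\<mu>| = l\<close>. Both sides
  satisfy the same recursion in \<open>l\<close>. For \<open>G\<close> it is the functional equation with all variables
  shifted, \<open>\<Prod>\<^sub>i (1 - h \<zeta>\<^sub>i X) G(q X) = \<Prod>\<^sub>i (1 - \<zeta>\<^sub>i X) G(X)\<close>; for the weights it is the alternating sum at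
  \<open>z = 0\<close>, where the product of the shifted points is \<open>q\<^sup>l s\<^bsup>|J|\<^esup>\<close> times the product of the original
  ones.
\<close>
lemma one_row_expansion:
  assumes N: "N \<subseteq> {1..p}"
    and F: "\<And>m j. coeff (elem_poly N \<zeta>) j * F m =
      (\<Sum>J\<in>{J\<in>Pow N. card J = j}. (-1) ^ j * (dual_coeff s N J (pt m) * F (up J m)))"
  shows "fps_nth (binom_series N \<zeta>) l * F m = (\<Sum>\<mu>\<in>comps N l. weight N N m (plus_comp m \<mu>) * F (plus_comp m \<mu>))"
proof (induction l arbitrary: m rule: less_induct)
  case (less l)
  have fin: "finite N" using N finite_subset by blast
  show ?case
  proof (cases "l = 0")
    case True
    then show ?thesis using comps_0[OF fin] weight_self[OF N] by (simp add: binom_series_0)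
  next
    case False
    define e where "e j = coeff (elem_poly N \<zeta>) j" for j
    define g where "g n = fps_nth (binom_series N \<zeta>) n" for n
    define H where "H \<mu> = weight N N m (plus_comp m \<mu>)" for \<mu>
    have sN: "shift c N \<zeta> i = c * \<zeta> i" if "i \<in> N" for c i using that by simp
    have eN: "elem_poly N (shift h N \<zeta>) = elem_poly N (\<lambda>i. h * \<zeta> i)"
      unfolding elem_poly_def by (intro prod.cong) auto
    have gN: "binom_series N (shift q N \<zeta>) = binom_series N (\<lambda>i. q * \<zeta> i)"
      unfolding binom_series_def by (intro prod.cong) auto
    have "(\<Sum>j=0..l. h ^ j * e j * (q ^ (l - j) * g (l - j))) = (\<Sum>j=0..l. e j * g (l - j))"
      using arg_cong[OF binom_series_functional_equation[of N N \<zeta>], of "\<lambda>f. fps_nth f l"]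
      unfolding eN gN fps_mult_nth by (simp add: coeff_elem_poly_scale binom_series_scale e_def g_def)
    then have "(\<Sum>j\<le>l. (h ^ j * q ^ (l - j) - 1) * (e j * g (l - j))) = 0"
      by (simp add: algebra_simps sum_subtractf atLeast0AtMost)
    moreover have "(\<Sum>j\<le>l. (h ^ j * q ^ (l - j) - 1) * (e j * g (l - j))) * F m =
       (\<Sum>j\<le>l. (q ^ l * s ^ j - 1) * (e j * (g (l - j) * F m)))"
    proof -
      have "h ^ j * q ^ (l - j) = q ^ l * s ^ j" if "j \<le> l" for j
      proof -
        have "q ^ l = q ^ (l - j) * q ^ j" using that by (simp flip: power_add)
        moreover have "h ^ j = q ^ j * s ^ j" by (metis s_q(1) power_mult_distrib)
        ultimately show ?thesis by (simp only: mult_ac)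
      qed
      then show ?thesis unfolding sum_distrib_right by (intro sum.cong) auto
    qed
    ultimately have z1: "(\<Sum>j\<le>l. (q ^ l * s ^ j - 1) * (e j * (g (l - j) * F m))) = 0" by simp
    \<comment> \<open>The recursion for \<open>G\<close> has the coefficients \<open>q\<^sup>l s\<^sup>j - 1\<close>, and \<open>Z j\<close> is its \<open>j\<close>-th summand with
        the weights in place of \<open>G\<close>.\<close>
    define f where "f J d = (-1) ^ card J * (q ^ l * s ^ card J - 1) * F d" for J :: "nat set" and d
    define Z where "Z j = (\<Sum>\<mu>\<in>comps N (l - j). H \<mu> *
      (\<Sum>J\<in>{J\<in>Pow N. card J = j}. dual_coeff s N J (pt (plus_comp m \<mu>)) * f J (up J (plus_comp m \<mu>))))" for j
    have Zj: "Z j = (q ^ l * s ^ j - 1) * (e j * (\<Sum>\<mu>\<in>comps N (l - j). H \<mu> * F (plus_comp m \<mu>)))" for j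
    proof -
      have "(\<Sum>J\<in>{J\<in>Pow N. card J = j}. dual_coeff s N J (pt d) * f J (up J d)) =
        (q ^ l * s ^ j - 1) * (e j * F d)" for d
        unfolding e_def F sum_distrib_left f_def by (intro sum.cong refl) (simp add: mult_ac)
      then show ?thesis unfolding Z_def by (simp add: sum_distrib_left mult_ac)
    qed
    have "(\<Sum>j\<le>l. Z j) = (\<Sum>\<nu>\<in>comps N l. \<Sum>J\<in>Pow N. H \<nu> *
        kernel_weight_right s N N (pt m) (pt (plus_comp m \<nu>)) J * f J (plus_comp m \<nu>))"
      unfolding Z_def H_def by (rule weight_regroup[OF N])
    also have "\<dots> = 0"
    proof (rule sum.neutral, rule ballI)
      fix \<nu> assume \<nu>: "\<nu> \<in> comps N l"
      let ?y = "pt (plus_comp m \<nu>)"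
      have "(\<Sum>J\<in>Pow N. (-1) ^ card J * kernel_weight_right s N N (pt m) ?y J *
        ((\<Prod>i\<in>N. 0 - shift s J ?y i) - (\<Prod>k\<in>N. 0 - pt m k))) = 0"
        using N fin s0 pt_distinct(1) pt_s by (intro alternating_sum_balanced) (auto simp: subset_iff)
      moreover have "(\<Prod>i\<in>N. 0 - shift s J ?y i) - (\<Prod>k\<in>N. 0 - pt m k) =
        (q ^ l * s ^ card J - 1) * (\<Prod>k\<in>N. 0 - pt m k)" if "J \<in> Pow N" for J
      proof -
        have "(\<Prod>i\<in>N. 0 - shift s J ?y i) = (\<Prod>i\<in>N. (if i \<in> J then s else 1) * (q ^ \<nu> i * (0 - pt m i)))"
          using q0 by (intro prod.cong) (auto simp: shift_def pt_def plus_comp_def power_int_add)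
        also have "\<dots> = (\<Prod>i\<in>N. if i \<in> J then s else 1) * ((\<Prod>i\<in>N. q ^ \<nu> i) * (\<Prod>k\<in>N. 0 - pt m k))"
          unfolding prod.distrib ..
        also have "(\<Prod>i\<in>N. if i \<in> J then s else 1) = s ^ card J"
          using that fin by (simp add: prod.If_cases Int_absorb1)
        also have "(\<Prod>i\<in>N. q ^ \<nu> i) = q ^ l"
          using \<nu> by (simp add: comps_def flip: power_sum)
        finally show ?thesis by (simp add: algebra_simps)
      qed
      ultimately have "(\<Sum>J\<in>Pow N. (-1) ^ card J * kernel_weight_right s N N (pt m) ?y J *
        ((q ^ l * s ^ card J - 1) * (\<Prod>k\<in>N. 0 - pt m k))) = 0" by simp
      moreover define S where "S = (\<Sum>J\<in>Pow N. (-1) ^ card J * kernel_weight_right s N N (pt m) ?y J *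
        (q ^ l * s ^ card J - 1))"
      ultimately have "S * (\<Prod>k\<in>N. 0 - pt m k) = 0"
        unfolding S_def sum_distrib_right by (simp only: mult.assoc)
      moreover have "(\<Prod>k\<in>N. 0 - pt m k) \<noteq> 0" using pt_nonzero N fin by (auto simp: subset_iff)
      ultimately have "S = 0" by (metis mult_eq_0_iff)
      then have "H \<nu> * F (plus_comp m \<nu>) * (\<Sum>J\<in>Pow N. (-1) ^ card J * kernel_weight_right s N N (pt m) ?y J *
        (q ^ l * s ^ card J - 1)) = 0" unfolding S_def[symmetric] by simp
      then show "(\<Sum>J\<in>Pow N. H \<nu> * kernel_weight_right s N N (pt m) ?y J * f J (plus_comp m \<nu>)) = 0"
        unfolding sum_distrib_left f_def by (simp only: mult_ac)
    qed
    finally have z2: "(\<Sum>j\<le>l. Z j) = 0" .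
    have "{..l} = insert 0 {1..l}" by auto
    then have split: "(\<Sum>j\<le>l. x j) = x 0 + (\<Sum>j\<in>{1..l}. x j)" for x :: "nat \<Rightarrow> complex" by simp
    have "(\<Sum>j\<in>{1..l}. (q ^ l * s ^ j - 1) * (e j * (g (l - j) * F m))) = (\<Sum>j\<in>{1..l}. Z j)"
    proof (intro sum.cong refl)
      fix j assume "j \<in> {1..l}"
      then have "l - j < l" by auto
      then show "(q ^ l * s ^ j - 1) * (e j * (g (l - j) * F m)) = Z j"
        unfolding Zj g_def H_def using less.IH by simp
    qed
    then have "(q ^ l - 1) * (e 0 * (g l * F m)) = Z 0"
      using z1 z2 unfolding split by (simp add: add_eq_0_iff2)
    moreover have "e 0 = 1"
      unfolding e_def poly_0_coeff_0[symmetric] poly_elem_poly by simp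
    moreover have "q ^ l \<noteq> 1" using False q_power_neq_one by simp
    ultimately show ?thesis unfolding Zj g_def H_def by simp
  qed
qed

text \<open>
  The coefficients of \<open>v\<^sup>j\<close> on both sides, \<open>R m j\<close> and \<open>D m j\<close>, satisfy the same system of linear
  equations: for all \<open>l\<close>,
  \<open>\<Sum>\<^sub>j \<Sum>\<^sub>|\<^sub>\<mu>\<^sub>|\<^sub>=\<^sub>l\<^sub>-\<^sub>j W(m, m + \<mu>) R (m + \<mu>) j\<close> is the coefficient of \<open>X\<^sup>l\<close> in
  \<open>\<Prod>\<^sub>i (1 - \<zeta>\<^sub>i X) G(X)\<close> times the right-hand side of the eigenvalue equation. On the left-hand side of the
  claim the one-row expansion turns the weights into \<open>G\<close> at the shifted variables, whose product with
  \<open>\<Prod>\<^sub>i (1 - h\<^bsup>[i \<in> I]\<^esup> \<zeta>\<^sub>i X)\<close> does not depend on \<open>I\<close>, and then the eigenvalue equation applies. On the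
  right-hand side \<open>weight_regroup\<close> and the alternating sum replace the eigenvalue at the shifted points
  by the one at \<open>m\<close>. The system is triangular with diagonal \<open>W(m, m) = 1\<close>, so \<open>R = D\<close>.
\<close>
theorem two_parameter_refinement:
  fixes F :: "nat set \<Rightarrow> (nat \<Rightarrow> int) \<Rightarrow> complex" and \<kappa> :: "nat set \<Rightarrow> complex"
  assumes N: "N \<subseteq> {1..p}"
    and pieri: "\<And>I m v. I \<subseteq> N \<Longrightarrow> (\<Prod>i\<in>N. 1 - v * shift q I \<zeta> i) * F I m =
      (\<Sum>J\<in>Pow N. (- v) ^ card J * (dual_coeff s N J (pt m) * F I (up J m)))"
    and eigen: "\<And>m. (\<Sum>I\<in>Pow N. \<kappa> I * F I m) = (\<Prod>i\<in>N. 1 - u * pt m i) * F {} m"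
  shows "(\<Sum>I\<in>Pow N. \<kappa> I * (\<Prod>i\<in>N. 1 - v * shift h I \<zeta> i) * F I m) =
    (\<Sum>J\<in>Pow N. (- v) ^ card J * (dual_coeff s N J (pt m) * (\<Prod>i\<in>N. 1 - u * shift h J (pt m) i) * F {} (up J m)))"
proof -
  have fin: "finite N" using N finite_subset by blast
  define e where "e I j = coeff (elem_poly N (shift h I \<zeta>)) j" for I j
  define EG where "EG = fps_of_poly (elem_poly N \<zeta>) * binom_series N \<zeta>"
  define \<Lambda> where "\<Lambda> m = (\<Prod>i\<in>N. 1 - u * pt m i)" for m
  have pc: "coeff (elem_poly N (shift q I \<zeta>)) j * F I m =
      (\<Sum>J\<in>{J\<in>Pow N. card J = j}. (-1) ^ j * (dual_coeff s N J (pt m) * F I (up J m)))" if "I \<subseteq> N" for I m j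
  proof -
    have "coeff (smult (F I m) (elem_poly N (shift q I \<zeta>))) j =
      (\<Sum>J\<in>{J\<in>Pow N. card J = j}. (-1) ^ j * (dual_coeff s N J (pt m) * F I (up J m)))"
      using fin pieri[OF that] by (intro coeff_eq_sum_subsets) (simp_all add: poly_elem_poly mult.commute)
    then show ?thesis by (simp add: mult.commute)
  qed
  have row: "fps_nth (binom_series N (shift q I \<zeta>)) l * F I m =
      (\<Sum>\<mu>\<in>comps N l. weight N N m (plus_comp m \<mu>) * F I (plus_comp m \<mu>))" if "I \<subseteq> N" for I l m
    by (rule one_row_expansion[OF N]) (rule pc[OF that])
  have conv: "(\<Sum>j\<le>l. e I j * fps_nth (binom_series N (shift q I \<zeta>)) (l - j)) = fps_nth EG l" for I l
    unfolding EG_def binom_series_functional_equation[of N I \<zeta>, symmetric] e_def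
    by (simp add: fps_mult_nth atLeast0AtMost)
  define D where "D m j = (\<Sum>J\<in>{J\<in>Pow N. card J = j}. (-1) ^ j * (dual_coeff s N J (pt m) *
      (\<Prod>i\<in>N. 1 - u * shift h J (pt m) i) * F {} (up J m)))" for m j
  define R where "R m j = (\<Sum>I\<in>Pow N. \<kappa> I * e I j * F I m)" for m j
  have HR: "(\<Sum>j\<le>l. \<Sum>\<mu>\<in>comps N (l - j). weight N N m (plus_comp m \<mu>) * R (plus_comp m \<mu>) j) =
      fps_nth EG l * (\<Lambda> m * F {} m)" for m l
  proof -
    have "(\<Sum>\<mu>\<in>comps N (l - j). weight N N m (plus_comp m \<mu>) * R (plus_comp m \<mu>) j) =
      (\<Sum>I\<in>Pow N. \<kappa> I * (e I j * fps_nth (binom_series N (shift q I \<zeta>)) (l - j) * F I m))" for j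
    proof -
      have "(\<Sum>\<mu>\<in>comps N (l - j). weight N N m (plus_comp m \<mu>) * R (plus_comp m \<mu>) j) =
        (\<Sum>I\<in>Pow N. \<Sum>\<mu>\<in>comps N (l - j). weight N N m (plus_comp m \<mu>) * (\<kappa> I * e I j * F I (plus_comp m \<mu>)))"
        unfolding R_def sum_distrib_left by (rule sum.swap)
      also have "\<dots> = (\<Sum>I\<in>Pow N. \<kappa> I * e I j * (\<Sum>\<mu>\<in>comps N (l - j). weight N N m (plus_comp m \<mu>) * F I (plus_comp m \<mu>)))"
        unfolding sum_distrib_left by (simp only: mult_ac)
      also have "\<dots> = (\<Sum>I\<in>Pow N. \<kappa> I * (e I j * fps_nth (binom_series N (shift q I \<zeta>)) (l - j) * F I m))"
        using row by (intro sum.cong refl) (simp add: mult_ac)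
      finally show ?thesis .
    qed
    then have "(\<Sum>j\<le>l. \<Sum>\<mu>\<in>comps N (l - j). weight N N m (plus_comp m \<mu>) * R (plus_comp m \<mu>) j) =
      (\<Sum>j\<le>l. \<Sum>I\<in>Pow N. \<kappa> I * (e I j * fps_nth (binom_series N (shift q I \<zeta>)) (l - j) * F I m))" by simp
    also have "\<dots> = (\<Sum>I\<in>Pow N. \<Sum>j\<le>l. \<kappa> I * (e I j * fps_nth (binom_series N (shift q I \<zeta>)) (l - j) * F I m))"
      by (rule sum.swap)
    also have "\<dots> = (\<Sum>I\<in>Pow N. \<kappa> I * (fps_nth EG l * F I m))"
    proof (intro sum.cong refl)
      fix I
      have "(\<Sum>j\<le>l. \<kappa> I * (e I j * fps_nth (binom_series N (shift q I \<zeta>)) (l - j) * F I m)) =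
        \<kappa> I * ((\<Sum>j\<le>l. e I j * fps_nth (binom_series N (shift q I \<zeta>)) (l - j)) * F I m)"
        unfolding sum_distrib_left sum_distrib_right by (simp only: mult_ac)
      then show "(\<Sum>j\<le>l. \<kappa> I * (e I j * fps_nth (binom_series N (shift q I \<zeta>)) (l - j) * F I m)) =
        \<kappa> I * (fps_nth EG l * F I m)" unfolding conv .
    qed
    also have "\<dots> = fps_nth EG l * (\<Sum>I\<in>Pow N. \<kappa> I * F I m)" by (simp add: sum_distrib_left mult_ac)
    finally show ?thesis unfolding eigen \<Lambda>_def .
  qed
  have HD: "(\<Sum>j\<le>l. \<Sum>\<mu>\<in>comps N (l - j). weight N N m (plus_comp m \<mu>) * D (plus_comp m \<mu>) j) =
      fps_nth EG l * (\<Lambda> m * F {} m)" for m l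
  proof -
    define f where "f J d = (-1) ^ card J * ((\<Prod>i\<in>N. 1 - u * shift h J (pt (down J d)) i) * F {} d)" for J d
    define f0 where "f0 J d = (-1) ^ card J * F {} d" for J :: "nat set" and d
    have "D d j = (\<Sum>J\<in>{J\<in>Pow N. card J = j}. dual_coeff s N J (pt d) * f J (up J d))" for d j
      unfolding D_def f_def by (intro sum.cong refl) (simp add: mult_ac)
    then have "(\<Sum>j\<le>l. \<Sum>\<mu>\<in>comps N (l - j). weight N N m (plus_comp m \<mu>) * D (plus_comp m \<mu>) j) =
      (\<Sum>\<nu>\<in>comps N l. \<Sum>J\<in>Pow N. weight N N m (plus_comp m \<nu>) *
        kernel_weight_right s N N (pt m) (pt (plus_comp m \<nu>)) J * f J (plus_comp m \<nu>))"
      by (simp only: weight_regroup[OF N])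
    also have "\<dots> = (\<Sum>\<nu>\<in>comps N l. \<Lambda> m * (\<Sum>J\<in>Pow N. weight N N m (plus_comp m \<nu>) *
        kernel_weight_right s N N (pt m) (pt (plus_comp m \<nu>)) J * f0 J (plus_comp m \<nu>)))"
    proof (intro sum.cong refl)
      fix \<nu>
      let ?y = "pt (plus_comp m \<nu>)" and ?w = "weight N N m (plus_comp m \<nu>) * F {} (plus_comp m \<nu>)"
      have "(\<Sum>J\<in>Pow N. (-1) ^ card J * kernel_weight_right s N N (pt m) ?y J * (\<Prod>i\<in>N. 1 - u * shift s J ?y i)) =
        \<Lambda> m * (\<Sum>J\<in>Pow N. (-1) ^ card J * kernel_weight_right s N N (pt m) ?y J)"
        unfolding \<Lambda>_def using N fin s0 pt_distinct(1) pt_s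
        by (intro alternating_sum_balanced') (auto simp: subset_iff)
      then have "?w * (\<Sum>J\<in>Pow N. (-1) ^ card J * kernel_weight_right s N N (pt m) ?y J * (\<Prod>i\<in>N. 1 - u * shift s J ?y i)) =
        ?w * (\<Lambda> m * (\<Sum>J\<in>Pow N. (-1) ^ card J * kernel_weight_right s N N (pt m) ?y J))" by simp
      then show "(\<Sum>J\<in>Pow N. weight N N m (plus_comp m \<nu>) * kernel_weight_right s N N (pt m) ?y J * f J (plus_comp m \<nu>)) =
        \<Lambda> m * (\<Sum>J\<in>Pow N. weight N N m (plus_comp m \<nu>) * kernel_weight_right s N N (pt m) ?y J * f0 J (plus_comp m \<nu>))"
        unfolding f_def f0_def shift_upper_conv sum_distrib_left by (simp only: mult_ac)
    qed
    also have "\<dots> = \<Lambda> m * (\<Sum>j\<le>l. \<Sum>\<mu>\<in>comps N (l - j). weight N N m (plus_comp m \<mu>) *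
      (\<Sum>J\<in>{J\<in>Pow N. card J = j}. dual_coeff s N J (pt (plus_comp m \<mu>)) * f0 J (up J (plus_comp m \<mu>))))"
      by (subst weight_regroup[OF N]) (rule sum_distrib_left[symmetric])
    also have "(\<Sum>j\<le>l. \<Sum>\<mu>\<in>comps N (l - j). weight N N m (plus_comp m \<mu>) *
      (\<Sum>J\<in>{J\<in>Pow N. card J = j}. dual_coeff s N J (pt (plus_comp m \<mu>)) * f0 J (up J (plus_comp m \<mu>)))) =
      (\<Sum>j\<le>l. e {} j * fps_nth (binom_series N \<zeta>) (l - j)) * F {} m"
      unfolding sum_distrib_right
    proof (intro sum.cong refl)
      fix j
      have "(\<Sum>J\<in>{J\<in>Pow N. card J = j}. dual_coeff s N J (pt d) * f0 J (up J d)) = e {} j * F {} d" for d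
        using pc[of "{}" j d] unfolding f0_def e_def by (simp add: mult_ac)
      then have "(\<Sum>\<mu>\<in>comps N (l - j). weight N N m (plus_comp m \<mu>) *
        (\<Sum>J\<in>{J\<in>Pow N. card J = j}. dual_coeff s N J (pt (plus_comp m \<mu>)) * f0 J (up J (plus_comp m \<mu>)))) =
        e {} j * (\<Sum>\<mu>\<in>comps N (l - j). weight N N m (plus_comp m \<mu>) * F {} (plus_comp m \<mu>))"
        by (simp add: sum_distrib_left mult_ac)
      then show "(\<Sum>\<mu>\<in>comps N (l - j). weight N N m (plus_comp m \<mu>) *
        (\<Sum>J\<in>{J\<in>Pow N. card J = j}. dual_coeff s N J (pt (plus_comp m \<mu>)) * f0 J (up J (plus_comp m \<mu>)))) =
        e {} j * fps_nth (binom_series N \<zeta>) (l - j) * F {} m"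
        using row[of "{}" "l - j" m] by simp
    qed
    also have "\<dots> = fps_nth EG l * F {} m" using conv[of "{}" l] by simp
    finally show ?thesis by (simp add: mult_ac)
  qed
  have RD: "R m l = D m l" for m l
  proof (induction l arbitrary: m rule: less_induct)
    case (less l)
    have "(\<Sum>j\<le>l. \<Sum>\<mu>\<in>comps N (l - j). weight N N m (plus_comp m \<mu>) * R (plus_comp m \<mu>) j) =
      (\<Sum>j\<le>l. \<Sum>\<mu>\<in>comps N (l - j). weight N N m (plus_comp m \<mu>) * D (plus_comp m \<mu>) j)"
      unfolding HR HD ..
    moreover have split: "(\<Sum>j\<le>l. x j) = (\<Sum>j<l. x j) + x l" for x :: "nat \<Rightarrow> complex"
      by (simp flip: lessThan_Suc_atMost)
    moreover have "(\<Sum>j<l. \<Sum>\<mu>\<in>comps N (l - j). weight N N m (plus_comp m \<mu>) * R (plus_comp m \<mu>) j) =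
      (\<Sum>j<l. \<Sum>\<mu>\<in>comps N (l - j). weight N N m (plus_comp m \<mu>) * D (plus_comp m \<mu>) j)"
      using less.IH by (intro sum.cong) auto
    ultimately have "(\<Sum>\<mu>\<in>comps N 0. weight N N m (plus_comp m \<mu>) * R (plus_comp m \<mu>) l) =
      (\<Sum>\<mu>\<in>comps N 0. weight N N m (plus_comp m \<mu>) * D (plus_comp m \<mu>) l)" by simp
    then show ?case using comps_0[OF fin] weight_self[OF N] by simp
  qed
  define P where "P = (\<Sum>I\<in>Pow N. smult (\<kappa> I * F I m) (elem_poly N (shift h I \<zeta>)))"
  define Q where "Q = (\<Sum>J\<in>Pow N. monom ((-1) ^ card J * (dual_coeff s N J (pt m) *
      (\<Prod>i\<in>N. 1 - u * shift h J (pt m) i) * F {} (up J m))) (card J))"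
  have "coeff Q j = D m j" for j
  proof -
    have "poly Q v = (\<Sum>J\<in>Pow N. (- v) ^ card J * (dual_coeff s N J (pt m) *
      (\<Prod>i\<in>N. 1 - u * shift h J (pt m) i) * F {} (up J m)))" for v
      unfolding Q_def by (simp only: poly_sum poly_monom power_minus[of v] mult_ac)
    then show ?thesis unfolding D_def by (rule coeff_eq_sum_subsets[OF fin])
  qed
  moreover have "coeff P j = R m j" for j
    unfolding P_def R_def e_def by (simp add: coeff_sum mult_ac)
  ultimately have "P = Q" using RD by (simp add: poly_eq_iff)
  then have "poly P v = poly Q v" by simp
  then show ?thesis
    unfolding P_def Q_def poly_sum poly_smult poly_elem_poly poly_monom power_minus[of v]
    by (simp only: mult_ac)
qed

end

section \<open>The eigenvalue equation\<close>

lemma shift_disjoint_union: "J \<inter> I = {} \<Longrightarrow> shift c I (shift c J x) = shift c (J \<union> I) x"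
  by (rule ext) (auto simp: shift_def)

context trs
begin

text \<open>
  Up to the common factor \<open>h\<^bsup>n-1\<^esup>\<close>, these are the factors \<open>\<alpha>\<^sub>i h\<^bsup>n-i\<^esup>\<close> produced by the theta functions. In
  this normalisation they do not depend on the rank.
\<close>
definition c :: "nat \<Rightarrow> complex" where
  "c i = \<alpha> i * h powi (1 - int i)"

definition shift_coeff :: "nat \<Rightarrow> complex \<Rightarrow> (nat \<Rightarrow> complex) \<Rightarrow> nat set \<Rightarrow> complex" where
  "shift_coeff k u \<zeta> I = (- u) ^ card I * vandermonde_ratio {1..k} (shift h I \<zeta>) \<zeta> * (\<Prod>i\<in>I. c i)"

text \<open>
  The equations of all \<open>T\<^sub>r\<close> at once, as a polynomial in \<open>u\<close>.
\<close>
definition eigen_equation :: "nat \<Rightarrow> complex \<Rightarrow> (nat \<Rightarrow> complex) \<Rightarrow> bool" where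
  "eigen_equation k u \<zeta> \<longleftrightarrow> (\<forall>m. (\<Sum>I\<in>Pow {1..k}. shift_coeff k u \<zeta> I * Psi k m (shift q I \<zeta>)) =
     (\<Prod>i=1..k. 1 - u * pt m i) * Psi k m \<zeta>)"

lemma shift_coeff_cong:
  assumes "I \<subseteq> {1..k}" "\<And>i. i \<in> {1..k} \<Longrightarrow> \<zeta> i = \<zeta>' i"
  shows "shift_coeff k u \<zeta> I = shift_coeff k u \<zeta>' I"
proof -
  have "vandermonde_ratio {1..k} (shift h I \<zeta>) \<zeta> = vandermonde_ratio {1..k} (shift h I \<zeta>') \<zeta>'"
    using assms(2) by (intro vandermonde_ratio_cong) (auto simp: shift_def)
  then show ?thesis by (simp add: shift_coeff_def)
qed

lemma eigen_equation_cong: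
  assumes "\<And>i. i \<in> {1..k} \<Longrightarrow> \<zeta> i = \<zeta>' i"
  shows "eigen_equation k u \<zeta> = eigen_equation k u \<zeta>'"
proof -
  have "Psi k m (shift q I \<zeta>) = Psi k m (shift q I \<zeta>')" for m I
    using assms by (intro Psi_cong_zeta) (auto simp: shift_def)
  moreover have "Psi k m \<zeta> = Psi k m \<zeta>'" for m using assms by (rule Psi_cong_zeta)
  moreover have "shift_coeff k u \<zeta> I = shift_coeff k u \<zeta>' I" if "I \<in> Pow {1..k}" for I
    using assms that by (intro shift_coeff_cong) auto
  ultimately show ?thesis unfolding eigen_equation_def by simp
qed

text \<open>
  At \<open>u = 0\<close> only \<open>I = {}\<close> remains; with it, the refinement becomes the Pieri rule, and
  \<open>refined_branching\<close> covers that case as well.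
\<close>
lemma eigen_equation_trivial:
  assumes "\<And>i j. i \<in> {1..k} \<Longrightarrow> j \<in> {1..k} \<Longrightarrow> i \<noteq> j \<Longrightarrow> \<zeta> i \<noteq> \<zeta> j"
  shows "shift_coeff k 0 \<zeta> {} = 1" "I \<subseteq> {1..k} \<Longrightarrow> I \<noteq> {} \<Longrightarrow> shift_coeff k 0 \<zeta> I = 0" "eigen_equation k 0 \<zeta>"
proof -
  show 1: "shift_coeff k 0 \<zeta> {} = 1"
    unfolding shift_coeff_def vandermonde_ratio_def using assms
    by (auto intro!: prod.neutral simp: ordered_pairs_def)
  show 2: "shift_coeff k 0 \<zeta> I = 0" if "I \<subseteq> {1..k}" "I \<noteq> {}" for I
    using that finite_subset[of I "{1..k}"] by (simp add: shift_coeff_def card_gt_0_iff)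
  have "(\<Sum>I\<in>Pow {1..k}. shift_coeff k 0 \<zeta> I * Psi k m (shift q I \<zeta>)) =
    (\<Sum>I\<in>{{}}. shift_coeff k 0 \<zeta> I * Psi k m (shift q I \<zeta>))" for m
    using 2 by (intro sum.mono_neutral_right) auto
  then show "eigen_equation k 0 \<zeta>" by (simp add: eigen_equation_def 1)
qed

text \<open>
  The two-parameter refinement in rank \<open>k\<close>, inserted into the branching sum of rank \<open>k + 1\<close>, with the
  lattice shifts moved onto the weight. As \<open>I \<subseteq> {1, \<dots>, k}\<close>, the branching coefficients do not
  see the shift of \<open>\<zeta>\<close>.
\<close>
lemma refined_branching:
  assumes k: "Suc k \<le> p" and conv: "\<And>I. I \<subseteq> {1..k} \<Longrightarrow> converges (Suc k) (shift q I \<zeta>)"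
    and nz: "\<And>i. i \<in> {1..Suc k} \<Longrightarrow> \<zeta> i \<noteq> 0"
    and eigen: "eigen_equation k u \<zeta>"
  shows "((\<lambda>e. branch_coeff k m \<zeta> e * Psi k e \<zeta> * (\<Sum>J\<in>Pow {1..k}. (- v * s * \<zeta> (Suc k)) ^ card J *
        kernel_weight_right s {1..Suc k} {1..k} (pt m) (pt e) J * (\<Prod>j=1..k. 1 - u * shift s J (pt e) j))) has_sum
      (\<Sum>I\<in>Pow {1..k}. shift_coeff k u \<zeta> I * (\<Prod>i=1..k. 1 - v * shift h I \<zeta> i) * Psi (Suc k) m (shift q I \<zeta>)))
      (lattice k)"
proof -
  let ?N = "{1..k}"
  define F where "F I d = Psi k d (shift q I \<zeta>)" for I d
  have F0: "F {} d = Psi k d \<zeta>" for d by (simp add: F_def)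
  have ref: "(\<Sum>I\<in>Pow ?N. shift_coeff k u \<zeta> I * (\<Prod>i\<in>?N. 1 - v * shift h I \<zeta> i) * F I d) =
    (\<Sum>J\<in>Pow ?N. (- v) ^ card J * (dual_coeff s ?N J (pt d) * (\<Prod>i\<in>?N. 1 - u * shift h J (pt d) i) * F {} (up J d)))" for d
  proof (rule two_parameter_refinement)
    show "?N \<subseteq> {1..p}" using k by auto
    fix I d v assume I: "I \<subseteq> ?N"
    have "(\<Prod>i=1..k. 1 - v * shift q I \<zeta> i) * Psi k d (shift q I \<zeta>) =
      (\<Sum>J\<in>Pow ?N. (- v) ^ card J * dual_coeff s ?N J (pt d) * Psi k (up J d) (shift q I \<zeta>))"
      using k converges_Suc[OF conv[OF I]] nz q0 by (intro pieri) (auto simp: shift_def)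
    then show "(\<Prod>i\<in>?N. 1 - v * shift q I \<zeta> i) * F I d =
      (\<Sum>J\<in>Pow ?N. (- v) ^ card J * (dual_coeff s ?N J (pt d) * F I (up J d)))"
      by (simp add: F_def mult.assoc)
  next
    fix d
    show "(\<Sum>I\<in>Pow ?N. shift_coeff k u \<zeta> I * F I d) = (\<Prod>i\<in>?N. 1 - u * pt d i) * F {} d"
      using eigen unfolding eigen_equation_def F_def by simp
  qed
  define g where "g J e = branch_coeff k m \<zeta> e * Psi k e \<zeta> * ((s * \<zeta> (Suc k)) ^ card J *
        kernel_weight_right s {1..Suc k} ?N (pt m) (pt e) J * (\<Prod>j=1..k. 1 - u * shift s J (pt e) j))" for J e
  have conv0: "converges (Suc k) \<zeta>" using conv[of "{}"] by simp
  have sh: "((\<lambda>d. branch_coeff k m \<zeta> d * (dual_coeff s ?N J (pt d) *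
        (\<Prod>j=1..k. 1 - u * shift h J (pt d) j) * Psi k (up J d) \<zeta>)) has_sum infsum (g J) (lattice k)) (lattice k)"
    "g J summable_on lattice k" if "J \<in> Pow ?N" for J
    using branch_shift[OF conv0 k, of J m u] nz that unfolding g_def by auto
  have "((\<lambda>d. \<Sum>I\<in>Pow ?N. (shift_coeff k u \<zeta> I * (\<Prod>i=1..k. 1 - v * shift h I \<zeta> i)) * (branch_coeff k m \<zeta> d * F I d)) has_sum
      (\<Sum>I\<in>Pow ?N. (shift_coeff k u \<zeta> I * (\<Prod>i=1..k. 1 - v * shift h I \<zeta> i)) * Psi (Suc k) m (shift q I \<zeta>))) (lattice k)"
  proof (intro has_sum_finite_sum has_sum_cmult_right)
    fix I assume I: "I \<in> Pow ?N"
    then have "branch_coeff k m (shift q I \<zeta>) d = branch_coeff k m \<zeta> d" for d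
      by (auto simp: branch_coeff_def shift_def)
    then show "((\<lambda>d. branch_coeff k m \<zeta> d * F I d) has_sum Psi (Suc k) m (shift q I \<zeta>)) (lattice k)"
      using branching(2)[OF conv[of I], of m] I unfolding F_def by simp
  qed simp
  moreover have "(\<Sum>I\<in>Pow ?N. (shift_coeff k u \<zeta> I * (\<Prod>i=1..k. 1 - v * shift h I \<zeta> i)) * (branch_coeff k m \<zeta> d * F I d)) =
    (\<Sum>J\<in>Pow ?N. (- v) ^ card J * (branch_coeff k m \<zeta> d * (dual_coeff s ?N J (pt d) *
        (\<Prod>j=1..k. 1 - u * shift h J (pt d) j) * Psi k (up J d) \<zeta>)))" for d
  proof -
    have "(\<Sum>I\<in>Pow ?N. (shift_coeff k u \<zeta> I * (\<Prod>i=1..k. 1 - v * shift h I \<zeta> i)) * (branch_coeff k m \<zeta> d * F I d)) =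
      branch_coeff k m \<zeta> d * (\<Sum>I\<in>Pow ?N. shift_coeff k u \<zeta> I * (\<Prod>i\<in>?N. 1 - v * shift h I \<zeta> i) * F I d)"
      unfolding sum_distrib_left by (simp only: mult_ac)
    also have "\<dots> = (\<Sum>J\<in>Pow ?N. (- v) ^ card J * (branch_coeff k m \<zeta> d * (dual_coeff s ?N J (pt d) *
        (\<Prod>j=1..k. 1 - u * shift h J (pt d) j) * Psi k (up J d) \<zeta>)))"
      unfolding ref F0 sum_distrib_left by (simp only: mult_ac)
    finally show ?thesis .
  qed
  moreover have "((\<lambda>d. \<Sum>J\<in>Pow ?N. (- v) ^ card J * (branch_coeff k m \<zeta> d * (dual_coeff s ?N J (pt d) *
        (\<Prod>j=1..k. 1 - u * shift h J (pt d) j) * Psi k (up J d) \<zeta>))) has_sum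
      (\<Sum>J\<in>Pow ?N. (- v) ^ card J * infsum (g J) (lattice k))) (lattice k)"
    by (intro has_sum_finite_sum has_sum_cmult_right sh) auto
  ultimately have eq: "(\<Sum>I\<in>Pow ?N. (shift_coeff k u \<zeta> I * (\<Prod>i=1..k. 1 - v * shift h I \<zeta> i)) * Psi (Suc k) m (shift q I \<zeta>)) =
      (\<Sum>J\<in>Pow ?N. (- v) ^ card J * infsum (g J) (lattice k))"
    using has_sum_unique by fastforce
  have "((\<lambda>e. \<Sum>J\<in>Pow ?N. (- v) ^ card J * g J e) has_sum
      (\<Sum>J\<in>Pow ?N. (- v) ^ card J * infsum (g J) (lattice k))) (lattice k)"
    by (intro has_sum_finite_sum has_sum_cmult_right has_sum_infsum sh(2)) auto
  moreover have "(\<Sum>J\<in>Pow ?N. (- v) ^ card J * g J e) =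
    branch_coeff k m \<zeta> e * Psi k e \<zeta> * (\<Sum>J\<in>Pow ?N. (- v * s * \<zeta> (Suc k)) ^ card J *
        kernel_weight_right s {1..Suc k} ?N (pt m) (pt e) J * (\<Prod>j=1..k. 1 - u * shift s J (pt e) j))" for e
    unfolding g_def sum_distrib_left mult.assoc[of "- v"] power_mult_distrib[of "- v"] by (simp only: mult_ac)
  ultimately show ?thesis unfolding eq by simp
qed

text \<open>
  The Vandermonde ratio of rank \<open>k + 1\<close>, multiplied by \<open>\<Prod>\<^sub>i (1 - \<zeta>\<^sub>i / \<zeta>\<^sub>k\<^sub>+\<^sub>1)\<close>, is that of rank \<open>k\<close> times
  the refining factor, at \<open>v = 1 / \<zeta>\<^sub>k\<^sub>+\<^sub>1\<close> if the last variable is not shifted, and at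
  \<open>v = 1 / (h \<zeta>\<^sub>k\<^sub>+\<^sub>1)\<close> if it is.
\<close>
lemma shift_coeff_Suc:
  assumes I: "I \<subseteq> {1..k}" and z: "\<zeta> (Suc k) \<noteq> 0" "\<And>i. i \<in> {1..k} \<Longrightarrow> \<zeta> i \<noteq> \<zeta> (Suc k)"
  shows "(\<Prod>i=1..k. 1 - 1 / \<zeta> (Suc k) * \<zeta> i) * shift_coeff (Suc k) u \<zeta> I =
      shift_coeff k u \<zeta> I * (\<Prod>i=1..k. 1 - 1 / \<zeta> (Suc k) * shift h I \<zeta> i)" (is ?th1)
    and "(\<Prod>i=1..k. 1 - 1 / \<zeta> (Suc k) * \<zeta> i) * shift_coeff (Suc k) u \<zeta> (insert (Suc k) I) =
      - (u * \<alpha> (Suc k)) * (shift_coeff k u \<zeta> I * (\<Prod>i=1..k. 1 - 1 / (h * \<zeta> (Suc k)) * shift h I \<zeta> i))" (is ?th2)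
proof -
  let ?z = "\<zeta> (Suc k)" and ?N = "{1..k}"
  have K: "{1..Suc k} = insert (Suc k) ?N" by auto
  have finI: "finite I" and nI: "Suc k \<notin> I" using I finite_subset by auto
  have E: "(1 - 1 / ?z * \<zeta> i) * ((x - y) / (\<zeta> i - ?z)) = y / ?z - 1 / ?z * x" if "i \<in> ?N" for i x y
  proof -
    have "1 - 1 / ?z * \<zeta> i = - (\<zeta> i - ?z) / ?z" using z(1) by (simp add: field_simps)
    moreover have "\<zeta> i - ?z \<noteq> 0" using z(2)[OF that] by simp
    moreover have "w \<noteq> 0 \<Longrightarrow> (- w / ?z) * ((x - y) / w) = - (x - y) / ?z" for w
      using z(1) by (simp add: field_simps)
    ultimately have "(1 - 1 / ?z * \<zeta> i) * ((x - y) / (\<zeta> i - ?z)) = - (x - y) / ?z" by (simp only:)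
    then show ?thesis by (simp add: diff_divide_distrib)
  qed
  have v1: "vandermonde_ratio {1..Suc k} (shift h I \<zeta>) \<zeta> = vandermonde_ratio ?N (shift h I \<zeta>) \<zeta> *
      (\<Prod>i\<in>?N. (shift h I \<zeta> i - ?z) / (\<zeta> i - ?z))"
    unfolding K using nI by (subst vandermonde_ratio_insert) auto
  have v2: "vandermonde_ratio {1..Suc k} (shift h (insert (Suc k) I) \<zeta>) \<zeta> = vandermonde_ratio ?N (shift h I \<zeta>) \<zeta> *
      (\<Prod>i\<in>?N. (shift h I \<zeta> i - h * ?z) / (\<zeta> i - ?z))"
  proof -
    have "vandermonde_ratio ?N (shift h (insert (Suc k) I) \<zeta>) \<zeta> = vandermonde_ratio ?N (shift h I \<zeta>) \<zeta>"
      by (intro vandermonde_ratio_cong) auto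
    moreover have "(\<Prod>i\<in>?N. (shift h (insert (Suc k) I) \<zeta> i - h * ?z) / (\<zeta> i - ?z)) =
      (\<Prod>i\<in>?N. (shift h I \<zeta> i - h * ?z) / (\<zeta> i - ?z))"
      by (intro prod.cong refl) auto
    ultimately show ?thesis unfolding K by (subst vandermonde_ratio_insert) auto
  qed
  have p1: "(\<Prod>i=1..k. 1 - 1 / ?z * \<zeta> i) * (\<Prod>i\<in>?N. (shift h I \<zeta> i - ?z) / (\<zeta> i - ?z)) =
      (\<Prod>i=1..k. 1 - 1 / ?z * shift h I \<zeta> i)"
    unfolding prod.distrib[symmetric] using z(1) by (intro prod.cong refl) (simp only: E, simp)
  have p2: "(\<Prod>i=1..k. 1 - 1 / ?z * \<zeta> i) * (\<Prod>i\<in>?N. (shift h I \<zeta> i - h * ?z) / (\<zeta> i - ?z)) =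
      h ^ k * (\<Prod>i=1..k. 1 - 1 / (h * ?z) * shift h I \<zeta> i)"
  proof -
    have "h ^ k = (\<Prod>i\<in>?N. h)" by simp
    then show ?thesis
      unfolding prod.distrib[symmetric]
      using z(1) h0 by (simp only: prod.distrib[symmetric]) (intro prod.cong refl, simp only: E, simp add: field_simps)
  qed
  have c: "h ^ k * c (Suc k) = \<alpha> (Suc k)"
    using h0 by (simp add: c_def power_int_minus)
  show ?th1 unfolding shift_coeff_def v1 p1[symmetric] by (simp only: mult_ac)
  have "(\<Prod>i=1..k. 1 - 1 / ?z * \<zeta> i) * shift_coeff (Suc k) u \<zeta> (insert (Suc k) I) =
    (- u) ^ card I * (- u) * (vandermonde_ratio ?N (shift h I \<zeta>) \<zeta> *
    ((\<Prod>i=1..k. 1 - 1 / ?z * \<zeta> i) * (\<Prod>i\<in>?N. (shift h I \<zeta> i - h * ?z) / (\<zeta> i - ?z)))) * (c (Suc k) * (\<Prod>i\<in>I. c i))"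
    unfolding shift_coeff_def v2 using finI nI by (simp add: mult_ac)
  also have "\<dots> = - (u * (h ^ k * c (Suc k))) * (shift_coeff k u \<zeta> I * (\<Prod>i=1..k. 1 - 1 / (h * ?z) * shift h I \<zeta> i))"
    unfolding p2 shift_coeff_def by (simp add: mult_ac)
  finally show ?th2 unfolding c .
qed

text \<open>
  The induction step compares three branching sums given by \<open>refined_branching\<close>: those of the subsets
  without and with \<open>k + 1\<close>, and the one that represents \<open>\<Psi>\<^sub>k\<^sub>+\<^sub>1\<close> itself (\<open>u = 0\<close>). At each lattice point
  \<open>e\<close> their summands satisfy the linear relation of the unbalanced alternating sum. Its extra factor
  \<open>1 - u \<Prod> a / \<Prod> b\<close> accounts for the subsets that contain \<open>k + 1\<close>, since for them
  \<open>\<zeta>\<^sub>k\<^sub>+\<^sub>1\<^bsup>|m|-|e|\<^esup>\<close> acquires the factor \<open>q\<^bsup>|m|-|e|\<^esup>\<close>, the lattice part of \<open>\<Prod> a / \<Prod> b\<close>.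
\<close>
theorem eigenvalue_equation:
  assumes "k \<le> p" "\<And>I. I \<subseteq> {1..k} \<Longrightarrow> converges k (shift q I \<zeta>)"
    and "\<And>i. i \<in> {1..k} \<Longrightarrow> \<zeta> i \<noteq> 0"
    and "\<And>i j. i \<in> {1..k} \<Longrightarrow> j \<in> {1..k} \<Longrightarrow> i \<noteq> j \<Longrightarrow> \<zeta> i \<noteq> \<zeta> j"
  shows "eigen_equation k u \<zeta>"
  using assms
proof (induction k)
  case 0
  show ?case
    by (simp add: eigen_equation_def shift_coeff_def vandermonde_ratio_def ordered_pairs_def)
next
  case (Suc k)
  let ?N = "{1..k}" and ?K = "{1..Suc k}" and ?z = "\<zeta> (Suc k)"
  note k = Suc.prems(1) and conv = Suc.prems(2) and nz = Suc.prems(3) and dist = Suc.prems(4)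
  have IH: "eigen_equation k u \<zeta>"
  proof (rule Suc.IH)
    fix I assume "I \<subseteq> ?N"
    then have "I \<subseteq> ?K" by auto
    then show "converges k (shift q I \<zeta>)" by (rule converges_Suc[OF conv])
  qed (use k nz dist in auto)
  \<comment> \<open>The subsets containing \<open>Suc k\<close> are treated as subsets of \<open>{1..k}\<close>, with \<open>\<zeta>'\<close> in place of \<open>\<zeta>\<close>.\<close>
  define \<zeta>' where "\<zeta>' = shift q {Suc k} \<zeta>"
  have z: "?z \<noteq> 0" using nz by simp
  have z': "\<zeta>' (Suc k) = q * ?z" by (simp add: \<zeta>'_def)
  have agree: "\<zeta>' i = \<zeta> i" if "i \<in> ?N" for i using that by (auto simp: \<zeta>'_def)
  have sh': "shift q I \<zeta>' = shift q (insert (Suc k) I) \<zeta>" if "I \<subseteq> ?N" for I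
    unfolding \<zeta>'_def using that by (subst shift_disjoint_union) auto
  define E where "E = (\<Prod>i=1..k. 1 - 1 / ?z * \<zeta> i)"
  have E0: "E \<noteq> 0"
    unfolding E_def using dist z by (auto simp: field_simps)
  have "eigen_equation (Suc k) u \<zeta> \<longleftrightarrow> (\<forall>m. (\<Sum>I\<in>Pow ?K. shift_coeff (Suc k) u \<zeta> I * Psi (Suc k) m (shift q I \<zeta>)) =
     (\<Prod>i=1..Suc k. 1 - u * pt m i) * Psi (Suc k) m \<zeta>)" by (simp add: eigen_equation_def)
  also have "\<dots>"
  proof
    fix m
    define W where "W e J = kernel_weight_right s ?K ?N (pt m) (pt e) J" for e J
    define Q where "Q e J = (\<Prod>j=1..k. 1 - u * shift s J (pt e) j)" for e J
    define \<Lambda> where "\<Lambda> = (\<Prod>i=1..Suc k. 1 - u * pt m i)"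
    define T where "T e = branch_coeff k m \<zeta> e * Psi k e \<zeta>" for e
    define \<beta> where "\<beta> e = \<alpha> (Suc k) * q powi (tot (Suc k) m - tot k e)" for e
    \<comment> \<open>The factor \<open>- v s \<zeta>\<^sub>k\<^sub>+\<^sub>1\<close> of \<open>refined_branching\<close> at the two values of \<open>v\<close>. In the second case the
        last variable is \<open>q \<zeta>\<^sub>k\<^sub>+\<^sub>1\<close>.\<close>
    have e1: "- (1 / ?z) * s * ?z = - s" using z by simp
    have e2: "- (1 / (h * ?z)) * s * (q * ?z) = - 1" using z q0 h0 by (simp add: s_def)
    have conv0: "converges (Suc k) (shift q I \<zeta>)" if "I \<subseteq> ?N" for I using that by (intro conv) auto
    have P1: "((\<lambda>e. T e * (\<Sum>J\<in>Pow ?N. (- s) ^ card J * W e J * Q e J)) has_sum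
        (\<Sum>I\<in>Pow ?N. shift_coeff k u \<zeta> I * (\<Prod>i=1..k. 1 - 1 / ?z * shift h I \<zeta> i) * Psi (Suc k) m (shift q I \<zeta>))) (lattice k)"
      using refined_branching[OF k conv0 nz IH, of m "1 / ?z"]
      unfolding e1 T_def W_def Q_def by simp
    have IH': "eigen_equation k u \<zeta>'" using IH eigen_equation_cong[of k \<zeta>' \<zeta> u] agree by blast
    have nz': "\<zeta>' i \<noteq> 0" if "i \<in> ?K" for i using nz[OF that] q0 by (auto simp: \<zeta>'_def shift_def)
    have conv': "converges (Suc k) (shift q I \<zeta>')" if "I \<subseteq> ?N" for I
      unfolding sh'[OF that] using that by (intro conv) auto
    have bc: "branch_coeff k m \<zeta>' e * Psi k e \<zeta>' = T e * q powi (tot (Suc k) m - tot k e)" for e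
      using Psi_cong_zeta[of k \<zeta>' \<zeta> e] agree
      by (simp add: branch_coeff_def T_def z' power_int_mult_distrib)
    have P2: "((\<lambda>e. T e * q powi (tot (Suc k) m - tot k e) * (\<Sum>J\<in>Pow ?N. (- 1) ^ card J * W e J * Q e J)) has_sum
        (\<Sum>I\<in>Pow ?N. shift_coeff k u \<zeta> I * (\<Prod>i=1..k. 1 - 1 / (h * ?z) * shift h I \<zeta> i) *
           Psi (Suc k) m (shift q (insert (Suc k) I) \<zeta>))) (lattice k)"
    proof -
      have "(\<Sum>I\<in>Pow ?N. shift_coeff k u \<zeta>' I * (\<Prod>i=1..k. 1 - 1 / (h * ?z) * shift h I \<zeta>' i) * Psi (Suc k) m (shift q I \<zeta>')) =
        (\<Sum>I\<in>Pow ?N. shift_coeff k u \<zeta> I * (\<Prod>i=1..k. 1 - 1 / (h * ?z) * shift h I \<zeta> i) *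
           Psi (Suc k) m (shift q (insert (Suc k) I) \<zeta>))"
      proof (rule sum.cong[OF refl])
        fix I assume I: "I \<in> Pow ?N"
        have "(\<Prod>i=1..k. 1 - 1 / (h * ?z) * shift h I \<zeta>' i) = (\<Prod>i=1..k. 1 - 1 / (h * ?z) * shift h I \<zeta> i)"
          using agree by (intro prod.cong) (auto simp: shift_def)
        moreover have "shift_coeff k u \<zeta>' I = shift_coeff k u \<zeta> I"
          using I agree by (intro shift_coeff_cong) auto
        ultimately show "shift_coeff k u \<zeta>' I * (\<Prod>i=1..k. 1 - 1 / (h * ?z) * shift h I \<zeta>' i) * Psi (Suc k) m (shift q I \<zeta>') =
          shift_coeff k u \<zeta> I * (\<Prod>i=1..k. 1 - 1 / (h * ?z) * shift h I \<zeta> i) * Psi (Suc k) m (shift q (insert (Suc k) I) \<zeta>)"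
          using sh' I by simp
      qed
      then show ?thesis
        using refined_branching[OF k conv' nz' IH', of m "1 / (h * ?z)"]
        unfolding z' e2 bc W_def Q_def by simp
    qed
    have P3: "((\<lambda>e. T e * (\<Sum>J\<in>Pow ?N. (- s) ^ card J * W e J)) has_sum E * Psi (Suc k) m \<zeta>) (lattice k)"
    proof -
      have dk: "\<zeta> i \<noteq> \<zeta> j" if "i \<in> ?N" "j \<in> ?N" "i \<noteq> j" for i j using dist that by auto
      note triv = eigen_equation_trivial[OF dk]
      have "(\<Sum>I\<in>Pow ?N. shift_coeff k 0 \<zeta> I * (\<Prod>i=1..k. 1 - 1 / ?z * shift h I \<zeta> i) * Psi (Suc k) m (shift q I \<zeta>)) =
        (\<Sum>I\<in>{{}}. shift_coeff k 0 \<zeta> I * (\<Prod>i=1..k. 1 - 1 / ?z * shift h I \<zeta> i) * Psi (Suc k) m (shift q I \<zeta>))"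
        using triv(2) by (intro sum.mono_neutral_right) auto
      also have "\<dots> = E * Psi (Suc k) m \<zeta>" using triv(1) by (simp add: E_def)
      finally have eq: "(\<Sum>I\<in>Pow ?N. shift_coeff k 0 \<zeta> I * (\<Prod>i=1..k. 1 - 1 / ?z * shift h I \<zeta> i) * Psi (Suc k) m (shift q I \<zeta>)) =
        E * Psi (Suc k) m \<zeta>" .
      show ?thesis
        using refined_branching[OF k conv0 nz triv(3), of m "1 / ?z"]
        unfolding e1 T_def W_def eq by simp
    qed
    have alt: "(\<Sum>J\<in>Pow ?N. (- s) ^ card J * W e J * Q e J) - u * \<beta> e * (\<Sum>J\<in>Pow ?N. (- 1) ^ card J * W e J * Q e J) =
        \<Lambda> * (\<Sum>J\<in>Pow ?N. (- s) ^ card J * W e J)" for e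
    proof -
      have sub: "?K \<subseteq> {1..p}" "?N \<subseteq> {1..p}" using k by auto
      have "(\<Sum>J\<in>Pow ?N. (- s) ^ card J * W e J * ((\<Prod>i\<in>?N. 1 - u * shift s J (pt e) i) *
          (1 - u * ((\<Prod>k\<in>?K. pt m k) / (\<Prod>i\<in>?N. shift s J (pt e) i))) - (\<Prod>k\<in>?K. 1 - u * pt m k))) = 0"
        unfolding W_def
      proof (rule alternating_sum_unbalanced')
        show "finite ?K" "finite ?N" "card ?K = Suc (card ?N)" "s \<noteq> 0" by (simp_all add: s0)
        show "pt e i \<noteq> pt e i' \<and> pt e i \<noteq> s * pt e i'" if "i \<in> ?N" "i' \<in> ?N" "i \<noteq> i'" for i i'
          using that pt_separated sub by blast
        show "pt m i \<noteq> s * pt e i'" if "i \<in> ?K" "i' \<in> ?N" for i i'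
          using that pt_s sub by blast
        show "pt e i \<noteq> 0" if "i \<in> ?N" for i using that pt_nonzero sub by blast
      qed
      moreover have "(- s) ^ card J * W e J * ((\<Prod>i\<in>?N. 1 - u * shift s J (pt e) i) *
          (1 - u * ((\<Prod>k\<in>?K. pt m k) / (\<Prod>i\<in>?N. shift s J (pt e) i))) - (\<Prod>k\<in>?K. 1 - u * pt m k)) =
        (- s) ^ card J * W e J * Q e J - u * \<beta> e * ((- 1) ^ card J * W e J * Q e J) - \<Lambda> * ((- s) ^ card J * W e J)"
        if J: "J \<in> Pow ?N" for J
      proof -
        have "(\<Prod>i\<in>?N. shift s J (pt e) i) = (\<Prod>i\<in>?N. (if i \<in> J then s else 1) * pt e i)"
          by (intro prod.cong) (auto simp: shift_def)
        also have "\<dots> = s ^ card J * (\<Prod>i\<in>?N. pt e i)"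
          using J by (simp add: prod.distrib prod.If_cases Int_absorb1)
        finally have 1: "(\<Prod>i\<in>?N. shift s J (pt e) i) = s ^ card J * (\<Prod>i\<in>?N. pt e i)" .
        have qs: "(\<Prod>i\<in>S. q powi f i) = q powi (\<Sum>i\<in>S. f i)" if "finite S" for S :: "nat set" and f
          using that q0 by (induction S rule: finite_induct) (auto simp: power_int_add)
        have \<alpha>nz: "(\<Prod>i\<in>?N. \<alpha> i) \<noteq> 0" using \<alpha>0 sub by (auto simp: subset_iff)
        have "(\<Prod>k\<in>?K. pt m k) = (\<Prod>i\<in>?N. \<alpha> i) * \<alpha> (Suc k) * q powi tot (Suc k) m"
        proof -
          have "(\<Prod>k\<in>?K. pt m k) = (\<Prod>i\<in>?K. \<alpha> i) * (\<Prod>i\<in>?K. q powi m i)" unfolding pt_def prod.distrib ..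
          also have "(\<Prod>i\<in>?K. q powi m i) = q powi tot (Suc k) m" unfolding tot_def by (rule qs) simp
          also have "(\<Prod>i\<in>?K. \<alpha> i) = (\<Prod>i\<in>?N. \<alpha> i) * \<alpha> (Suc k)" by simp
          finally show ?thesis .
        qed
        moreover have "(\<Prod>i\<in>?N. pt e i) = (\<Prod>i\<in>?N. \<alpha> i) * q powi tot k e"
          unfolding pt_def prod.distrib tot_def by (subst qs) auto
        ultimately have 2: "(\<Prod>k\<in>?K. pt m k) / (s ^ card J * (\<Prod>i\<in>?N. pt e i)) = \<beta> e / s ^ card J"
          using \<alpha>nz q0 by (simp add: \<beta>_def power_int_diff)
        have 3: "(- s) ^ card J = (- 1) ^ card J * s ^ card J" by (rule power_minus)
        have 4: "s ^ card J \<noteq> 0" using s0 by simp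
        show ?thesis
          unfolding 1 2 Q_def[symmetric] \<Lambda>_def[symmetric] 3 using s0 by (simp add: field_simps)
      qed
      ultimately have "(\<Sum>J\<in>Pow ?N. (- s) ^ card J * W e J * Q e J - u * \<beta> e * ((- 1) ^ card J * W e J * Q e J) - \<Lambda> * ((- s) ^ card J * W e J)) = 0"
        by simp
      then show ?thesis unfolding sum_subtractf sum_distrib_left[symmetric] by simp
    qed
    define X1 where "X1 = (\<Sum>I\<in>Pow ?N. shift_coeff k u \<zeta> I * (\<Prod>i=1..k. 1 - 1 / ?z * shift h I \<zeta> i) * Psi (Suc k) m (shift q I \<zeta>))"
    define X2 where "X2 = (\<Sum>I\<in>Pow ?N. shift_coeff k u \<zeta> I * (\<Prod>i=1..k. 1 - 1 / (h * ?z) * shift h I \<zeta> i) *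
           Psi (Suc k) m (shift q (insert (Suc k) I) \<zeta>))"
    have "((\<lambda>e. T e * (\<Sum>J\<in>Pow ?N. (- s) ^ card J * W e J * Q e J) +
        (- (u * \<alpha> (Suc k))) * (T e * q powi (tot (Suc k) m - tot k e) * (\<Sum>J\<in>Pow ?N. (- 1) ^ card J * W e J * Q e J)))
        has_sum (X1 + (- (u * \<alpha> (Suc k))) * X2)) (lattice k)"
      unfolding X1_def X2_def by (intro has_sum_add P1 has_sum_cmult_right P2)
    moreover have "T e * (\<Sum>J\<in>Pow ?N. (- s) ^ card J * W e J * Q e J) +
        (- (u * \<alpha> (Suc k))) * (T e * q powi (tot (Suc k) m - tot k e) * (\<Sum>J\<in>Pow ?N. (- 1) ^ card J * W e J * Q e J)) =
        \<Lambda> * (T e * (\<Sum>J\<in>Pow ?N. (- s) ^ card J * W e J))" for e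
    proof -
      have "T e * (\<Sum>J\<in>Pow ?N. (- s) ^ card J * W e J * Q e J) +
        (- (u * \<alpha> (Suc k))) * (T e * q powi (tot (Suc k) m - tot k e) * (\<Sum>J\<in>Pow ?N. (- 1) ^ card J * W e J * Q e J)) =
        T e * ((\<Sum>J\<in>Pow ?N. (- s) ^ card J * W e J * Q e J) - u * \<beta> e * (\<Sum>J\<in>Pow ?N. (- 1) ^ card J * W e J * Q e J))"
        by (simp add: \<beta>_def right_diff_distrib mult_ac)
      then show ?thesis unfolding alt by (simp add: mult_ac)
    qed
    moreover have "((\<lambda>e. \<Lambda> * (T e * (\<Sum>J\<in>Pow ?N. (- s) ^ card J * W e J))) has_sum \<Lambda> * (E * Psi (Suc k) m \<zeta>)) (lattice k)"
      by (intro has_sum_cmult_right P3)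
    ultimately have X: "X1 + (- (u * \<alpha> (Suc k))) * X2 = \<Lambda> * (E * Psi (Suc k) m \<zeta>)"
      using has_sum_unique by fastforce
    have K: "?K = insert (Suc k) ?N" by auto
    have "E * (\<Sum>I\<in>Pow ?K. shift_coeff (Suc k) u \<zeta> I * Psi (Suc k) m (shift q I \<zeta>)) =
      E * (\<Sum>I\<in>Pow ?N. shift_coeff (Suc k) u \<zeta> I * Psi (Suc k) m (shift q I \<zeta>) +
        shift_coeff (Suc k) u \<zeta> (insert (Suc k) I) * Psi (Suc k) m (shift q (insert (Suc k) I) \<zeta>))"
      unfolding K by (subst sum_Pow_insert) auto
    also have "\<dots> = (\<Sum>I\<in>Pow ?N. (E * shift_coeff (Suc k) u \<zeta> I) * Psi (Suc k) m (shift q I \<zeta>)) +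
        (\<Sum>I\<in>Pow ?N. (E * shift_coeff (Suc k) u \<zeta> (insert (Suc k) I)) * Psi (Suc k) m (shift q (insert (Suc k) I) \<zeta>))"
      by (simp add: sum_distrib_left sum.distrib distrib_left mult_ac)
    also have "(\<Sum>I\<in>Pow ?N. (E * shift_coeff (Suc k) u \<zeta> I) * Psi (Suc k) m (shift q I \<zeta>)) = X1"
      unfolding X1_def E_def using z dist by (intro sum.cong refl) (subst shift_coeff_Suc(1), auto)
    also have "(\<Sum>I\<in>Pow ?N. (E * shift_coeff (Suc k) u \<zeta> (insert (Suc k) I)) * Psi (Suc k) m (shift q (insert (Suc k) I) \<zeta>)) =
        (\<Sum>I\<in>Pow ?N. (- (u * \<alpha> (Suc k))) * (shift_coeff k u \<zeta> I * (\<Prod>i=1..k. 1 - 1 / (h * ?z) * shift h I \<zeta> i) *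
           Psi (Suc k) m (shift q (insert (Suc k) I) \<zeta>)))"
      unfolding E_def using z dist by (intro sum.cong refl) (subst shift_coeff_Suc(2), auto)
    also have "\<dots> = (- (u * \<alpha> (Suc k))) * X2" unfolding X2_def sum_distrib_left ..
    also have "X1 + (- (u * \<alpha> (Suc k))) * X2 = E * (\<Lambda> * Psi (Suc k) m \<zeta>)" unfolding X by (simp only: mult_ac)
    finally show "(\<Sum>I\<in>Pow ?K. shift_coeff (Suc k) u \<zeta> I * Psi (Suc k) m (shift q I \<zeta>)) =
       (\<Prod>i=1..Suc k. 1 - u * pt m i) * Psi (Suc k) m \<zeta>"
      using E0 unfolding \<Lambda>_def mult_cancel_left by blast
  qed
  finally show ?case .
qed

end

section \<open>The vertex function as a sum over arrays\<close>

text \<open>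
  Degrees of the vertex are natural numbers, zero outside the triangle, and their columns are numbered
  by the enumeration \<open>x\<close> of the fixed point. Arrays are extensional and integral, and their columns
  are numbered by the \<open>\<alpha>\<^sub>l\<close>. The bijections \<open>\<pi> i\<close> translate between the two numberings of row \<open>i\<close>.
\<close>
definition nat_arrays :: "nat \<Rightarrow> (nat \<Rightarrow> nat \<Rightarrow> nat) set" where
  "nat_arrays n = {d. \<forall>i j. \<not> (1 \<le> j \<and> j \<le> i \<and> i < n) \<longrightarrow> d i j = 0}"

definition to_array :: "nat \<Rightarrow> (nat \<Rightarrow> nat \<Rightarrow> nat) \<Rightarrow> (nat \<Rightarrow> nat \<Rightarrow> nat) \<Rightarrow> nat \<Rightarrow> nat \<Rightarrow> int" where
  "to_array n \<pi> d = restrict (\<lambda>i. restrict (\<lambda>l. int (d i (inv_into {1..i} (\<pi> i) l))) {1..i}) {..<n}"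

lemma to_array_apply:
  assumes "bij_betw (\<pi> i) {1..i} {1..i}" "i < n" "j \<in> {1..i}"
  shows "to_array n \<pi> d i (\<pi> i j) = int (d i j)"
proof -
  have "\<pi> i j \<in> {1..i}" using assms bij_betwE by blast
  moreover have "inv_into {1..i} (\<pi> i) (\<pi> i j) = j"
    using assms by (intro inv_into_f_f) (auto simp: bij_betw_def)
  ultimately show ?thesis using assms(2) by (simp add: to_array_def)
qed

lemma bij_to_array:
  assumes \<pi>: "\<And>i. i \<in> {1..n} \<Longrightarrow> bij_betw (\<pi> i) {1..i} {1..i}"
  shows "bij_betw (to_array n \<pi>) (nat_arrays n) {D\<in>arrays n. \<forall>i<n. \<forall>l\<in>{1..i}. D i l \<ge> 0}"
proof (rule bij_betwI[where g = "\<lambda>D i j. if 1 \<le> j \<and> j \<le> i \<and> i < n then nat (D i (\<pi> i j)) else 0"])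
  show "to_array n \<pi> \<in> nat_arrays n \<rightarrow> {D\<in>arrays n. \<forall>i<n. \<forall>l\<in>{1..i}. D i l \<ge> 0}"
    by (auto simp: to_array_def arrays_def lattice_def)
  show "(\<lambda>D i j. if 1 \<le> j \<and> j \<le> i \<and> i < n then nat (D i (\<pi> i j)) else 0) \<in>
      {D\<in>arrays n. \<forall>i<n. \<forall>l\<in>{1..i}. D i l \<ge> 0} \<rightarrow> nat_arrays n"
    by (auto simp: nat_arrays_def)
next
  fix d assume d: "d \<in> nat_arrays n"
  show "(\<lambda>i j. if 1 \<le> j \<and> j \<le> i \<and> i < n then nat (to_array n \<pi> d i (\<pi> i j)) else 0) = d"
  proof (intro ext)
    fix i j
    show "(if 1 \<le> j \<and> j \<le> i \<and> i < n then nat (to_array n \<pi> d i (\<pi> i j)) else 0) = d i j"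
    proof (cases "1 \<le> j \<and> j \<le> i \<and> i < n")
      case True
      then have "to_array n \<pi> d i (\<pi> i j) = int (d i j)"
        using \<pi>[of i] by (intro to_array_apply) auto
      then show ?thesis using True by simp
    next
      case False
      then have "d i j = 0" using d unfolding nat_arrays_def by blast
      then show ?thesis using False by (simp only: if_False)
    qed
  qed
next
  fix D assume D: "D \<in> {D\<in>arrays n. \<forall>i<n. \<forall>l\<in>{1..i}. D i l \<ge> 0}"
  let ?d = "\<lambda>i j. if 1 \<le> j \<and> j \<le> i \<and> i < n then nat (D i (\<pi> i j)) else 0"
  show "to_array n \<pi> ?d = D"
  proof (intro ext)
    fix i l
    show "to_array n \<pi> ?d i l = D i l"
    proof (cases "i < n")
      case False
      then show ?thesis using D by (auto simp: to_array_def arrays_def PiE_def extensional_def)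
    next
      case i: True
      show ?thesis
      proof (cases "l \<in> {1..i}")
        case False
        have "D i \<in> lattice i" using D i by (auto simp: arrays_def)
        then have "D i l = undefined" using False unfolding lattice_def by (rule PiE_arb)
        then show ?thesis using False i by (auto simp: to_array_def)
      next
        case True
        then have bij: "bij_betw (\<pi> i) {1..i} {1..i}" using \<pi>[of i] i by auto
        then have j: "inv_into {1..i} (\<pi> i) l \<in> {1..i}" "\<pi> i (inv_into {1..i} (\<pi> i) l) = l"
          using True by (auto simp: bij_betw_def intro: f_inv_into_f inv_into_into simp del: atLeastAtMost_iff)
        have "D i l \<ge> 0" using D i True by auto
        then show ?thesis using i True j by (auto simp: to_array_def)
      qed
    qed
  qed
qed

context trs
begin

lemma qpoch_ratio:
  "qpoch (q * X) q N / qpoch (h * X) q N = omega X / omega (q powi N * X)"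
  "qpoch (h * X) q N / qpoch (q * X) q N = omega (q powi N * X) / omega X"
proof -
  have *: "q powi N * (q * X) = q * (q powi N * X)" "q powi N * (h * X) = h * (q powi N * X)" by simp_all
  show "qpoch (q * X) q N / qpoch (h * X) q N = omega X / omega (q powi N * X)"
    "qpoch (h * X) q N / qpoch (q * X) q N = omega (q powi N * X) / omega X"
    unfolding qpoch_def omega_def * by simp_all
qed

text \<open>
  The array completed by the zero row \<open>p\<close>, which stands for \<open>d\<^sub>n\<^sub>,\<^sub>k = 0\<close>.
\<close>
definition row :: "(nat \<Rightarrow> nat \<Rightarrow> int) \<Rightarrow> nat \<Rightarrow> nat \<Rightarrow> int" where
  "row D i = (if i = p then (\<lambda>_. 0) else D i)"

lemma array_term_prod:
  "array_term k m \<zeta> D = (\<Prod>i<k. branch_coeff i (if Suc i = k then m else D (Suc i)) \<zeta> (D i))"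
proof (induction k arbitrary: m)
  case (Suc k)
  have "(\<Prod>i<k. branch_coeff i (if Suc i = k then D k else D (Suc i)) \<zeta> (D i)) =
    (\<Prod>i<k. branch_coeff i (if Suc i = Suc k then m else D (Suc i)) \<zeta> (D i))"
    by (intro prod.cong) auto
  then show ?case by (simp add: Suc.IH)
qed simp

lemma array_term_row:
  "array_term p (\<lambda>_. 0) \<zeta> D = (\<Prod>i<p. branch_coeff i (row D (Suc i)) \<zeta> (row D i))"
  unfolding array_term_prod row_def by (intro prod.cong) auto

text \<open>
  Nonzero terms have entries that weakly decrease towards the zero row \<open>p\<close>.
\<close>
lemma array_term_support:
  assumes "array_term p (\<lambda>_. 0) \<zeta> D \<noteq> 0"
  shows "i < p \<Longrightarrow> l \<in> {1..i} \<Longrightarrow> row D (Suc i) l \<le> row D i l"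
    and "i \<le> p \<Longrightarrow> l \<in> {1..i} \<Longrightarrow> 0 \<le> row D i l"
proof -
  show *: "row D (Suc i) l \<le> row D i l" if "i < p" "l \<in> {1..i}" for i l
  proof (rule ccontr)
    assume "\<not> ?thesis"
    then have "branch_coeff i (row D (Suc i)) \<zeta> (row D i) = 0"
      using that by (intro branch_coeff_zero[of l]) auto
    then show False using assms that unfolding array_term_row by (auto simp: prod_zero_iff)
  qed
  show "0 \<le> row D i l" if "i \<le> p" "l \<in> {1..i}"
    using that
  proof (induction i rule: inc_induct)
    case base
    then show ?case by (simp add: row_def)
  next
    case (step i)
    then show ?case using *[of i l] by auto
  qed
qed

text \<open>
  Summation by parts turns the powers of single variables in the branching coefficients into powers of
  the ratios \<open>\<zeta>\<^sub>i / \<zeta>\<^sub>i\<^sub>+\<^sub>1\<close>.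
\<close>
lemma monomial_telescope:
  fixes E :: "nat \<Rightarrow> int"
  assumes "E 0 = 0" "\<And>i. i \<in> {1..Suc k} \<Longrightarrow> \<zeta> i \<noteq> 0"
  shows "(\<Prod>i<Suc k. t powi E i * \<zeta> (Suc i) powi (E (Suc i) - E i)) =
    \<zeta> (Suc k) powi E (Suc k) * (\<Prod>i=1..k. (t * (\<zeta> i / \<zeta> (Suc i))) powi E i)"
  using assms(2)
proof (induction k)
  case 0
  then show ?case using assms(1) by simp
next
  case (Suc k)
  have nz: "\<zeta> (Suc k) \<noteq> 0" "\<zeta> (Suc (Suc k)) \<noteq> 0" using Suc.prems by auto
  have "(\<Prod>i<Suc (Suc k). t powi E i * \<zeta> (Suc i) powi (E (Suc i) - E i)) =
    \<zeta> (Suc k) powi E (Suc k) * (\<Prod>i=1..k. (t * (\<zeta> i / \<zeta> (Suc i))) powi E i) *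
    (t powi E (Suc k) * \<zeta> (Suc (Suc k)) powi (E (Suc (Suc k)) - E (Suc k)))"
    using Suc by (subst prod.lessThan_Suc) simp
  also have "\<zeta> (Suc (Suc k)) powi (E (Suc (Suc k)) - E (Suc k)) =
      \<zeta> (Suc (Suc k)) powi E (Suc (Suc k)) / \<zeta> (Suc (Suc k)) powi E (Suc k)"
    using nz by (simp add: power_int_diff)
  finally show ?case
    by (simp add: power_int_mult_distrib power_int_divide_distrib)
qed

text \<open>
  The constant collects the values of \<open>\<omega>\<close> at degree zero. It does not depend on \<open>\<zeta>\<close>, so the same
  constant serves all shifts.
\<close>
lemma vertex_term_eq:
  assumes p: "p \<ge> 2"
    and \<pi>: "\<And>i. i \<in> {1..p} \<Longrightarrow> bij_betw (\<pi> i) {1..i} {1..i}"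
    and x: "\<And>i j. i \<in> {1..p} \<Longrightarrow> j \<in> {1..i} \<Longrightarrow> x i j = \<alpha> (\<pi> i j)"
  shows "\<exists>C. \<forall>\<zeta> d. (\<forall>i\<in>{1..p}. \<zeta> i \<noteq> 0) \<longrightarrow> d \<in> nat_arrays p \<longrightarrow>
    vertex_term q h p (\<lambda>i j. inverse (x i j)) \<zeta> d = C * array_term p (\<lambda>_. 0) \<zeta> (to_array p \<pi> d)"
proof -
  define C where "C i = (\<Prod>j=1..i. \<Prod>k=1..i. omega (x i j / x i k)) /
     (\<Prod>j=1..i. \<Prod>k=1..i + 1. omega (x i j / x (i + 1) k))" for i
  have "vertex_term q h p (\<lambda>i j. inverse (x i j)) \<zeta> d =
      (\<Prod>i=1..p - 1. C i) * array_term p (\<lambda>_. 0) \<zeta> (to_array p \<pi> d)"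
    if nz: "\<forall>i\<in>{1..p}. \<zeta> i \<noteq> 0" and d: "d \<in> nat_arrays p" for \<zeta> d
  proof -
    define D where "D = row (to_array p \<pi> d)"
    define y where "y i j = x i j * q powi int (d i j)" for i j
    have dp: "d p j = 0" for j using d by (auto simp: nat_arrays_def)
    have Dd: "D i (\<pi> i j) = int (d i j)" if "i \<in> {1..p}" "j \<in> {1..i}" for i j
    proof (cases "i = p")
      case True
      then show ?thesis by (simp add: D_def row_def dp)
    next
      case False
      then show ?thesis using to_array_apply[of \<pi> i p j d] \<pi> that by (auto simp: D_def row_def)
    qed
    have pty: "pt (D i) (\<pi> i j) = y i j" if "i \<in> {1..p}" "j \<in> {1..i}" for i j
      using Dd[OF that] x[OF that] by (simp add: pt_def y_def)
    have totD: "tot i (D i) = int (\<Sum>j=1..i. d i j)" if "i \<in> {1..p}" for i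
    proof -
      have "tot i (D i) = (\<Sum>j\<in>{1..i}. D i (\<pi> i j))"
        unfolding tot_def by (rule sum.reindex_bij_betw[OF \<pi>[OF that], symmetric])
      also have "\<dots> = (\<Sum>j\<in>{1..i}. int (d i j))" using Dd[OF that] by (intro sum.cong) auto
      finally show ?thesis by simp
    qed
    have reindex: "(\<Prod>j\<in>{1..i}. \<Prod>k\<in>{1..l}. omega (pt (D i) j / pt (D l) k)) =
        (\<Prod>j=1..i. \<Prod>k=1..l. omega (y i j / y l k))" if "i \<in> {1..p}" "l \<in> {1..p}" for i l
    proof -
      have "(\<Prod>j\<in>{1..i}. \<Prod>k\<in>{1..l}. omega (pt (D i) j / pt (D l) k)) =
        (\<Prod>j\<in>{1..i}. \<Prod>k\<in>{1..l}. omega (pt (D i) (\<pi> i j) / pt (D l) (\<pi> l k)))"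
        using prod.reindex_bij_betw[OF \<pi>[OF that(1)], of "\<lambda>j. \<Prod>k\<in>{1..l}. omega (pt (D i) j / pt (D l) k)"]
          prod.reindex_bij_betw[OF \<pi>[OF that(2)], of "\<lambda>k. omega (pt (D i) _ / pt (D l) k)"] by simp
      also have "\<dots> = (\<Prod>j=1..i. \<Prod>k=1..l. omega (y i j / y l k))"
        using pty that by (intro prod.cong refl) auto
      finally show ?thesis .
    qed
    have level: "(\<Prod>j = 1..i. \<Prod>k = 1..i.
           qpoch (q * (inverse (x i k) / inverse (x i j))) q (int (d i j) - int (d i k)) /
           qpoch (h * (inverse (x i k) / inverse (x i j))) q (int (d i j) - int (d i k))) *
        (\<Prod>j = 1..i. \<Prod>k = 1..i + 1.
           qpoch (h * (inverse (x (i + 1) k) / inverse (x i j))) q (int (d i j) - int (d (i + 1) k)) /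
           qpoch (q * (inverse (x (i + 1) k) / inverse (x i j))) q (int (d i j) - int (d (i + 1) k))) =
        C i * weight {1..i} {1..Suc i} (D (Suc i)) (D i)" if i: "i \<in> {1..p - 1}" for i
    proof -
      have ip: "i \<in> {1..p}" "Suc i \<in> {1..p}" using i p by auto
      have X: "q powi (int (d i j) - int (d l k)) * (x i j / x l k) = y i j / y l k"
        "inverse (x l k) / inverse (x i j) = x i j / x l k" for j k l
        using q0 by (simp_all add: y_def power_int_diff divide_inverse mult_ac)
      show ?thesis
        unfolding X(2) qpoch_ratio X(1)
        unfolding weight_def reindex[OF ip] reindex[OF ip(1) ip(1)] C_def prod_dividef Suc_eq_plus1[symmetric]
        by (simp del: prod.cl_ivl_Suc)
    qed
    have p1: "Suc (p - 1) = p" using p by simp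
    have mon: "(\<Prod>i<p. t powi tot i (D i) * \<zeta> (Suc i) powi (tot (Suc i) (D (Suc i)) - tot i (D i))) =
      (\<Prod>i=1..p - 1. (q / h * (\<zeta> i / \<zeta> (i + 1))) ^ (\<Sum>j=1..i. d i j))"
    proof -
      have "(\<Prod>i<Suc (p - 1). t powi tot i (D i) * \<zeta> (Suc i) powi (tot (Suc i) (D (Suc i)) - tot i (D i))) =
        \<zeta> (Suc (p - 1)) powi tot (Suc (p - 1)) (D (Suc (p - 1))) * (\<Prod>i=1..p - 1. (t * (\<zeta> i / \<zeta> (Suc i))) powi tot i (D i))"
        using nz p by (intro monomial_telescope[where E = "\<lambda>i. tot i (D i)"]) (auto simp: tot_def)
      also have "tot (Suc (p - 1)) (D (Suc (p - 1))) = 0" unfolding p1 by (simp add: D_def row_def tot_def)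
      also have "(\<Prod>i=1..p - 1. (t * (\<zeta> i / \<zeta> (Suc i))) powi tot i (D i)) =
         (\<Prod>i=1..p - 1. (q / h * (\<zeta> i / \<zeta> (i + 1))) ^ (\<Sum>j=1..i. d i j))"
      proof (intro prod.cong refl)
        fix i assume "i \<in> {1..p - 1}"
        then have "i \<in> {1..p}" using p by auto
        then show "(t * (\<zeta> i / \<zeta> (Suc i))) powi tot i (D i) = (q / h * (\<zeta> i / \<zeta> (i + 1))) ^ (\<Sum>j=1..i. d i j)"
          unfolding totD[OF \<open>i \<in> {1..p}\<close>] power_int_of_nat by (simp add: t_def s_def)
      qed
      finally show ?thesis unfolding p1 by simp
    qed
    have wprod: "(\<Prod>i<p. weight {1..i} {1..Suc i} (D (Suc i)) (D i)) =
        (\<Prod>i=1..p - 1. weight {1..i} {1..Suc i} (D (Suc i)) (D i))"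
    proof -
      have "{..<p} = insert 0 {1..p - 1}" using p by auto
      then show ?thesis by (simp add: weight_def)
    qed
    have "array_term p (\<lambda>_. 0) \<zeta> (to_array p \<pi> d) =
       (\<Prod>i<p. (t powi tot i (D i) * \<zeta> (Suc i) powi (tot (Suc i) (D (Suc i)) - tot i (D i))) *
          weight {1..i} {1..Suc i} (D (Suc i)) (D i))"
      unfolding array_term_row D_def[symmetric] branch_coeff_def by simp
    also have "\<dots> = (\<Prod>i=1..p - 1. (q / h * (\<zeta> i / \<zeta> (i + 1))) ^ (\<Sum>j=1..i. d i j)) *
        (\<Prod>i=1..p - 1. weight {1..i} {1..Suc i} (D (Suc i)) (D i))"
      unfolding prod.distrib[where A = "{..<p}"] mon[unfolded prod.distrib] wprod by (simp add: prod.distrib)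
    finally have at: "array_term p (\<lambda>_. 0) \<zeta> (to_array p \<pi> d) = \<dots>" .
    have "vertex_term q h p (\<lambda>i j. inverse (x i j)) \<zeta> d =
      (\<Prod>i=1..p - 1. (q / h * (\<zeta> i / \<zeta> (i + 1))) ^ (\<Sum>j=1..i. d i j) *
        (C i * weight {1..i} {1..Suc i} (D (Suc i)) (D i)))"
      unfolding vertex_term_def mult.assoc by (intro prod.cong refl) (simp only: level)
    then show ?thesis unfolding at by (simp add: prod.distrib mult_ac)
  qed
  then show ?thesis by blast
qed

text \<open>
  The vertex is summed over fewer degrees than \<open>\<Psi>\<close>, but the difference consists of zeros. Negative
  entries are excluded by \<open>array_term_support\<close>. If a term does not vanish, the degrees decrease along
  each column \<open>l\<close>, and the injection required by \<open>vertex_degrees\<close> sends an index to the one that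
  enumerates the same parameter in the next row.
\<close>
theorem vertex_sum:
  assumes p: "p \<ge> 2"
    and \<pi>: "\<And>i. i \<in> {1..p} \<Longrightarrow> bij_betw (\<pi> i) {1..i} {1..i}"
    and x: "\<And>i j. i \<in> {1..p} \<Longrightarrow> j \<in> {1..i} \<Longrightarrow> x i j = \<alpha> (\<pi> i j)"
  shows "\<exists>C. \<forall>\<zeta>. (\<forall>i\<in>{1..p}. \<zeta> i \<noteq> 0) \<longrightarrow> converges p \<zeta> \<longrightarrow>
    (vertex_term q h p (\<lambda>i j. inverse (x i j)) \<zeta> has_sum C * Psi p (\<lambda>_. 0) \<zeta>) (vertex_degrees p)"
proof -
  let ?f = "vertex_term q h p (\<lambda>i j. inverse (x i j))"
  obtain C where C: "\<And>\<zeta> d. (\<forall>i\<in>{1..p}. \<zeta> i \<noteq> 0) \<Longrightarrow> d \<in> nat_arrays p \<Longrightarrow>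
    ?f \<zeta> d = C * array_term p (\<lambda>_. 0) \<zeta> (to_array p \<pi> d)"
    using vertex_term_eq[OF p \<pi> x] by blast
  have "(?f \<zeta> has_sum C * Psi p (\<lambda>_. 0) \<zeta>) (vertex_degrees p)"
    if nz: "\<forall>i\<in>{1..p}. \<zeta> i \<noteq> 0" and conv: "converges p \<zeta>" for \<zeta>
  proof -
    let ?g = "array_term p (\<lambda>_. 0) \<zeta>"
    define A where "A = {D\<in>arrays p. \<forall>i<p. \<forall>l\<in>{1..i}. D i l \<ge> 0}"
    have "?g summable_on arrays p"
      using conv abs_summable_summable unfolding converges_def by blast
    then have "(?g has_sum Psi p (\<lambda>_. 0) \<zeta>) (arrays p)"
      unfolding Psi_def by (rule has_sum_infsum)
    moreover have "?g D = 0" if "D \<in> arrays p - A" for D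
    proof (rule ccontr)
      assume "?g D \<noteq> 0"
      then have "0 \<le> D i l" if "i < p" "l \<in> {1..i}" for i l
        using array_term_support(2)[of \<zeta> D i l] that by (simp add: row_def)
      then show False using that by (auto simp: A_def)
    qed
    ultimately have "(?g has_sum Psi p (\<lambda>_. 0) \<zeta>) A"
      by (subst has_sum_cong_neutral[where T = "arrays p" and g = ?g]) (auto simp: A_def)
    then have "((\<lambda>d. ?g (to_array p \<pi> d)) has_sum Psi p (\<lambda>_. 0) \<zeta>) (nat_arrays p)"
      using has_sum_reindex_bij_betw[OF bij_to_array[of p \<pi>]] \<pi> unfolding A_def by blast
    then have "((\<lambda>d. C * ?g (to_array p \<pi> d)) has_sum C * Psi p (\<lambda>_. 0) \<zeta>) (nat_arrays p)"
      by (rule has_sum_cmult_right)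
    moreover have "vertex_degrees p \<subseteq> nat_arrays p"
      by (auto simp: vertex_degrees_def nat_arrays_def)
    moreover have "C * ?g (to_array p \<pi> d) = 0" if d: "d \<in> nat_arrays p - vertex_degrees p" for d
    proof (rule ccontr)
      assume "C * ?g (to_array p \<pi> d) \<noteq> 0"
      then have g: "?g (to_array p \<pi> d) \<noteq> 0" by auto
      have "\<exists>s. inj_on s {1..i} \<and> s ` {1..i} \<subseteq> {1..i + 1} \<and> (\<forall>k\<in>{1..i}. d i k \<ge> d (i + 1) (s k))"
        if i: "i \<in> {1..p - 2}" for i
      proof -
        have ip: "i \<in> {1..p}" "Suc i \<in> {1..p}" "i < p" "Suc i < p" using i p by auto
        \<comment> \<open>The index in row \<open>i + 1\<close> of the parameter that has index \<open>k\<close> in row \<open>i\<close>.\<close>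
        define s' where "s' = (\<lambda>k. inv_into {1..Suc i} (\<pi> (Suc i)) (\<pi> i k))"
        have \<pi>i: "\<pi> i k \<in> {1..i}" if "k \<in> {1..i}" for k using \<pi>[OF ip(1)] that bij_betwE by blast
        have im: "\<pi> (Suc i) ` {1..Suc i} = {1..Suc i}" "inj_on (\<pi> i) {1..i}"
          using \<pi>[OF ip(2)] \<pi>[OF ip(1)] by (auto simp: bij_betw_def)
        have mem: "\<pi> i k \<in> \<pi> (Suc i) ` {1..Suc i}" if "k \<in> {1..i}" for k
          unfolding im(1) using \<pi>i[OF that] by auto
        have s1: "s' k \<in> {1..Suc i}" "\<pi> (Suc i) (s' k) = \<pi> i k" if "k \<in> {1..i}" for k
          unfolding s'_def using mem[OF that] by (rule inv_into_into, rule f_inv_into_f)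
        have "inj_on s' {1..i}"
        proof (rule inj_onI)
          fix k k' assume "k \<in> {1..i}" "k' \<in> {1..i}" "s' k = s' k'"
          then show "k = k'" using s1(2) im(2) by (metis inj_onD)
        qed
        moreover have "d (i + 1) (s' k) \<le> d i k" if k: "k \<in> {1..i}" for k
        proof -
          have "row (to_array p \<pi> d) (Suc i) (\<pi> i k) \<le> row (to_array p \<pi> d) i (\<pi> i k)"
            using array_term_support(1)[OF g ip(3) \<pi>i[OF k]] .
          moreover have "row (to_array p \<pi> d) i (\<pi> i k) = int (d i k)"
            using to_array_apply[where \<pi> = \<pi> and n = p and i = i, OF \<pi>[OF ip(1)] ip(3) k] ip(3) by (simp add: row_def)
          moreover have "row (to_array p \<pi> d) (Suc i) (\<pi> i k) = int (d (Suc i) (s' k))"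
            using to_array_apply[where \<pi> = \<pi> and n = p and i = "Suc i", OF \<pi>[OF ip(2)] ip(4) s1(1)[OF k], of d] ip(4) s1(2)[OF k] by (simp add: row_def)
          ultimately show ?thesis by simp
        qed
        ultimately show ?thesis using s1(1) by (intro exI[of _ s']) auto
      qed
      then have "d \<in> vertex_degrees p"
        using d unfolding vertex_degrees_def nat_arrays_def by blast
      then show False using d by blast
    qed
    ultimately have "((\<lambda>d. C * ?g (to_array p \<pi> d)) has_sum C * Psi p (\<lambda>_. 0) \<zeta>) (vertex_degrees p)"
      by (subst has_sum_cong_neutral[where T = "nat_arrays p" and g = "\<lambda>d. C * ?g (to_array p \<pi> d)"]) auto
    then show ?thesis
      using C[OF nz] \<open>vertex_degrees p \<subseteq> nat_arrays p\<close> by (subst has_sum_cong) auto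
  qed
  then show ?thesis by blast
qed

end

section \<open>The operators in coordinates\<close>

text \<open>
  Pairs inside \<open>I\<close> contribute \<open>c\<close>, pairs with one element in \<open>I\<close> contribute the coefficients of the
  tRS operators.
\<close>
lemma vandermonde_ratio_shift:
  assumes "finite N" "I \<subseteq> N" and "\<And>i j. i \<in> N \<Longrightarrow> j \<in> N \<Longrightarrow> i \<noteq> j \<Longrightarrow> z i \<noteq> z j"
  shows "vandermonde_ratio N (shift c I z) z =
    c ^ (card I choose 2) * (\<Prod>i\<in>I. \<Prod>j\<in>N - I. (c * z i - z j) / (z i - z j))"
  using assms
proof (induction N arbitrary: I rule: finite_induct)
  case empty
  then show ?case by (simp add: vandermonde_ratio_def ordered_pairs_def numeral_2_eq_2)
next
  case (insert n N)
  note dist = insert.prems(2)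
  show ?case
  proof (cases "n \<in> I")
    case False
    then have I: "I \<subseteq> N" using insert by auto
    have "(\<Prod>i\<in>N. (shift c I z i - shift c I z n) / (z i - z n)) =
      (\<Prod>i\<in>N. if i \<in> I then (c * z i - z n) / (z i - z n) else 1)"
      using dist insert.hyps False by (intro prod.cong) (auto simp: shift_def)
    also have "\<dots> = (\<Prod>i\<in>I. (c * z i - z n) / (z i - z n))"
      using I insert.hyps by (simp add: prod.If_cases Int_absorb1)
    finally have 1: "(\<Prod>i\<in>N. (shift c I z i - shift c I z n) / (z i - z n)) = \<dots>" .
    have "insert n N - I = insert n (N - I)" using False by auto
    then have 2: "(\<Prod>j\<in>insert n N - I. (c * z i - z j) / (z i - z j)) =
      (c * z i - z n) / (z i - z n) * (\<Prod>j\<in>N - I. (c * z i - z j) / (z i - z j))" for i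
      using insert.hyps by simp
    show ?thesis
      unfolding vandermonde_ratio_insert[OF insert.hyps] 1 2 prod.distrib
      using insert.IH[OF I] dist by simp
  next
    case True
    define I' where "I' = I - {n}"
    have I: "I = insert n I'" "n \<notin> I'" "I' \<subseteq> N" and finI: "finite I'"
      using True insert finite_subset[of I' N] by (auto simp: I'_def)
    have 0: "vandermonde_ratio N (shift c I z) z = vandermonde_ratio N (shift c I' z) z"
      using I insert.hyps by (intro vandermonde_ratio_cong) (auto simp: shift_def)
    have "(\<Prod>i\<in>N. (shift c I z i - shift c I z n) / (z i - z n)) =
      (\<Prod>i\<in>N. if i \<in> I' then c else (c * z n - z i) / (z n - z i))"
    proof (intro prod.cong refl)
      fix i assume i: "i \<in> N"
      then have ne: "i \<noteq> n" "z i \<noteq> z n" using insert.hyps dist by auto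
      show "(shift c I z i - shift c I z n) / (z i - z n) = (if i \<in> I' then c else (c * z n - z i) / (z n - z i))"
      proof (cases "i \<in> I'")
        case True
        have "c * z i - c * z n = c * (z i - z n)" by (simp add: right_diff_distrib)
        then show ?thesis using True I ne by (simp add: shift_def)
      next
        case False
        then have "(shift c I z i - shift c I z n) / (z i - z n) = (z i - c * z n) / (z i - z n)"
          using I ne by (simp add: shift_def)
        also have "\<dots> = (c * z n - z i) / (z n - z i)"
          by (metis minus_diff_eq minus_divide_divide)
        finally show ?thesis using False by simp
      qed
    qed
    also have "\<dots> = c ^ card I' * (\<Prod>i\<in>N - I'. (c * z n - z i) / (z n - z i))"
    proof -
      have "N \<inter> {x. x \<in> I'} = I'" "N \<inter> - {x. x \<in> I'} = N - I'" using I by auto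
      then show ?thesis using insert.hyps by (simp add: prod.If_cases)
    qed
    finally have 1: "(\<Prod>i\<in>N. (shift c I z i - shift c I z n) / (z i - z n)) = \<dots>" .
    have 2: "insert n N - I = N - I'" using I insert.hyps by auto
    have 3: "card I choose 2 = card I' + (card I' choose 2)"
      using I finI by (simp add: numeral_2_eq_2)
    show ?thesis
      unfolding vandermonde_ratio_insert[OF insert.hyps] 0 1 2 3
      using insert.IH[OF I(3)] dist I finI by (simp add: power_add mult_ac)
  qed
qed

lemma tRS_exponent_eq:
  assumes "1 \<le> r" "r \<le> n"
  shows "tRS_exponent n r + (r choose 2) = (n - 1) * r"
proof -
  obtain k where k: "n = r + k" using assms(2) le_Suc_ex by blast
  obtain l where l: "r = Suc l" using assms(1) by (cases r) auto
  have "2 * tRS_exponent n r + 2 * (r choose 2) = 2 * ((n - 1) * r)"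
  proof -
    have e1: "2 * n - r - 1 = l + 2 * k" using k l by simp
    have ev: "even (Suc l * (l + 2 * k))" "even (Suc l * l)" by auto
    have "2 * tRS_exponent n r = Suc l * (l + 2 * k)"
      unfolding tRS_exponent_def e1 unfolding l using ev(1) by (simp del: mult_Suc)
    moreover have "2 * (r choose 2) = Suc l * l"
      unfolding l choose_two using ev(2) by (simp del: mult_Suc)
    moreover have "n - 1 = l + k" using k l by simp
    ultimately show ?thesis unfolding l by (simp add: algebra_simps)
  qed
  then show ?thesis by simp
qed

lemma prod_one_minus_expand:
  fixes a :: "nat \<Rightarrow> complex"
  assumes "finite N"
  shows "(\<Prod>i\<in>N. 1 - v * a i) = (\<Sum>J\<in>Pow N. (- v) ^ card J * (\<Prod>i\<in>J. a i))"
proof -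
  have "(\<Prod>i\<in>N. 1 - v * a i) = (\<Prod>i\<in>N. (- v) * a i + 1)" by simp
  also have "\<dots> = (\<Sum>J\<in>Pow N. (\<Prod>i\<in>J. (- v) * a i) * (\<Prod>i\<in>N - J. 1))"
    by (rule prod_add[OF assms])
  also have "\<dots> = (\<Sum>J\<in>Pow N. (- v) ^ card J * (\<Prod>i\<in>J. a i))"
    unfolding prod.distrib by simp
  finally show ?thesis .
qed

context trs
begin

text \<open>
  The coefficient of \<open>u\<^sup>r\<close> in the eigenvalue equation at \<open>m = 0\<close>. The power of \<open>h\<close> is the quotient of
  \<open>h\<^bsup>r(p-1)\<^esup>\<close>, by which the factors differ from \<open>c\<close>, and \<open>h\<^bsup>r(r-1)/2\<^esup>\<close>, which the pairs inside \<open>I\<close>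
  contribute to the Vandermonde ratio.
\<close>
lemma eigen_operator:
  assumes eigen: "\<And>u. eigen_equation p u \<zeta>" and r: "1 \<le> r" "r \<le> p"
    and dist: "\<And>i j. i \<in> {1..p} \<Longrightarrow> j \<in> {1..p} \<Longrightarrow> i \<noteq> j \<Longrightarrow> \<zeta> i \<noteq> \<zeta> j"
  shows "(\<Sum>I | I \<subseteq> {1..p} \<and> card I = r. (\<Prod>i\<in>I. \<Prod>j\<in>{1..p} - I. (h * \<zeta> i - \<zeta> j) / (\<zeta> i - \<zeta> j)) *
      ((\<Prod>i\<in>I. \<alpha> i * h powi (int p - int i)) * Psi p (\<lambda>_. 0) (shift q I \<zeta>))) =
    h ^ tRS_exponent p r * elem_sym p r \<alpha> * Psi p (\<lambda>_. 0) \<zeta>"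
proof -
  let ?N = "{1..p}"
  define \<psi> where "\<psi> I = Psi p (\<lambda>_. 0) (shift q I \<zeta>)" for I
  define A where "A I = (\<Prod>i\<in>I. \<Prod>j\<in>?N - I. (h * \<zeta> i - \<zeta> j) / (\<zeta> i - \<zeta> j))" for I
  define P where "P = smult (\<psi> {}) (elem_poly ?N \<alpha>)"
  have pt0: "pt (\<lambda>_. 0) i = \<alpha> i" for i by (simp add: pt_def)
  have 1: "poly P v = (\<Sum>I\<in>Pow ?N. (- v) ^ card I * (vandermonde_ratio ?N (shift h I \<zeta>) \<zeta> * (\<Prod>i\<in>I. c i) * \<psi> I))" for v
    using eigen[of v] unfolding eigen_equation_def
    by (auto simp: P_def poly_elem_poly \<psi>_def pt0 shift_coeff_def mult_ac dest!: spec[of _ "\<lambda>_. 0"])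
  have 2: "poly P v = (\<Sum>I\<in>Pow ?N. (- v) ^ card I * ((\<Prod>i\<in>I. \<alpha> i) * \<psi> {}))" for v
    by (simp add: P_def poly_elem_poly prod_one_minus_expand sum_distrib_left mult_ac)
  let ?S = "{I\<in>Pow ?N. card I = r}"
  have S: "{I. I \<subseteq> ?N \<and> card I = r} = ?S" by auto
  have "(\<Sum>I\<in>?S. (-1) ^ r * (vandermonde_ratio ?N (shift h I \<zeta>) \<zeta> * (\<Prod>i\<in>I. c i) * \<psi> I)) =
    (\<Sum>I\<in>?S. (-1) ^ r * ((\<Prod>i\<in>I. \<alpha> i) * \<psi> {}))"
    using coeff_eq_sum_subsets[OF _ 1, of r] coeff_eq_sum_subsets[OF _ 2, of r] by simp
  then have eq: "(\<Sum>I\<in>?S. vandermonde_ratio ?N (shift h I \<zeta>) \<zeta> * (\<Prod>i\<in>I. c i) * \<psi> I) = elem_sym p r \<alpha> * \<psi> {}"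
    unfolding sum_distrib_left[symmetric] elem_sym_def S sum_distrib_right[symmetric] by simp
  have "h ^ (r choose 2) * (\<Sum>I\<in>?S. A I * ((\<Prod>i\<in>I. \<alpha> i * h powi (int p - int i)) * \<psi> I)) =
    h ^ ((p - 1) * r) * (\<Sum>I\<in>?S. vandermonde_ratio ?N (shift h I \<zeta>) \<zeta> * (\<Prod>i\<in>I. c i) * \<psi> I)"
    unfolding sum_distrib_left
  proof (rule sum.cong[OF refl])
    fix I assume I: "I \<in> ?S"
    have v: "vandermonde_ratio ?N (shift h I \<zeta>) \<zeta> = h ^ (r choose 2) * A I"
      unfolding A_def using vandermonde_ratio_shift[of ?N I \<zeta> h] dist I by auto
    have "(\<Prod>i\<in>I. \<alpha> i * h powi (int p - int i)) = (\<Prod>i\<in>I. h ^ (p - 1) * c i)"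
    proof (intro prod.cong refl)
      fix i assume "i \<in> I"
      have e: "int p - int i = int (p - 1) + (1 - int i)" using r by simp
      have "h powi (int p - int i) = h powi int (p - 1) * h powi (1 - int i)"
        unfolding e by (rule power_int_add) (simp add: h0)
      then have "h powi (int p - int i) = h ^ (p - 1) * h powi (1 - int i)"
        by (simp only: power_int_of_nat)
      then show "\<alpha> i * h powi (int p - int i) = h ^ (p - 1) * c i" by (simp add: c_def)
    qed
    also have "\<dots> = h ^ ((p - 1) * r) * (\<Prod>i\<in>I. c i)"
      using I by (simp add: prod.distrib power_mult)
    finally have c: "(\<Prod>i\<in>I. \<alpha> i * h powi (int p - int i)) = \<dots>" .
    show "h ^ (r choose 2) * (A I * ((\<Prod>i\<in>I. \<alpha> i * h powi (int p - int i)) * \<psi> I)) =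
      h ^ ((p - 1) * r) * (vandermonde_ratio ?N (shift h I \<zeta>) \<zeta> * (\<Prod>i\<in>I. c i) * \<psi> I)"
      unfolding v c by (simp only: mult_ac)
  qed
  also have "\<dots> = h ^ (r choose 2) * (h ^ tRS_exponent p r * (elem_sym p r \<alpha> * \<psi> {}))"
    unfolding eq tRS_exponent_eq[OF r, symmetric] by (simp add: power_add mult_ac)
  finally have "(\<Sum>I\<in>?S. A I * ((\<Prod>i\<in>I. \<alpha> i * h powi (int p - int i)) * \<psi> I)) =
    h ^ tRS_exponent p r * (elem_sym p r \<alpha> * \<psi> {})" using h0 by simp
  then show ?thesis unfolding A_def \<psi>_def S by (simp add: mult.assoc)
qed

text \<open>
  \<open>\<theta>(q y) = - \<theta>(y) / y\<close> in numerator and denominator. The quotient of the two arguments,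
  \<open>\<alpha>\<^sub>i \<zeta>\<^sub>i / (h\<^bsup>i-n\<^esup> \<zeta>\<^sub>i)\<close>, is independent of \<open>\<zeta>\<close>.
\<close>
lemma theta_prefactor_shift:
  assumes "I \<subseteq> {1..p}" "\<And>i. i \<in> {1..p} \<Longrightarrow> \<zeta> i \<noteq> 0"
  shows "(\<Prod>i=1..p. qtheta (h powi (int i - int p) * shift q I \<zeta> i) q / qtheta (\<alpha> i * shift q I \<zeta> i) q) =
    (\<Prod>i\<in>I. \<alpha> i * h powi (int p - int i)) *
    (\<Prod>i=1..p. qtheta (h powi (int i - int p) * \<zeta> i) q / qtheta (\<alpha> i * \<zeta> i) q)"
proof -
  have "(\<Prod>i=1..p. qtheta (h powi (int i - int p) * shift q I \<zeta> i) q / qtheta (\<alpha> i * shift q I \<zeta> i) q) =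
    (\<Prod>i=1..p. (if i \<in> I then \<alpha> i * h powi (int p - int i) else 1) *
      (qtheta (h powi (int i - int p) * \<zeta> i) q / qtheta (\<alpha> i * \<zeta> i) q))"
  proof (intro prod.cong refl)
    fix i assume i: "i \<in> {1..p}"
    show "qtheta (h powi (int i - int p) * shift q I \<zeta> i) q / qtheta (\<alpha> i * shift q I \<zeta> i) q =
      (if i \<in> I then \<alpha> i * h powi (int p - int i) else 1) *
      (qtheta (h powi (int i - int p) * \<zeta> i) q / qtheta (\<alpha> i * \<zeta> i) q)"
    proof (cases "i \<in> I")
      case True
      let ?y = "h powi (int i - int p) * \<zeta> i" and ?w = "\<alpha> i * \<zeta> i"
      have nz: "?y \<noteq> 0" "?w \<noteq> 0" "\<zeta> i \<noteq> 0" using assms(2)[OF i] \<alpha>0[OF i] h0 by auto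
      have s: "h powi (int i - int p) * shift q I \<zeta> i = q * ?y" "\<alpha> i * shift q I \<zeta> i = q * ?w"
        using True by simp_all
      have "h powi (int p - int i) * h powi (int i - int p) = 1"
        using h0 by (simp flip: power_int_add)
      then have "?w / ?y = \<alpha> i * h powi (int p - int i)"
        using nz by (simp add: divide_eq_eq)
      moreover have "(- A / ?y) / (- B / ?w) = ?w / ?y * (A / B)" for A B :: complex
        using nz(1,2) by (simp add: mult_ac)
      ultimately show ?thesis
        unfolding s qtheta_shift[OF q1 q0 nz(1)] qtheta_shift[OF q1 q0 nz(2)] using True by (simp only: if_True)
    qed simp
  qed
  also have "\<dots> = (\<Prod>i=1..p. if i \<in> I then \<alpha> i * h powi (int p - int i) else 1) *
      (\<Prod>i=1..p. qtheta (h powi (int i - int p) * \<zeta> i) q / qtheta (\<alpha> i * \<zeta> i) q)"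
    by (rule prod.distrib)
  also have "(\<Prod>i=1..p. if i \<in> I then \<alpha> i * h powi (int p - int i) else 1) =
      (\<Prod>i\<in>I. \<alpha> i * h powi (int p - int i))"
    using assms(1) by (simp add: prod.If_cases Int_absorb1)
  finally show ?thesis .
qed

end

section \<open>Fixed points\<close>

text \<open>
  A full flag of subsets is the same as an ordering of the parameters.
\<close>
lemma fixed_point_params:
  assumes "fixed_point n a V" "inj_on a {1..n}"
  shows "i \<le> n \<Longrightarrow> V i = fp_param V ` {1..i}" and "inj_on (fp_param V) {1..n}"
proof -
  have V0: "V 0 = {}" and Vn: "V n = a ` {1..n}"
    and step: "\<And>i. i \<in> {1..<n} \<Longrightarrow> V i \<subseteq> V (Suc i) \<and> card (V i) = i"
    using assms(1) unfolding fixed_point_def by auto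
  have card: "card (V i) = i" if "i \<le> n" for i
  proof -
    have "i = 0 \<or> i = n \<or> i \<in> {1..<n}" using that by auto
    then consider "i = 0" | "i = n" | "i \<in> {1..<n}" by blast
    then show ?thesis using V0 Vn step card_image[OF assms(2)] by cases auto
  qed
  have ins: "V (Suc i) = insert (fp_param V (Suc i)) (V i) \<and> fp_param V (Suc i) \<notin> V i" if i: "i < n" for i
  proof -
    have sub: "V i \<subseteq> V (Suc i)" using V0 step[of i] i by (cases "i = 0") auto
    have fin: "finite (V (Suc i))" using card[of "Suc i"] i by (intro card_ge_0_finite) auto
    have "card (V (Suc i) - V i) = 1"
      using card_Diff_subset[OF finite_subset[OF sub fin] sub] card[of i] card[of "Suc i"] i by simp
    then obtain w where w: "V (Suc i) - V i = {w}" using card_1_singletonE by blast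
    then have "fp_param V (Suc i) = w" by (simp add: fp_param_def)
    then show ?thesis using w sub by auto
  qed
  show im: "V i = fp_param V ` {1..i}" if "i \<le> n" for i
    using that
  proof (induction i)
    case 0
    then show ?case by (simp add: V0)
  next
    case (Suc i)
    have "{1..Suc i} = insert (Suc i) {1..i}" by auto
    then show ?case using Suc ins[of i] by simp
  qed
  show "inj_on (fp_param V) {1..n}"
    by (rule eq_card_imp_inj_on) (use im[of n] card[of n] in simp_all)
qed

theorem theorem2p10:
  fixes n :: nat and q h :: complex and a :: "nat \<Rightarrow> complex"
    and V :: "nat \<Rightarrow> complex set" and x :: "nat \<Rightarrow> nat \<Rightarrow> complex"
  assumes "n \<ge> 2"
    and "generic_params n q h a"
    and "fixed_point n a V"
    and "enumerates n a V x"
  shows "\<exists>\<epsilon>>0. \<forall>\<zeta>\<in>vertex_region n q a \<epsilon>.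
    (\<forall>I\<subseteq>{1..n}. vertex_term q h n (\<lambda>i j. inverse (x i j)) (shift q I \<zeta>)
        summable_on vertex_degrees n) \<and>
    (\<forall>r\<in>{1..n}. tRS q h n r (dressed_vertex q h n V x) \<zeta> =
        h ^ tRS_exponent n r * elem_sym n r a * dressed_vertex q h n V x \<zeta>)"
proof -
  have gen: "q \<noteq> 0" "norm q < 1" "h \<noteq> 0" "\<And>i. i \<in> {1..n} \<Longrightarrow> a i \<noteq> 0"
    "\<And>i j m. i \<in> {1..n} \<Longrightarrow> j \<in> {1..n} \<Longrightarrow> i \<noteq> j \<Longrightarrow> a i / a j \<noteq> q powi m"
    "\<And>i j m. i \<in> {1..n} \<Longrightarrow> j \<in> {1..n} \<Longrightarrow> h * (a i / a j) \<noteq> q powi m"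
    using assms(2) unfolding generic_params_def by blast+
  define \<alpha> where "\<alpha> = fp_param V"
  have inj_a: "inj_on a {1..n}"
  proof (rule inj_onI, rule ccontr)
    fix i j assume "i \<in> {1..n}" "j \<in> {1..n}" "a i = a j" "i \<noteq> j"
    then show False using gen(5)[of i j 0] gen(4)[of j] by simp
  qed
  have V\<alpha>: "V i = \<alpha> ` {1..i}" if "i \<le> n" for i
    unfolding \<alpha>_def using fixed_point_params(1)[OF assms(3) inj_a that] .
  have inj\<alpha>: "inj_on \<alpha> {1..n}"
    unfolding \<alpha>_def using fixed_point_params(2)[OF assms(3) inj_a] .
  have Vn: "\<alpha> ` {1..n} = a ` {1..n}"
    using V\<alpha>[of n] assms(3) unfolding fixed_point_def by simp
  have ex: "\<exists>k\<in>{1..n}. \<alpha> i = a k" if "i \<in> {1..n}" for i using Vn that by blast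
  interpret trs n q h \<alpha>
  proof
    fix i j :: nat and m :: int
    show "\<alpha> i \<noteq> 0" if "i \<in> {1..n}" using ex[OF that] gen(4) by force
    show "\<alpha> i \<noteq> q powi m * \<alpha> j" if ij: "i \<in> {1..n}" "j \<in> {1..n}" "i \<noteq> j"
    proof -
      obtain k l where kl: "k \<in> {1..n}" "l \<in> {1..n}" "\<alpha> i = a k" "\<alpha> j = a l" using ex ij by metis
      then have "k \<noteq> l" using inj_onD[OF inj\<alpha>, of i j] ij by auto
      then show ?thesis using gen(5)[OF kl(1,2), of m] gen(4)[OF kl(2)] kl by (auto simp: field_simps)
    qed
    show "h * \<alpha> i \<noteq> q powi m * \<alpha> j" if ij: "i \<in> {1..n}" "j \<in> {1..n}"
    proof -
      obtain k l where kl: "k \<in> {1..n}" "l \<in> {1..n}" "\<alpha> i = a k" "\<alpha> j = a l" using ex ij by metis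
      then show ?thesis using gen(6)[OF kl(1,2), of m] gen(4)[OF kl(2)] kl by (auto simp: field_simps)
    qed
  qed (fact gen)+
  define \<pi> where "\<pi> i = (\<lambda>j. inv_into {1..i} \<alpha> (x i j))" for i
  have bijx: "bij_betw (x i) {1..i} (\<alpha> ` {1..i})" if "i \<in> {1..n}" for i
  proof (cases "i = n")
    case True
    have "bij_betw a {1..n} (a ` {1..n})" using inj_a by (rule inj_on_imp_bij_betw)
    then have "bij_betw (x n) {1..n} (\<alpha> ` {1..n})"
      using assms(4) Vn unfolding enumerates_def by (subst bij_betw_cong[of _ _ a]) auto
    then show ?thesis using True by simp
  next
    case False
    then have "bij_betw (x i) {1..i} (V i)" using assms(4) that unfolding enumerates_def by auto
    then show ?thesis using V\<alpha>[of i] that by simp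
  qed
  have inji: "inj_on \<alpha> {1..i}" if "i \<in> {1..n}" for i
    by (rule inj_on_subset[OF inj\<alpha>]) (use that in auto)
  have \<pi>: "bij_betw (\<pi> i) {1..i} {1..i}" if "i \<in> {1..n}" for i
    using bij_betw_trans[OF bijx[OF that] bij_betw_inv_into[OF inj_on_imp_bij_betw[OF inji[OF that]]]]
    unfolding \<pi>_def comp_def .
  have x\<alpha>: "x i j = \<alpha> (\<pi> i j)" if "i \<in> {1..n}" "j \<in> {1..i}" for i j
  proof -
    have "x i j \<in> \<alpha> ` {1..i}" using bijx[OF that(1)] that(2) bij_betwE by blast
    then show ?thesis unfolding \<pi>_def by (simp only: f_inv_into_f)
  qed
  let ?f = "vertex_term q h n (\<lambda>i j. inverse (x i j))"
  obtain C where C: "\<And>\<zeta>. (\<forall>i\<in>{1..n}. \<zeta> i \<noteq> 0) \<Longrightarrow> converges n \<zeta> \<Longrightarrow>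
    (?f \<zeta> has_sum C * Psi n (\<lambda>_. 0) \<zeta>) (vertex_degrees n)"
    using vertex_sum[OF assms(1) \<pi> x\<alpha>] by blast
  obtain \<delta> where \<delta>: "\<delta> > 0" "\<And>\<zeta>. convergence_region \<delta> n \<zeta> \<Longrightarrow> converges n \<zeta>"
    using convergence[of n] by blast
  \<comment> \<open>A shift can enlarge \<open>\<zeta>\<^sub>i / \<zeta>\<^sub>j\<close> by the factor \<open>1 / norm q\<close>; \<open>\<epsilon> \<le> 1\<close> makes smallness of the
      ratios of neighbours pass to all pairs, and keeps the \<open>\<zeta>\<^sub>i\<close> distinct.\<close>
  define \<epsilon> where "\<epsilon> = min 1 (\<delta> * norm q)"
  have \<epsilon>: "\<epsilon> > 0" "\<epsilon> \<le> 1" "\<epsilon> \<le> \<delta> * norm q" using \<delta> gen(1) by (auto simp: \<epsilon>_def)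
  \<comment> \<open>\<open>\<alpha>\<close> is a rearrangement of \<open>a\<close>.\<close>
  have sym: "elem_sym n r \<alpha> = elem_sym n r a" for r
  proof -
    have "elem_poly {1..n} b = (\<Prod>y\<in>b ` {1..n}. [:1, - y:])" if "inj_on b {1..n}" for b
      unfolding elem_poly_def using that by (subst prod.reindex) auto
    then have "elem_poly {1..n} \<alpha> = elem_poly {1..n} a" using inj\<alpha> inj_a Vn by simp
    moreover have "coeff (elem_poly {1..n} b) r = (-1) ^ r * elem_sym n r b" for b
    proof -
      have "coeff (elem_poly {1..n} b) r = (\<Sum>J\<in>{J\<in>Pow {1..n}. card J = r}. (-1) ^ r * (\<Prod>i\<in>J. b i))"
        by (rule coeff_eq_sum_subsets) (simp_all add: poly_elem_poly prod_one_minus_expand)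
      then show ?thesis unfolding elem_sym_def sum_distrib_left by simp
    qed
    ultimately have "(-1) ^ r * elem_sym n r \<alpha> = (-1) ^ r * elem_sym n r a" by metis
    then show ?thesis by simp
  qed
  have main: "(\<forall>I\<subseteq>{1..n}. ?f (shift q I \<zeta>) summable_on vertex_degrees n) \<and>
    (\<forall>r\<in>{1..n}. tRS q h n r (dressed_vertex q h n V x) \<zeta> =
        h ^ tRS_exponent n r * elem_sym n r a * dressed_vertex q h n V x \<zeta>)"
    if region: "\<zeta> \<in> vertex_region n q a \<epsilon>" for \<zeta>
  proof -
    have nz: "\<And>i. i \<in> {1..n} \<Longrightarrow> \<zeta> i \<noteq> 0"
      and small: "\<And>i. i \<in> {1..<n} \<Longrightarrow> norm (\<zeta> i / \<zeta> (i + 1)) < \<epsilon>"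
      using region unfolding vertex_region_def by auto
    have step: "norm (\<zeta> i) < \<epsilon> * norm (\<zeta> (Suc i))" if "i \<in> {1..<n}" for i
      using small[OF that] nz[of "Suc i"] that by (simp add: norm_divide pos_divide_less_eq)
    have chain: "norm (\<zeta> i) < \<epsilon> * norm (\<zeta> j)" if "i < j" "1 \<le> i" "j \<le> n" for i j
      using that(1,3)
    proof (induction j)
      case (Suc j)
      show ?case
      proof (cases "i = j")
        case True
        then show ?thesis using step[of j] that(2) Suc.prems by simp
      next
        case False
        then have "norm (\<zeta> i) < \<epsilon> * norm (\<zeta> j)" using Suc by simp
        also have "\<dots> \<le> \<epsilon> * (\<epsilon> * norm (\<zeta> (Suc j)))"
          using step[of j] that(2) Suc.prems False \<epsilon> by (intro mult_left_mono) auto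
        also have "\<dots> \<le> \<epsilon> * (1 * norm (\<zeta> (Suc j)))"
          using \<epsilon> by (intro mult_left_mono mult_right_mono) auto
        finally show ?thesis by simp
      qed
    qed simp
    have dist: "\<zeta> i \<noteq> \<zeta> j" if "i \<in> {1..n}" "j \<in> {1..n}" "i \<noteq> j" for i j
    proof -
      have "norm (\<zeta> i) < norm (\<zeta> j)" if "i < j" "1 \<le> i" "j \<le> n" for i j
        using chain[OF that] mult_right_mono[OF \<epsilon>(2), of "norm (\<zeta> j)"] by simp
      then show ?thesis using that by (metis atLeastAtMost_iff linorder_neqE_nat order_less_irrefl)
    qed
    have nzI: "\<forall>i\<in>{1..n}. shift q I \<zeta> i \<noteq> 0" for I
      using nz gen(1) by (simp add: shift_def)
    have conv: "converges n (shift q I \<zeta>)" for I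
    proof (rule \<delta>(2), unfold convergence_region_def, intro conjI ballI impI)
      show "shift q I \<zeta> i \<noteq> 0" if "i \<in> {1..n}" for i using nzI that by blast
      fix i j assume ij: "i \<in> {1..n}" "j \<in> {1..n}" "i < j"
      have "norm q * norm (shift q I \<zeta> i) \<le> norm q * norm (\<zeta> i)"
        using gen(2) by (intro mult_left_mono) (auto simp: shift_def norm_mult mult_left_le_one_le)
      also have "\<dots> < norm q * (\<epsilon> * norm (\<zeta> j))"
        using chain[of i j] ij gen(1) by (intro mult_strict_left_mono) auto
      also have "\<dots> \<le> \<epsilon> * norm (shift q I \<zeta> j)"
        using gen(2) \<epsilon>(1) by (auto simp: shift_def norm_mult mult_left_le_one_le)
      also have "\<dots> \<le> \<delta> * norm q * norm (shift q I \<zeta> j)"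
        using \<epsilon>(3) by (intro mult_right_mono) auto
      finally have "norm q * norm (shift q I \<zeta> i) < norm q * (\<delta> * norm (shift q I \<zeta> j))"
        by (simp add: mult_ac)
      then show "norm (shift q I \<zeta> i / shift q I \<zeta> j) < \<delta>"
        using gen(1) nzI ij(2) by (simp add: norm_divide pos_divide_less_eq)
    qed
    have vertex: "(?f (shift q I \<zeta>) has_sum C * Psi n (\<lambda>_. 0) (shift q I \<zeta>)) (vertex_degrees n)" for I
      using C[OF nzI conv] .
    define \<Theta> where "\<Theta> = (\<Prod>i=1..n. qtheta (h powi (int i - int n) * \<zeta> i) q / qtheta (\<alpha> i * \<zeta> i) q)"
    have dressed: "dressed_vertex q h n V x (shift q I \<zeta>) =
        \<Theta> * C * ((\<Prod>i\<in>I. \<alpha> i * h powi (int n - int i)) * Psi n (\<lambda>_. 0) (shift q I \<zeta>))"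
      if "I \<subseteq> {1..n}" for I
    proof -
      have "dressed_vertex q h n V x (shift q I \<zeta>) =
        (\<Prod>i=1..n. qtheta (h powi (int i - int n) * shift q I \<zeta> i) q / qtheta (\<alpha> i * shift q I \<zeta> i) q) *
          (C * Psi n (\<lambda>_. 0) (shift q I \<zeta>))"
        unfolding dressed_vertex_def vertex_def infsumI[OF vertex] \<alpha>_def ..
      also have "\<dots> = (\<Prod>i\<in>I. \<alpha> i * h powi (int n - int i)) * \<Theta> * (C * Psi n (\<lambda>_. 0) (shift q I \<zeta>))"
        unfolding \<Theta>_def using theta_prefactor_shift[of I \<zeta>, OF that nz] by simp
      finally show ?thesis by (simp only: mult_ac)
    qed
    have eigen: "eigen_equation n u \<zeta>" for u
      using eigenvalue_equation[of n \<zeta> u] conv nz dist by blast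
    have "tRS q h n r (dressed_vertex q h n V x) \<zeta> =
        h ^ tRS_exponent n r * elem_sym n r a * dressed_vertex q h n V x \<zeta>" if "r \<in> {1..n}" for r
    proof -
      let ?A = "\<lambda>I. \<Prod>i\<in>I. \<Prod>j\<in>{1..n} - I. (h * \<zeta> i - \<zeta> j) / (\<zeta> i - \<zeta> j)"
      have "tRS q h n r (dressed_vertex q h n V x) \<zeta> = (\<Sum>I | I \<subseteq> {1..n} \<and> card I = r.
          \<Theta> * C * (?A I * ((\<Prod>i\<in>I. \<alpha> i * h powi (int n - int i)) * Psi n (\<lambda>_. 0) (shift q I \<zeta>))))"
        unfolding tRS_def
      proof (rule sum.cong[OF refl])
        fix I assume "I \<in> {I. I \<subseteq> {1..n} \<and> card I = r}"
        then have "I \<subseteq> {1..n}" by simp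
        then show "?A I * dressed_vertex q h n V x (shift q I \<zeta>) =
          \<Theta> * C * (?A I * ((\<Prod>i\<in>I. \<alpha> i * h powi (int n - int i)) * Psi n (\<lambda>_. 0) (shift q I \<zeta>)))"
          unfolding dressed[OF \<open>I \<subseteq> {1..n}\<close>] by (simp only: mult_ac)
      qed
      also have "\<dots> = \<Theta> * C * (h ^ tRS_exponent n r * elem_sym n r \<alpha> * Psi n (\<lambda>_. 0) \<zeta>)"
        unfolding sum_distrib_left[symmetric]
        using that by (subst eigen_operator[OF eigen _ _ dist]) auto
      finally show ?thesis
        using dressed[of "{}"] by (simp add: sym mult_ac)
    qed
    then show ?thesis using has_sum_imp_summable[OF vertex] by blast
  qed
  then show ?thesis using \<epsilon>(1) by blast
qed

end
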